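(* Let $S$ be an arbitrary commutative semiring, $\Sigma$ a ranked alphabet, and $r: T_\Sigma \rightarrow S$ a weighted tree language. Then the following are equivalent: (a) $r$ is recognizable (by a weighted tree automaton over $S$); (b) $r$ is $\mathrm{BTC}((\mathrm{BFO}+\mathrm{mod})_{\mathrm{step}})$-definable; (c) $r$ is $\mathrm{BTC}(\mathrm{BMSO}_{\mathrm{step}})$-definable; (d) $r$ is $\exists\forall((\mathrm{BFO}+\mathrm{mod})_{\mathrm{step}})$-definable; (e) $r$ is $\exists\forall(\mathrm{BMSO}_{\mathrm{step}})$-definable; (f) $r$ is $\mathrm{RMSO}$-definable.
   Context: **Trees.** $\Sigma$ is a ranked alphabet (finite, nonempty), $\Sigma^{(k)}$ its symbols of rank $k$, $\mathrm{maxrk}(\Sigma)$ its maximal rank, $T_\Sigma$ the set of $\Sigma$-trees. For $\xi\in T_\Sigma$, $\mathrm{pos}(\xi)\subseteq\mathbb N_+^*$ is the set of positions (root $\varepsilon$; the $i$-th child of $w$ is $wi$), $\xi(w)$ the label at $w$, $\mathrm{size}(\xi)=|\mathrm{pos}(\xi)|$, $\le$ the prefix order on positions, $|w|$ the length of $w$. $S=(S,+,\cdot,0,1)$ is a commutative semiring (both operations commutative). A weighted tree language is a map $T_\Sigma\to S$. **Weighted tree automata (wta).** A wta over $S$ is $\mathcal A=(Q,\Sigma,\delta,F)$ with $Q$ a finite nonempty set of states, $F\subseteq Q$, and $\delta=(\delta_k\mid k\in\mathbb N)$, $\delta_k:Q^k\times\Sigma^{(k)}\times Q\to S$. Define $h:T_\Sigma\to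 S^Q$ by $h(\sigma(\xi_1,\dots,\xi_l))_q=\sum_{p_1\dots p_l\in Q^l}\delta_l(p_1\dots p_l,\sigma,q)\cdot\prod_{i=1}^l h(\xi_i)_{p_i}$. $\mathcal A$ recognizes $r_{\mathcal A}(\xi)=\sum_{q\in F}h(\xi)_q$. $r$ is recognizable if $r=r_{\mathcal A}$ for some wta $\mathcal A$ over $S$. **Weighted MSO.** MSO-formulas over $\Sigma$ and $S$: $\varphi::=a\mid\mathrm{label}_\sigma(x)\mid\mathrm{edge}_i(x,y)\mid x\le y\mid x\in X\mid\neg\varphi\mid\varphi\vee\varphi\mid\varphi\wedge\varphi\mid\exists x.\varphi\mid\forall x.\varphi\mid\exists X.\varphi\mid\forall X.\varphi$, with $a\in S$, $\sigma\in\Sigma$, $1\le i\le\mathrm{maxrk}(\Sigma)$, $x,y$ first-order and $X$ second-order variables. For $\xi\in T_\Sigma$ and an assignment $\rho$ of positions (subsets of $\mathrm{pos}(\xi)$) to the free first-order (second-order) variables, $[\![\varphi]\!](\xi,\rho)\in S$ is: $a$ for $\varphi=a$; for atomic formulas $1$ or $0$ according to whether $\xi(\rho(x))=\sigma$, resp. $\rho(y)=\rho(x)i$, resp. $\rho(x)\le\rho(y)$, resp. $\rho(x)\in\rho(X)$ is true; $[\![\neg\varphi]\!]=1$ if $[\![\varphi]\!]=0$, and $0$ otherwise; $\vee$ is sum, $\wedge$ is product; $\exists x$ ($\exists X$) is the sum and $\forall x$ ($\forall X$) the product over all positions (all subsets of $\mathrm{pos}(\xi)$) assigned to $x$ ($X$).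 Values for free variables are also written as a list: $[\![\varphi]\!](\xi,u_1,\dots,u_n)$. For a class $\mathcal L$ of MSO-formulas, $r$ is $\mathcal L$-definable if $r=[\![\varphi]\!]$ for a sentence $\varphi\in\mathcal L$. **Fragments.** - BMSO: $\varphi::=0\mid1\mid\mathrm{label}_\sigma(x)\mid\mathrm{edge}_i(x,y)\mid x\le y\mid x\in X\mid\neg\varphi\mid\varphi\wedge\varphi\mid\forall x.\varphi\mid\forall X.\varphi$ (its formulas only take values $0,1$). - $|x|\equiv_n m$ ($n\in\mathbb N_+$, $0\le m<n$) abbreviates a BMSO-formula with one free variable $x$ and semantics $[\![|x|\equiv_n m]\!](\xi,v)=1$ if $|v|\equiv m \pmod n$, and $0$ otherwise (it expresses: every set $X$ of positions that contains $x$ and contains, with each $y\in X$ of length $\ge n$, also the prefix of $y$ of length $|y|-n$, contains a position of length $m$). - BFO+mod: $\varphi::=0\mid1\mid\mathrm{label}_\sigma(x)\mid\mathrm{edge}_i(x,y)\mid x\le y\mid x\in X\mid |x|\equiv_n m\mid\neg\varphi\mid\varphi\wedge\varphi\mid\forall x.\varphi$. - For $\mathcal L\subseteq\mathrm{BMSO}$ closed under $\wedge,\neg$, the class $\mathcal L_{\mathrm{step}}$ of $\mathcal L$-step formulas: $\varphi::=a\mid\alpha\mid\neg\varphi\mid\varphi\vee\varphi\mid\varphi\wedge\varphi$ with $a\in S$, $\alpha\in\mathcal L$. - $\exists\forall(\mathcal L)$: all formulas $\exists X.\forall x.\theta(X,x)$ with $\theta\in\mathcal L$ having free variables $X$ and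 $x$. - RMSO: $\varphi::=a\mid\mathrm{label}_\sigma(x)\mid\mathrm{edge}_i(x,y)\mid x\le y\mid x\in X\mid\neg\psi\mid\varphi\vee\varphi\mid\varphi\wedge\varphi\mid\exists x.\varphi\mid\forall x.\psi\mid\exists X.\varphi\mid\forall X.\chi$ with $\psi\in\mathrm{BMSO}_{\mathrm{step}}$, $\chi\in\mathrm{BMSO}$. **Branching transitive closure.** Fix $n\in\mathbb N_+$. The base position $\langle v\rangle$ of a position $v$ is the unique prefix $u$ of $v$ such that $|u|$ is a multiple of $n$ and $0\le|v|-|u|<n$. For positions $v,v_1,\dots,v_k$ of $\xi$ ($k\ge0$), $\psi_k^\xi(v,v_1,\dots,v_k)$ holds iff for all $i$, $\langle v\rangle$ is a prefix of $\langle v_i\rangle$ with $|\langle v_i\rangle|=|\langle v\rangle|+n$, and $\langle v_1\rangle,\dots,\langle v_k\rangle$ are in strict left-to-right (lexicographic) order. For $m\in\mathbb N$ and $\mathcal L\subseteq\mathrm{MSO}$, an $m$-family of formulas in $\mathcal L$ is $\Phi=(\varphi_k(x,y_1,\dots,y_k)\mid0\le k\le m)$ with $\varphi_k\in\mathcal L$ having free variables $x,y_1,\dots,y_k$. It is $n$-progressing if for all $0\le k\le m$, $\xi\in T_\Sigma$, $v,v_1,\dots,v_k\in\mathrm{pos}(\xi)$: $[\![\varphi_k]\!](\xi,v,v_1,\dots,v_k)\ne0$ implies $\psi_k^\xi(v,v_1,\dots,v_k)$. With pairwise distinct first-order variables $x_w$ ($w\in\mathbb N_+^*$), define $\mathrm{BTC}^1_w(\Phi)=\varphi_0(x_w)$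 and, for $l\ge1$, $$\mathrm{BTC}^{l+1}_w(\Phi)=\bigvee_{1\le k\le m}\exists x_{w1}\dots\exists x_{wk}.\ \varphi_k(x_w,x_{w1},\dots,x_{wk})\wedge\bigvee_{\substack{l_1,\dots,l_k\in\mathbb N_+\\l_1+\dots+l_k=l}}\ \bigwedge_{1\le i\le k}\mathrm{BTC}^{l_i}_{wi}(\Phi)$$ (an empty disjunction has value $0$). Put $[\![\mathrm{BTC}(\Phi)]\!](\xi,v)=\sum_{1\le l\le\mathrm{size}(\xi)}[\![\mathrm{BTC}^l_\varepsilon(\Phi)]\!](\xi,v)$. $r$ is $\mathrm{BTC}(\mathcal L)$-definable if there are $m\in\mathbb N$, $n\in\mathbb N_+$ and an $m$-family $\Phi$ of $n$-progressing formulas in $\mathcal L$ with $r(\xi)=[\![\mathrm{BTC}(\Phi)]\!](\xi,\varepsilon)$ for all $\xi\in T_\Sigma$. *)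

theory Defs
  imports "HOL-Library.Sublist"
begin

section \<open>Trees\<close>

text \<open>
  The ranked alphabet is a finite type \<open>'f\<close> together with a rank function \<open>rk\<close>. The
  weights live in a type of sort \<open>{comm_semiring_0, comm_monoid_mult}\<close>: this is a
  commutative semiring with \<open>0\<close> and \<open>1\<close> in which, unlike in class \<open>comm_semiring_1\<close>, \<open>0 = 1\<close> is
  not excluded.
\<close>

datatype 'f tree = Node 'f "'f tree list"

inductive_set trees :: "('f \<Rightarrow> nat) \<Rightarrow> 'f tree set" for rk where
  "\<lbrakk>length ts = rk f; \<And>t. t \<in> set ts \<Longrightarrow> t \<in> trees rk\<rbrakk> \<Longrightarrow> Node f ts \<in> trees rk"

definition maxrk :: "('f::finite \<Rightarrow> nat) \<Rightarrow> nat" where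
  "maxrk rk = Max (range rk)"

lemma size_nth_less [termination_simp]:
  "i < length ts \<Longrightarrow> size (ts ! i) < Suc (size_list size ts)"
  by (simp add: less_Suc_eq_le size_list_estimation' [OF nth_mem])

text \<open>Positions are lists of positive numbers; child \<open>i\<close> (counted from 1) of a node is \<open>ts ! (i - 1)\<close>.\<close>

fun pos :: "'f tree \<Rightarrow> nat list set" where
  "pos (Node f ts) = insert [] (\<Union>i\<in>{1..length ts}. (\<lambda>w. i # w) ` pos (ts ! (i - 1)))"

fun label_at :: "'f tree \<Rightarrow> nat list \<Rightarrow> 'f" where
  "label_at (Node f ts) [] = f"
| "label_at (Node f ts) (i # w) = label_at (ts ! (i - 1)) w"


section \<open>Weighted tree automata\<close>

text \<open>
  The family \<open>\<delta>\<^sub>k\<close> is a single function, as \<open>k\<close> is the length of the list of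
  states. Only its values on lists over \<open>states\<close> whose length is the rank of the symbol matter.
\<close>

record ('q, 'f, 's) wta =
  states :: "'q set"
  trans :: "'q list \<Rightarrow> 'f \<Rightarrow> 'q \<Rightarrow> 's"
  final :: "'q set"

definition is_wta :: "('q, 'f, 's) wta \<Rightarrow> bool" where
  "is_wta A \<longleftrightarrow> finite (states A) \<and> states A \<noteq> {} \<and> final A \<subseteq> states A"

fun run_weight ::
  "('q, 'f, 's::{comm_semiring_0, comm_monoid_mult}) wta \<Rightarrow> 'f tree \<Rightarrow> 'q \<Rightarrow> 's" where
  "run_weight A (Node f ts) q =
    (\<Sum>ps\<in>{ps. length ps = length ts \<and> set ps \<subseteq> states A}.
      trans A ps f q * (\<Prod>i<length ts. run_weight A (ts ! i) (ps ! i)))"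

definition wta_language ::
  "('q, 'f, 's::{comm_semiring_0, comm_monoid_mult}) wta \<Rightarrow> 'f tree \<Rightarrow> 's" where
  "wta_language A \<xi> = (\<Sum>q\<in>final A. run_weight A \<xi> q)"

text \<open>States are numbers without loss of generality, since state sets are finite.\<close>

definition recognizable ::
  "('f \<Rightarrow> nat) \<Rightarrow> ('f tree \<Rightarrow> 's::{comm_semiring_0, comm_monoid_mult}) \<Rightarrow> bool" where
  "recognizable rk r \<longleftrightarrow>
    (\<exists>A :: (nat, 'f, 's) wta. is_wta A \<and> (\<forall>\<xi>\<in>trees rk. r \<xi> = wta_language A \<xi>))"


section \<open>Weighted MSO\<close>

text \<open>
  First-order variables are of type \<open>'v\<close>, second-order variables are numbers. The condition
  \<open>1 \<le> i \<le> maxrk rk\<close> on \<open>Edge i x y\<close> is part of the definitions of the fragments.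
\<close>

datatype ('f, 's, 'v) mso =
    Const 's
  | Label 'f 'v
  | Edge nat 'v 'v
  | Le 'v 'v
  | In 'v nat
  | Neg "('f, 's, 'v) mso"
  | Or "('f, 's, 'v) mso" "('f, 's, 'v) mso"
  | And "('f, 's, 'v) mso" "('f, 's, 'v) mso"
  | Ex1 'v "('f, 's, 'v) mso"
  | All1 'v "('f, 's, 'v) mso"
  | Ex2 nat "('f, 's, 'v) mso"
  | All2 nat "('f, 's, 'v) mso"

primrec free1 :: "('f, 's, 'v) mso \<Rightarrow> 'v set" where
  "free1 (Const a) = {}"
| "free1 (Label f x) = {x}"
| "free1 (Edge i x y) = {x, y}"
| "free1 (Le x y) = {x, y}"
| "free1 (In x X) = {x}"
| "free1 (Neg \<phi>) = free1 \<phi>"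
| "free1 (Or \<phi> \<psi>) = free1 \<phi> \<union> free1 \<psi>"
| "free1 (And \<phi> \<psi>) = free1 \<phi> \<union> free1 \<psi>"
| "free1 (Ex1 x \<phi>) = free1 \<phi> - {x}"
| "free1 (All1 x \<phi>) = free1 \<phi> - {x}"
| "free1 (Ex2 X \<phi>) = free1 \<phi>"
| "free1 (All2 X \<phi>) = free1 \<phi>"

primrec free2 :: "('f, 's, 'v) mso \<Rightarrow> nat set" where
  "free2 (Const a) = {}"
| "free2 (Label f x) = {}"
| "free2 (Edge i x y) = {}"
| "free2 (Le x y) = {}"
| "free2 (In x X) = {X}"
| "free2 (Neg \<phi>) = free2 \<phi>"
| "free2 (Or \<phi> \<psi>) = free2 \<phi> \<union> free2 \<psi>"
| "free2 (And \<phi> \<psi>) = free2 \<phi> \<union> free2 \<psi>"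
| "free2 (Ex1 x \<phi>) = free2 \<phi>"
| "free2 (All1 x \<phi>) = free2 \<phi>"
| "free2 (Ex2 X \<phi>) = free2 \<phi> - {X}"
| "free2 (All2 X \<phi>) = free2 \<phi> - {X}"

primrec sem ::
  "('f, 's::{comm_semiring_0, comm_monoid_mult}, 'v) mso \<Rightarrow> 'f tree \<Rightarrow>
    ('v \<Rightarrow> nat list) \<Rightarrow> (nat \<Rightarrow> nat list set) \<Rightarrow> 's" where
  "sem (Const a) \<xi> \<rho> \<tau> = a"
| "sem (Label f x) \<xi> \<rho> \<tau> = (if label_at \<xi> (\<rho> x) = f then 1 else 0)"
| "sem (Edge i x y) \<xi> \<rho> \<tau> = (if \<rho> y = \<rho> x @ [i] then 1 else 0)"
| "sem (Le x y) \<xi> \<rho> \<tau> = (if prefix (\<rho> x) (\<rho> y) then 1 else 0)"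
| "sem (In x X) \<xi> \<rho> \<tau> = (if \<rho> x \<in> \<tau> X then 1 else 0)"
| "sem (Neg \<phi>) \<xi> \<rho> \<tau> = (if sem \<phi> \<xi> \<rho> \<tau> = 0 then 1 else 0)"
| "sem (Or \<phi> \<psi>) \<xi> \<rho> \<tau> = sem \<phi> \<xi> \<rho> \<tau> + sem \<psi> \<xi> \<rho> \<tau>"
| "sem (And \<phi> \<psi>) \<xi> \<rho> \<tau> = sem \<phi> \<xi> \<rho> \<tau> * sem \<psi> \<xi> \<rho> \<tau>"
| "sem (Ex1 x \<phi>) \<xi> \<rho> \<tau> = (\<Sum>v\<in>pos \<xi>. sem \<phi> \<xi> (\<rho>(x := v)) \<tau>)"
| "sem (All1 x \<phi>) \<xi> \<rho> \<tau> = (\<Prod>v\<in>pos \<xi>. sem \<phi> \<xi> (\<rho>(x := v)) \<tau>)"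
| "sem (Ex2 X \<phi>) \<xi> \<rho> \<tau> = (\<Sum>V\<in>Pow (pos \<xi>). sem \<phi> \<xi> \<rho> (\<tau>(X := V)))"
| "sem (All2 X \<phi>) \<xi> \<rho> \<tau> = (\<Prod>V\<in>Pow (pos \<xi>). sem \<phi> \<xi> \<rho> (\<tau>(X := V)))"

text \<open>The value of a sentence does not depend on the assignments, so dummy ones are used.\<close>

definition definable ::
  "('f \<Rightarrow> nat) \<Rightarrow> ('f, 's, nat) mso set \<Rightarrow>
    ('f tree \<Rightarrow> 's::{comm_semiring_0, comm_monoid_mult}) \<Rightarrow> bool" where
  "definable rk L r \<longleftrightarrow>
    (\<exists>\<phi>\<in>L. free1 \<phi> = {} \<and> free2 \<phi> = {} \<and>
      (\<forall>\<xi>\<in>trees rk. r \<xi> = sem \<phi> \<xi> (\<lambda>_. []) (\<lambda>_. {})))"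

text \<open>Finite iterations; the empty disjunction has value 0 and the empty conjunction value 1.\<close>

definition Disj :: "('f, 's::zero, 'v) mso list \<Rightarrow> ('f, 's, 'v) mso" where
  "Disj \<phi>s = foldr Or \<phi>s (Const 0)"

definition Conj :: "('f, 's::one, 'v) mso list \<Rightarrow> ('f, 's, 'v) mso" where
  "Conj \<phi>s = foldr And \<phi>s (Const 1)"


section \<open>Fragments\<close>

inductive_set BMSO :: "('f::finite \<Rightarrow> nat) \<Rightarrow> ('f, 's::{zero, one}, nat) mso set" for rk where
  "Const 0 \<in> BMSO rk"
| "Const 1 \<in> BMSO rk"
| "Label f x \<in> BMSO rk"
| "1 \<le> i \<Longrightarrow> i \<le> maxrk rk \<Longrightarrow> Edge i x y \<in> BMSO rk"
| "Le x y \<in> BMSO rk"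
| "In x X \<in> BMSO rk"
| "\<phi> \<in> BMSO rk \<Longrightarrow> Neg \<phi> \<in> BMSO rk"
| "\<phi> \<in> BMSO rk \<Longrightarrow> \<psi> \<in> BMSO rk \<Longrightarrow> And \<phi> \<psi> \<in> BMSO rk"
| "\<phi> \<in> BMSO rk \<Longrightarrow> All1 x \<phi> \<in> BMSO rk"
| "\<phi> \<in> BMSO rk \<Longrightarrow> All2 X \<phi> \<in> BMSO rk"

text \<open>
  \<open>|x| \<equiv>\<^sub>n m\<close> as a \<open>BMSO\<close>-formula: every set \<open>X\<close> that contains \<open>x\<close> and is closed under going
  up \<open>n\<close> steps contains a position of length \<open>m\<close>. Implication and existential
  quantification are expressed by \<open>Neg\<close>, \<open>And\<close> and \<open>All1\<close>. The formula \<open>upath rk k z\<close> says that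
  \<open>z, z + 1, \<dots>, z + k\<close> is a downward path. The bound first-order variables are \<open>x + 1\<close>,
  \<open>x + 2\<close>, \<open>\<dots>\<close>, and the bound second-order variable is \<open>0\<close>.
\<close>

definition bImp :: "('f, 's, 'v) mso \<Rightarrow> ('f, 's, 'v) mso \<Rightarrow> ('f, 's, 'v) mso" where
  "bImp \<phi> \<psi> = Neg (And \<phi> (Neg \<psi>))"

definition uedge :: "('f::finite \<Rightarrow> nat) \<Rightarrow> 'v \<Rightarrow> 'v \<Rightarrow> ('f, 's::{zero, one}, 'v) mso" where
  "uedge rk x y = Neg (Conj (map (\<lambda>i. Neg (Edge i x y)) [1..<Suc (maxrk rk)]))"

definition upath :: "('f::finite \<Rightarrow> nat) \<Rightarrow> nat \<Rightarrow> nat \<Rightarrow> ('f, 's::{zero, one}, nat) mso" where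
  "upath rk k z = Conj (map (\<lambda>j. uedge rk (z + j) (z + j + 1)) [0..<k])"

definition up_closed :: "('f::finite \<Rightarrow> nat) \<Rightarrow> nat \<Rightarrow> nat \<Rightarrow> ('f, 's::{zero, one}, nat) mso" where
  "up_closed rk n z =
    foldr All1 [z..<z + n + 1] (bImp (And (upath rk n z) (In (z + n) 0)) (In z 0))"

definition has_length :: "('f::finite \<Rightarrow> nat) \<Rightarrow> nat \<Rightarrow> nat \<Rightarrow> ('f, 's::{zero, one}, nat) mso" where
  "has_length rk m z =
    Neg (foldr All1 [z..<z + m + 1]
      (Neg (And (All1 (z + 1) (Le z (z + 1))) (And (upath rk m z) (In (z + m) 0)))))"

definition Mod_eq :: "('f::finite \<Rightarrow> nat) \<Rightarrow> nat \<Rightarrow> nat \<Rightarrow> nat \<Rightarrow> ('f, 's::{zero, one}, nat) mso" where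
  "Mod_eq rk n m x =
    All2 0 (bImp (And (In x 0) (up_closed rk n (x + 1))) (has_length rk m (x + 1)))"

text \<open>Boolean values in \<open>'s\<close>; \<open>of_bool\<close> would require \<open>0 \<noteq> 1\<close>.\<close>

abbreviation tv :: "bool \<Rightarrow> 's::{zero, one}" where
  "tv P \<equiv> (if P then 1 else 0)"

lemma prod_tv:
  "finite A \<Longrightarrow>
    (\<Prod>x\<in>A. tv (P x)) = (tv (\<forall>x\<in>A. P x) :: 's::{comm_semiring_0, comm_monoid_mult})"
  by (induction A rule: finite_induct) auto

lemma finite_pos: "finite (pos \<xi>)"
  by (induction \<xi>) auto

lemma Nil_in_pos: "[] \<in> pos \<xi>"
  by (cases \<xi>) simp

lemma pos_prefix: "u @ v \<in> pos \<xi> \<Longrightarrow> u \<in> pos \<xi>"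
proof (induction u arbitrary: \<xi>)
  case (Cons i u)
  then show ?case by (cases \<xi>) auto
qed (simp add: Nil_in_pos)

lemma pos_bounds:
  assumes "\<xi> \<in> trees rk" "w \<in> pos \<xi>" "i \<in> set w"
  shows "1 \<le> i \<and> i \<le> maxrk rk"
  using assms
proof (induction arbitrary: w rule: trees.induct)
  case (1 ts f)
  from 1(4,5) obtain j u where w: "w = j # u" "1 \<le> j" "j \<le> length ts" "u \<in> pos (ts ! (j - 1))"
    by auto
  have "rk f \<le> maxrk rk" by (simp add: maxrk_def)
  moreover have "ts ! (j - 1) \<in> set ts" using w by simp
  ultimately show ?case using 1(1,5) 1(3)[of "ts ! (j - 1)" u] w by auto
qed

lemma sem_Neg: "sem \<phi> \<xi> \<rho> \<tau> = tv P \<Longrightarrow> sem (Neg \<phi>) \<xi> \<rho> \<tau> = tv (\<not> P)"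
  by auto

lemma sem_bImp:
  assumes "sem \<phi> \<xi> \<rho> \<tau> = tv P" "sem \<psi> \<xi> \<rho> \<tau> = tv Q"
  shows "sem (bImp \<phi> \<psi>) \<xi> \<rho> \<tau> = tv (P \<longrightarrow> Q)"
  using assms by (auto simp: bImp_def)

lemma sem_Conj:
  assumes "\<And>i. i \<in> set xs \<Longrightarrow> sem (F i) \<xi> \<rho> \<tau> = tv (P i)"
  shows "sem (Conj (map F xs)) \<xi> \<rho> \<tau> = tv (\<forall>i\<in>set xs. P i)"
  using assms by (induction xs) (auto simp: Conj_def)

lemma sem_uedge:
  "sem (uedge rk x y) \<xi> \<rho> \<tau> = tv (\<exists>i\<in>{1..maxrk rk}. \<rho> y = \<rho> x @ [i])"
proof -
  have "sem (Conj (map (\<lambda>i. Neg (Edge i x y)) [1..<Suc (maxrk rk)])) \<xi> \<rho> \<tau> =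
      tv (\<forall>i\<in>set [1..<Suc (maxrk rk)]. \<rho> y \<noteq> \<rho> x @ [i])"
    by (rule sem_Conj) simp
  from sem_Neg[OF this] show ?thesis
    by (simp add: uedge_def less_Suc_eq_le atLeastLessThanSuc_atLeastAtMost
        del: upt_Suc sem.simps)
qed

definition is_path :: "('f::finite \<Rightarrow> nat) \<Rightarrow> nat \<Rightarrow> nat \<Rightarrow> (nat \<Rightarrow> nat list) \<Rightarrow> bool" where
  "is_path rk k z \<rho> \<longleftrightarrow> (\<forall>j<k. \<exists>i\<in>{1..maxrk rk}. \<rho> (z + Suc j) = \<rho> (z + j) @ [i])"

lemma sem_upath: "sem (upath rk k z) \<xi> \<rho> \<tau> = tv (is_path rk k z \<rho>)"
proof -
  have "sem (upath rk k z) \<xi> \<rho> \<tau> =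
      tv (\<forall>j\<in>set [0..<k]. \<exists>i\<in>{1..maxrk rk}. \<rho> (z + j + 1) = \<rho> (z + j) @ [i])"
    unfolding upath_def by (rule sem_Conj) (rule sem_uedge)
  then show ?thesis
    by (simp add: is_path_def Ball_def)
qed

lemma is_path_append:
  "is_path rk k z \<rho> \<Longrightarrow> \<exists>u. \<rho> (z + k) = \<rho> z @ u \<and> length u = k"
proof (induction k)
  case (Suc k)
  then obtain u where "\<rho> (z + k) = \<rho> z @ u" "length u = k"
    by (auto simp: is_path_def)
  moreover obtain i where "\<rho> (z + Suc k) = \<rho> (z + k) @ [i]"
    using Suc.prems unfolding is_path_def by blast
  ultimately show ?case by (intro exI[of _ "u @ [i]"]) simp
qed simp

lemma is_path_take:
  assumes "\<xi> \<in> trees rk" "y \<in> pos \<xi>" "k \<le> length y"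
    and \<rho>: "\<And>j. j \<le> k \<Longrightarrow> \<rho> (z + j) = take (length y - k + j) y"
  shows "is_path rk k z \<rho>"
  unfolding is_path_def
proof (intro allI impI)
  fix j assume j: "j < k"
  define i where "i = y ! (length y - k + j)"
  have lt: "length y - k + j < length y" using j assms(3) by simp
  then have "i \<in> {1..maxrk rk}"
    using pos_bounds[OF assms(1,2), of i] by (simp add: i_def)
  moreover have "\<rho> (z + Suc j) = \<rho> (z + j) @ [i]"
    using j \<rho>[of j] \<rho>[of "Suc j"] lt by (simp add: i_def take_Suc_conv_app_nth)
  ultimately show "\<exists>i\<in>{1..maxrk rk}. \<rho> (z + Suc j) = \<rho> (z + j) @ [i]" by blast
qed

lemma sem_All1s:
  assumes "\<And>\<rho>. sem \<phi> \<xi> \<rho> \<tau> = tv (P \<rho>)" "distinct xs"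
  shows "sem (foldr All1 xs \<phi>) \<xi> \<rho> \<tau> =
    tv (\<forall>\<rho>'. (\<forall>x. if x \<in> set xs then \<rho>' x \<in> pos \<xi> else \<rho>' x = \<rho> x) \<longrightarrow> P \<rho>')"
  using assms(2)
proof (induction xs arbitrary: \<rho>)
  case Nil
  show ?case by (simp add: assms(1) flip: fun_eq_iff)
next
  case (Cons x xs)
  let ?A = "\<lambda>xs \<rho> \<rho>'. \<forall>y. if y \<in> set xs then \<rho>' y \<in> pos \<xi> else \<rho>' y = \<rho> y"
  have "?A (x # xs) \<rho> \<rho>' \<longleftrightarrow> (\<exists>v\<in>pos \<xi>. ?A xs (\<rho>(x := v)) \<rho>')" for \<rho>'
    using Cons.prems by (auto split: if_splits)
  then have "(\<forall>v\<in>pos \<xi>. \<forall>\<rho>'. ?A xs (\<rho>(x := v)) \<rho>' \<longrightarrow> P \<rho>') \<longleftrightarrow>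
      (\<forall>\<rho>'. ?A (x # xs) \<rho> \<rho>' \<longrightarrow> P \<rho>')"
    by blast
  moreover have "sem (foldr All1 (x # xs) \<phi>) \<xi> \<rho> \<tau> =
      tv (\<forall>v\<in>pos \<xi>. \<forall>\<rho>'. ?A xs (\<rho>(x := v)) \<rho>' \<longrightarrow> P \<rho>')"
    using Cons by (simp add: prod_tv finite_pos)
  ultimately show ?case by (simp only:)
qed

lemma sem_up_closed:
  assumes "\<xi> \<in> trees rk" "\<tau> 0 \<subseteq> pos \<xi>"
  shows "sem (up_closed rk n z) \<xi> \<rho> \<tau> =
    tv (\<forall>y\<in>\<tau> 0. n \<le> length y \<longrightarrow> take (length y - n) y \<in> \<tau> 0)"
proof -
  let ?A = "\<lambda>\<rho>'. \<forall>x. if x \<in> set [z..<z + n + 1] then \<rho>' x \<in> pos \<xi> else \<rho>' x = \<rho> x"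
  let ?P = "\<lambda>\<rho>. is_path rk n z \<rho> \<and> \<rho> (z + n) \<in> \<tau> 0 \<longrightarrow> \<rho> z \<in> \<tau> 0"
  have "sem (up_closed rk n z) \<xi> \<rho> \<tau> = tv (\<forall>\<rho>'. ?A \<rho>' \<longrightarrow> ?P \<rho>')"
    unfolding up_closed_def
    by (rule sem_All1s, subst sem_bImp[where P = "is_path rk n z _ \<and> _ (z + n) \<in> \<tau> 0"])
      (auto simp: sem_upath)
  also have "(\<forall>\<rho>'. ?A \<rho>' \<longrightarrow> ?P \<rho>') \<longleftrightarrow>
      (\<forall>y\<in>\<tau> 0. n \<le> length y \<longrightarrow> take (length y - n) y \<in> \<tau> 0)"
  proof (intro iffI ballI allI impI)
    fix y assume *: "\<forall>\<rho>'. ?A \<rho>' \<longrightarrow> ?P \<rho>'" and y: "y \<in> \<tau> 0" "n \<le> length y"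
    define \<rho>' where "\<rho>' x =
      (if x \<in> set [z..<z + n + 1] then take (length y - n + (x - z)) y else \<rho> x)" for x
    have ypos: "y \<in> pos \<xi>" using y assms by blast
    then have "take j y \<in> pos \<xi>" for j
      using pos_prefix[of "take j y" "drop j y" \<xi>] by simp
    then have "?A \<rho>'" by (simp add: \<rho>'_def del: upt_Suc)
    with * have "?P \<rho>'" by blast
    moreover have "is_path rk n z \<rho>'"
      by (rule is_path_take[OF assms(1) ypos y(2)]) (simp add: \<rho>'_def)
    moreover have "\<rho>' z = take (length y - n) y" by (auto simp: \<rho>'_def)
    moreover have "\<rho>' (z + n) = y" using y by (simp add: \<rho>'_def)
    ultimately show "take (length y - n) y \<in> \<tau> 0"
      using y by simp
  next
    fix \<rho>'
    assume *: "\<forall>y\<in>\<tau> 0. n \<le> length y \<longrightarrow> take (length y - n) y \<in> \<tau> 0"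
      and p: "is_path rk n z \<rho>' \<and> \<rho>' (z + n) \<in> \<tau> 0"
    from p obtain u where "\<rho>' (z + n) = \<rho>' z @ u" "length u = n"
      using is_path_append by blast
    with * p show "\<rho>' z \<in> \<tau> 0" by fastforce
  qed
  finally show ?thesis .
qed

lemma sem_has_length:
  assumes "\<xi> \<in> trees rk" "\<tau> 0 \<subseteq> pos \<xi>"
  shows "sem (has_length rk m z) \<xi> \<rho> \<tau> = tv (\<exists>y\<in>\<tau> 0. length y = m)"
proof -
  let ?A = "\<lambda>\<rho>'. \<forall>x. if x \<in> set [z..<z + m + 1] then \<rho>' x \<in> pos \<xi> else \<rho>' x = \<rho> x"
  let ?P = "\<lambda>\<rho>. \<rho> z = [] \<and> is_path rk m z \<rho> \<and> \<rho> (z + m) \<in> \<tau> 0"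
  have root: "(\<forall>v\<in>pos \<xi>. prefix u v) \<longleftrightarrow> u = []" for u
    using Nil_in_pos[of \<xi>] by (auto dest: bspec)
  have "sem (foldr All1 [z..<z + m + 1]
      (Neg (And (All1 (z + 1) (Le z (z + 1))) (And (upath rk m z) (In (z + m) 0))))) \<xi> \<rho> \<tau> =
      tv (\<forall>\<rho>'. ?A \<rho>' \<longrightarrow> \<not> ?P \<rho>')"
    by (rule sem_All1s) (auto simp: sem_upath prod_tv finite_pos root)
  from sem_Neg[OF this] have "sem (has_length rk m z) \<xi> \<rho> \<tau> = tv (\<exists>\<rho>'. ?A \<rho>' \<and> ?P \<rho>')"
    unfolding has_length_def not_all not_imp not_not .
  also have "(\<exists>\<rho>'. ?A \<rho>' \<and> ?P \<rho>') \<longleftrightarrow> (\<exists>y\<in>\<tau> 0. length y = m)"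
  proof
    assume "\<exists>\<rho>'. ?A \<rho>' \<and> ?P \<rho>'"
    then obtain \<rho>' where "?P \<rho>'" by blast
    moreover then obtain u where "\<rho>' (z + m) = \<rho>' z @ u" "length u = m"
      using is_path_append by blast
    ultimately show "\<exists>y\<in>\<tau> 0. length y = m" by auto
  next
    assume "\<exists>y\<in>\<tau> 0. length y = m"
    then obtain y where y: "y \<in> \<tau> 0" "length y = m" by blast
    define \<rho>' where "\<rho>' x = (if x \<in> set [z..<z + m + 1] then take (x - z) y else \<rho> x)" for x
    have ypos: "y \<in> pos \<xi>" using y assms by blast
    then have "take j y \<in> pos \<xi>" for j
      using pos_prefix[of "take j y" "drop j y" \<xi>] by simp
    then have "?A \<rho>'" by (simp add: \<rho>'_def del: upt_Suc)
    moreover have "is_path rk m z \<rho>'"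
      by (rule is_path_take[OF assms(1) ypos]) (auto simp: \<rho>'_def y)
    moreover have "\<rho>' z = []" "\<rho>' (z + m) = y" using y by (auto simp: \<rho>'_def)
    ultimately show "\<exists>\<rho>'. ?A \<rho>' \<and> ?P \<rho>'" using y by (intro exI[of _ \<rho>']) simp
  qed
  finally show ?thesis .
qed

lemma sem_Mod_eq:
  fixes rk :: "'f::finite \<Rightarrow> nat"
  assumes "\<xi> \<in> trees rk" "\<rho> x \<in> pos \<xi>" "m < n"
  shows "sem (Mod_eq rk n m x :: ('f, 's::{comm_semiring_0, comm_monoid_mult}, nat) mso) \<xi> \<rho> \<tau> =
    tv (length (\<rho> x) mod n = m)"
proof -
  let ?v = "\<rho> x"
  let ?C = "\<lambda>V. ?v \<in> V \<and> (\<forall>y\<in>V. n \<le> length y \<longrightarrow> take (length y - n) y \<in> V)"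
  have "sem (bImp (And (In x 0) (up_closed rk n (x + 1))) (has_length rk m (x + 1)))
      \<xi> \<rho> (\<tau>(0 := V)) = (tv (?C V \<longrightarrow> (\<exists>y\<in>V. length y = m)) :: 's)"
    if "V \<in> Pow (pos \<xi>)" for V
    using that assms(1) by (intro sem_bImp) (auto simp: sem_up_closed sem_has_length)
  then have "sem (Mod_eq rk n m x) \<xi> \<rho> \<tau> =
      (\<Prod>V\<in>Pow (pos \<xi>). (tv (?C V \<longrightarrow> (\<exists>y\<in>V. length y = m)) :: 's))"
    unfolding Mod_eq_def sem.simps by (intro prod.cong refl)
  also have "\<dots> = tv (\<forall>V\<in>Pow (pos \<xi>). ?C V \<longrightarrow> (\<exists>y\<in>V. length y = m))"
    by (rule prod_tv) (simp add: finite_pos)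
  also have "(\<forall>V\<in>Pow (pos \<xi>). ?C V \<longrightarrow> (\<exists>y\<in>V. length y = m)) \<longleftrightarrow> length ?v mod n = m"
  proof (intro iffI ballI impI)
    assume *: "\<forall>V\<in>Pow (pos \<xi>). ?C V \<longrightarrow> (\<exists>y\<in>V. length y = m)"
    define V where "V = {take j ?v | j. j \<le> length ?v \<and> j mod n = length ?v mod n}"
    have "take j ?v \<in> pos \<xi>" for j
      using pos_prefix[of "take j ?v" "drop j ?v" \<xi>] assms(2) by simp
    then have V: "V \<in> Pow (pos \<xi>)" by (auto simp: V_def)
    have "take (length y - n) y \<in> V" if y: "y \<in> V" "n \<le> length y" for y
    proof -
      obtain j where j: "y = take j ?v" "j \<le> length ?v" "j mod n = length ?v mod n"
        using y by (auto simp: V_def)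
      with y have "n \<le> j" by simp
      then have "(j - n) mod n = length ?v mod n" using j by (metis le_mod_geq)
      then show ?thesis using j unfolding V_def by (intro CollectI exI[of _ "j - n"]) auto
    qed
    moreover have "?v \<in> V" unfolding V_def by (intro CollectI exI[of _ "length ?v"]) simp
    ultimately obtain y where "y \<in> V" "length y = m" using bspec[OF * V] by auto
    then show "length ?v mod n = m" using assms(3) by (auto simp: V_def)
  next
    fix V assume mod: "length ?v mod n = m" and C: "?C V"
    have "k * n \<le> length ?v \<longrightarrow> take (length ?v - k * n) ?v \<in> V" for k
    proof (induction k)
      case (Suc k)
      show ?case
      proof
        assume le: "Suc k * n \<le> length ?v"
        let ?y = "take (length ?v - k * n) ?v"
        have "?y \<in> V" "n \<le> length ?y" using Suc le by auto
        with C have "take (length ?y - n) ?y \<in> V" by blast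
        moreover have "take (length ?y - n) ?y = take (length ?v - Suc k * n) ?v"
          by (simp add: min.absorb1 min.absorb2 diff_diff_eq add.commute)
        ultimately show "take (length ?v - Suc k * n) ?v \<in> V" by simp
      qed
    qed (use C in simp)
    from this[of "length ?v div n"] have "take (length ?v mod n) ?v \<in> V"
      by (simp add: minus_div_mult_eq_mod)
    moreover have "length (take (length ?v mod n) ?v) = m"
      using mod by (auto simp: min.absorb2)
    ultimately show "\<exists>y\<in>V. length y = m" by blast
  qed
  finally show ?thesis .
qed

lemma Conj_in_BMSO: "set \<phi>s \<subseteq> BMSO rk \<Longrightarrow> Conj \<phi>s \<in> BMSO rk"
  by (induction \<phi>s) (auto simp: Conj_def intro: BMSO.intros)

lemma All1s_in_BMSO: "\<phi> \<in> BMSO rk \<Longrightarrow> foldr All1 xs \<phi> \<in> BMSO rk"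
  by (induction xs) (auto intro: BMSO.intros)

lemma Mod_eq_in_BMSO:
  fixes rk :: "'f::finite \<Rightarrow> nat"
  shows "(Mod_eq rk n m x :: ('f, 's::{zero, one}, nat) mso) \<in> BMSO rk"
proof -
  have "(uedge rk y z :: ('f, 's, nat) mso) \<in> BMSO rk" for y z
    unfolding uedge_def by (intro BMSO.intros Conj_in_BMSO) (auto intro!: BMSO.intros)
  then have "(upath rk k z :: ('f, 's, nat) mso) \<in> BMSO rk" for k z
    unfolding upath_def by (intro Conj_in_BMSO) auto
  then show ?thesis
    unfolding Mod_eq_def up_closed_def has_length_def bImp_def
    by (intro BMSO.intros All1s_in_BMSO)
qed

lemma free1_Conj: "free1 (Conj \<phi>s) = (\<Union>\<phi>\<in>set \<phi>s. free1 \<phi>)"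
  and free2_Conj: "free2 (Conj \<phi>s) = (\<Union>\<phi>\<in>set \<phi>s. free2 \<phi>)"
  by (induction \<phi>s) (auto simp: Conj_def)

lemma free1_All1s: "free1 (foldr All1 xs \<phi>) = free1 \<phi> - set xs"
  and free2_All1s: "free2 (foldr All1 xs \<phi>) = free2 \<phi>"
  by (induction xs) auto

lemma free_upath: "free1 (upath rk k z) \<subseteq> {z..z + k}" "free2 (upath rk k z) = {}"
  by (auto simp: upath_def uedge_def free1_Conj free2_Conj simp del: upt_Suc)

lemma free_Mod_eq:
  fixes rk :: "'f::finite \<Rightarrow> nat"
  shows "free1 (Mod_eq rk n m x :: ('f, 's::{zero, one}, nat) mso) = {x}"
    and "free2 (Mod_eq rk n m x :: ('f, 's, nat) mso) = {}"
proof -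
  have "free1 (up_closed rk n z :: ('f, 's, nat) mso) = {}" for z
    using free_upath(1)[of rk n z] by (auto simp: up_closed_def bImp_def free1_All1s simp del: upt_Suc)
  moreover have "free1 (has_length rk m z :: ('f, 's, nat) mso) = {}" for z
    using free_upath(1)[of rk m z] by (auto simp: has_length_def free1_All1s simp del: upt_Suc)
  ultimately show "free1 (Mod_eq rk n m x :: ('f, 's, nat) mso) = {x}"
    by (simp add: Mod_eq_def bImp_def)
  show "free2 (Mod_eq rk n m x :: ('f, 's, nat) mso) = {}"
    by (simp add: Mod_eq_def bImp_def up_closed_def has_length_def free2_All1s free_upath)
qed

inductive_set BFO_mod :: "('f::finite \<Rightarrow> nat) \<Rightarrow> ('f, 's::{zero, one}, nat) mso set" for rk where
  "Const 0 \<in> BFO_mod rk"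
| "Const 1 \<in> BFO_mod rk"
| "Label f x \<in> BFO_mod rk"
| "1 \<le> i \<Longrightarrow> i \<le> maxrk rk \<Longrightarrow> Edge i x y \<in> BFO_mod rk"
| "Le x y \<in> BFO_mod rk"
| "In x X \<in> BFO_mod rk"
| "m < n \<Longrightarrow> Mod_eq rk n m x \<in> BFO_mod rk"
| "\<phi> \<in> BFO_mod rk \<Longrightarrow> Neg \<phi> \<in> BFO_mod rk"
| "\<phi> \<in> BFO_mod rk \<Longrightarrow> \<psi> \<in> BFO_mod rk \<Longrightarrow> And \<phi> \<psi> \<in> BFO_mod rk"
| "\<phi> \<in> BFO_mod rk \<Longrightarrow> All1 x \<phi> \<in> BFO_mod rk"

inductive_set step :: "('f, 's, nat) mso set \<Rightarrow> ('f, 's, nat) mso set" for L where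
  "Const a \<in> step L"
| "\<alpha> \<in> L \<Longrightarrow> \<alpha> \<in> step L"
| "\<phi> \<in> step L \<Longrightarrow> Neg \<phi> \<in> step L"
| "\<phi> \<in> step L \<Longrightarrow> \<psi> \<in> step L \<Longrightarrow> Or \<phi> \<psi> \<in> step L"
| "\<phi> \<in> step L \<Longrightarrow> \<psi> \<in> step L \<Longrightarrow> And \<phi> \<psi> \<in> step L"

definition EA :: "('f, 's, nat) mso set \<Rightarrow> ('f, 's, nat) mso set" where
  "EA L = {Ex2 X (All1 x \<theta>) | X x \<theta>. \<theta> \<in> L \<and> free1 \<theta> \<subseteq> {x} \<and> free2 \<theta> \<subseteq> {X}}"

inductive_set RMSO :: "('f::finite \<Rightarrow> nat) \<Rightarrow> ('f, 's::{zero, one}, nat) mso set" for rk where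
  "Const a \<in> RMSO rk"
| "Label f x \<in> RMSO rk"
| "1 \<le> i \<Longrightarrow> i \<le> maxrk rk \<Longrightarrow> Edge i x y \<in> RMSO rk"
| "Le x y \<in> RMSO rk"
| "In x X \<in> RMSO rk"
| "\<psi> \<in> step (BMSO rk) \<Longrightarrow> Neg \<psi> \<in> RMSO rk"
| "\<phi> \<in> RMSO rk \<Longrightarrow> \<psi> \<in> RMSO rk \<Longrightarrow> Or \<phi> \<psi> \<in> RMSO rk"
| "\<phi> \<in> RMSO rk \<Longrightarrow> \<psi> \<in> RMSO rk \<Longrightarrow> And \<phi> \<psi> \<in> RMSO rk"
| "\<phi> \<in> RMSO rk \<Longrightarrow> Ex1 x \<phi> \<in> RMSO rk"
| "\<psi> \<in> step (BMSO rk) \<Longrightarrow> All1 x \<psi> \<in> RMSO rk"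
| "\<phi> \<in> RMSO rk \<Longrightarrow> Ex2 X \<phi> \<in> RMSO rk"
| "\<chi> \<in> BMSO rk \<Longrightarrow> All2 X \<chi> \<in> RMSO rk"


section \<open>Branching transitive closure\<close>

definition base :: "nat \<Rightarrow> nat list \<Rightarrow> nat list" where
  "base n v = (THE u. prefix u v \<and> n dvd length u \<and> length v - length u < n)"

lemma base_eq:
  assumes "0 < n"
  shows "base n v = take (length v - length v mod n) v"
  unfolding base_def
proof (rule the_equality)
  show "prefix (take (length v - length v mod n) v) v \<and>
    n dvd length (take (length v - length v mod n) v) \<and>
    length v - length (take (length v - length v mod n) v) < n"
    using assms by (simp add: take_is_prefix dvd_minus_mod)
next
  fix u assume u: "prefix u v \<and> n dvd length u \<and> length v - length u < n"
  then have le: "length u \<le> length v" by (auto dest: prefix_length_le)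
  have "length v = (length v - length u) + length u" using le by simp
  then have "length v mod n = (length v - length u) mod n"
    using u by (metis add.right_neutral dvd_eq_mod_eq_0 mod_add_right_eq)
  then have "length v - length v mod n = length u" using u le by simp
  moreover obtain zs where "v = u @ zs" using u by (auto simp: prefix_def)
  ultimately show "u = take (length v - length v mod n) v" by (metis append_eq_conv_conj)
qed

text \<open>The relation \<open>\<psi>\<^sub>k\<^sup>\<xi>(v, v\<^sub>1, \<dots>, v\<^sub>k)\<close> for the list \<open>vs\<close> of the \<open>v\<^sub>i\<close>.\<close>

definition next_base :: "nat \<Rightarrow> nat list \<Rightarrow> nat list list \<Rightarrow> bool" where
  "next_base n v vs \<longleftrightarrow>
    (\<forall>u\<in>set vs. prefix (base n v) (base n u) \<and> length (base n u) = length (base n v) + n) \<and>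
    sorted_wrt (\<lambda>u u'. (u, u') \<in> lexord less_than) (map (base n) vs)"

text \<open>
  In the members \<open>\<phi>\<^sub>k(x, y\<^sub>1, \<dots>, y\<^sub>k)\<close> of a family, the variable \<open>x\<close> is \<open>0\<close> and \<open>y\<^sub>i\<close> is \<open>i\<close>.
\<close>

definition is_family :: "('f, 's, nat) mso set \<Rightarrow> nat \<Rightarrow> (nat \<Rightarrow> ('f, 's, nat) mso) \<Rightarrow> bool" where
  "is_family L m \<Phi> \<longleftrightarrow> (\<forall>k\<le>m. \<Phi> k \<in> L \<and> free1 (\<Phi> k) \<subseteq> {0..k} \<and> free2 (\<Phi> k) = {})"

definition assign :: "nat list \<Rightarrow> nat list list \<Rightarrow> nat \<Rightarrow> nat list" where
  "assign v vs i = (if i \<le> length vs then (v # vs) ! i else [])"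

definition progressing ::
  "('f \<Rightarrow> nat) \<Rightarrow> nat \<Rightarrow> nat \<Rightarrow>
    (nat \<Rightarrow> ('f, 's::{comm_semiring_0, comm_monoid_mult}, nat) mso) \<Rightarrow> bool" where
  "progressing rk n m \<Phi> \<longleftrightarrow>
    (\<forall>\<xi>\<in>trees rk. \<forall>v\<in>pos \<xi>. \<forall>vs. set vs \<subseteq> pos \<xi> \<longrightarrow> length vs \<le> m \<longrightarrow>
      sem (\<Phi> (length vs)) \<xi> (assign v vs) (\<lambda>_. {}) \<noteq> 0 \<longrightarrow> next_base n v vs)"

text \<open>
  The first-order variables of the formulas \<open>BTC\<^sup>l\<^sub>w(\<Phi>)\<close> are lists of numbers, and \<open>x\<^sub>w\<close> is \<open>w\<close>
  itself. To form \<open>\<phi>\<^sub>k(x\<^sub>w, x\<^sub>w\<^sub>1, \<dots>, x\<^sub>w\<^sub>k)\<close>, all variables of \<open>\<phi>\<^sub>k\<close>, including the bound ones, are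
  renamed. As \<open>0\<close> does not occur in \<open>w\<close>, this renaming is injective, and hence nothing is captured.
\<close>

definition subst_var :: "nat \<Rightarrow> nat list \<Rightarrow> nat \<Rightarrow> nat list" where
  "subst_var k w j = (if j = 0 then w else if j \<le> k then w @ [j] else [0, j])"

definition subst :: "nat \<Rightarrow> nat list \<Rightarrow> ('f, 's, nat) mso \<Rightarrow> ('f, 's, nat list) mso" where
  "subst k w \<phi> = map_mso id id (subst_var k w) \<phi>"

text \<open>All lists of \<open>k\<close> positive numbers with sum \<open>l\<close>, without repetitions.\<close>

definition compositions :: "nat \<Rightarrow> nat \<Rightarrow> nat list list" where
  "compositions k l = filter (\<lambda>ls. sum_list ls = l) (List.n_lists k [1..<Suc l])"

lemma set_compositions:
  "set (compositions k l) = {ls. length ls = k \<and> 0 \<notin> set ls \<and> sum_list ls = l}"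
proof -
  have "set ls \<subseteq> {1..<Suc l} \<longleftrightarrow> 0 \<notin> set ls" if "sum_list ls = l" for ls :: "nat list"
  proof
    assume "0 \<notin> set ls"
    then have "x \<noteq> 0" if "x \<in> set ls" for x using that by metis
    moreover have "x \<le> l" if "x \<in> set ls" for x
      using that member_le_sum_list[of x ls] \<open>sum_list ls = l\<close> by simp
    ultimately show "set ls \<subseteq> {1..<Suc l}"
      by (simp add: subset_iff Suc_le_eq less_Suc_eq_le)
  qed auto
  then show ?thesis
    unfolding compositions_def set_filter set_n_lists set_upt by blast
qed

lemma distinct_compositions: "distinct (compositions k l)"
  by (simp add: compositions_def distinct_n_lists)

text \<open>The superscript \<open>l\<close> is positive; the case \<open>0\<close> is a dummy.\<close>

function BTC ::
  "nat \<Rightarrow> (nat \<Rightarrow> ('f, 's::{zero, one}, nat) mso) \<Rightarrow> nat \<Rightarrow> nat list \<Rightarrow> ('f, 's, nat list) mso" where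
  "BTC m \<Phi> 0 w = Const 0"
| "BTC m \<Phi> (Suc 0) w = subst 0 w (\<Phi> 0)"
| "BTC m \<Phi> (Suc (Suc l)) w =
    Disj (map (\<lambda>k. foldr Ex1 (map (\<lambda>i. w @ [i]) [1..<Suc k])
        (And (subst k w (\<Phi> k))
          (Disj (map (\<lambda>ls. Conj (map (\<lambda>i. BTC m \<Phi> (ls ! (i - 1)) (w @ [i])) [1..<Suc k]))
            (compositions k (Suc l))))))
      [1..<Suc m])"
  by pat_completeness auto
termination
proof (relation "measure (\<lambda>(m, \<Phi>, l, w). l)", simp, goal_cases)
  case (1 m \<Phi> l w k ls i)
  then have "ls ! (i - 1) \<in> set ls" "sum_list ls = Suc l"
    by (auto simp: set_compositions)
  with member_le_sum_list[of "ls ! (i - 1)" ls] show ?case by simp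
qed

definition BTC_sem ::
  "nat \<Rightarrow> (nat \<Rightarrow> ('f, 's::{comm_semiring_0, comm_monoid_mult}, nat) mso) \<Rightarrow>
    'f tree \<Rightarrow> nat list \<Rightarrow> 's" where
  "BTC_sem m \<Phi> \<xi> v =
    (\<Sum>l\<in>{1..card (pos \<xi>)}. sem (BTC m \<Phi> l []) \<xi> ((\<lambda>_. [])([] := v)) (\<lambda>_. {}))"

definition BTC_definable ::
  "('f \<Rightarrow> nat) \<Rightarrow> ('f, 's, nat) mso set \<Rightarrow>
    ('f tree \<Rightarrow> 's::{comm_semiring_0, comm_monoid_mult}) \<Rightarrow> bool" where
  "BTC_definable rk L r \<longleftrightarrow>
    (\<exists>m n \<Phi>. 0 < n \<and> is_family L m \<Phi> \<and> progressing rk n m \<Phi> \<and>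
      (\<forall>\<xi>\<in>trees rk. r \<xi> = BTC_sem m \<Phi> \<xi> []))"

end

theory Submission
  imports Defs "HOL-Library.FuncSet" "HOL-Library.List_Lexorder"
begin

text \<open>
  The implications form the cycle from (a) to (b), (c), (e), (f) and back to (a), together with (b) to
  (d) to (e).

  From (a) to (b), cut a tree into blocks of height \<open>n\<close>, where \<open>n\<close> is the number of states. State \<open>p\<close>
  at a base position is encoded by the choice of a position at distance \<open>p\<close> from it, which exists
  whenever the subtree there has height at least \<open>n - 1\<close>; smaller subtrees are absorbed into the block
  above them. The weight of a block depends on a bounded part of the tree, so it is a step function of
  finitely many first-order properties with modulo predicates.

  From (b) to (d) and from (c) to (e), a run of the branching transitive closure of a progressing
  family visits every base position at most once, so the run is determined by the set of its
  positions, and it is a run if and only if this set satisfies a first-order property.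

  From (f) to (a), recognizable functions are closed under sums, products and projections, regular
  properties are also closed under complement, and the product of a step function over all positions
  is obtained by guessing and checking its values.
\<close>

section \<open>Regular properties of annotated trees\<close>

text \<open>Disjunction and existential quantification add up, and the semiring need not be
  idempotent, so every run has to be counted exactly once. This is why states are encoded along one
  fixed path, why a set of positions must determine the list of children of each of its elements,
  and why guessed values are checked to be unique. A state can only be stored as a distance below a
  base position. It must be smaller than \<open>n\<close> to leave the base unchanged, and the
  subtree must be high enough to offer that distance; this forces the special treatment of low
  subtrees. Both implications about branching transitive closures rest on one fixpoint equation over
  lists of successors. Progress makes base positions descend strictly, so the equation has one
  solution, found by induction on the number of positions below the base; the superscript
  \<open>l\<close> disappears because a run cannot have more nodes than there are positions.
  Automata appear as finite families of predicates or functions whose values at a node are computed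
  from those at the children. A closure property then amounts to exhibiting such a family, and the
  annotations may come from an infinite set.\<close>

definition down :: "nat \<Rightarrow> (nat list \<Rightarrow> 'b) \<Rightarrow> nat list \<Rightarrow> 'b" where
  "down i \<nu> = (\<lambda>w. \<nu> (Suc i # w))"

lemma ball_pos_Node:
  "(\<forall>w\<in>pos (Node f ts). P w) \<longleftrightarrow> P [] \<and> (\<forall>i<length ts. \<forall>w\<in>pos (ts ! i). P (Suc i # w))"
proof -
  have "{1..length ts} = Suc ` {..<length ts}"
    by (simp add: image_Suc_lessThan)
  then show ?thesis by auto
qed

lemma bex_pos_Node:
  "(\<exists>w\<in>pos (Node f ts). P w) \<longleftrightarrow> P [] \<or> (\<exists>i<length ts. \<exists>w\<in>pos (ts ! i). P (Suc i # w))"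
proof -
  have "{1..length ts} = Suc ` {..<length ts}"
    by (simp add: image_Suc_lessThan)
  then show ?thesis by auto
qed

lemma Cons_in_pos_Node:
  "i # w \<in> pos (Node f ts) \<longleftrightarrow> 1 \<le> i \<and> i \<le> length ts \<and> w \<in> pos (ts ! (i - 1))"
  by auto

lemma Suc_Cons_in_pos_Node:
  "Suc i # w \<in> pos (Node f ts) \<longleftrightarrow> i < length ts \<and> w \<in> pos (ts ! i)"
  using Cons_in_pos_Node[of "Suc i" w f ts] by auto

declare pos.simps [simp del]

text \<open>
  Trees are annotated by a function \<open>\<nu>\<close> on positions; \<open>down i \<nu>\<close> is the annotation of the child with
  position \<open>[i + 1]\<close>. A predicate is regular if it belongs to a finite set of predicates whose
  truth values at a tree are determined by the root and by their truth values at the children: these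
  truth values are the states of a deterministic bottom-up automaton.
\<close>

definition congr :: "('f tree \<Rightarrow> (nat list \<Rightarrow> 'b) \<Rightarrow> bool) set \<Rightarrow> bool" where
  "congr \<P> \<longleftrightarrow> (\<forall>f ts ts' \<nu> \<nu>'. length ts = length ts' \<longrightarrow> \<nu> [] = \<nu>' [] \<longrightarrow>
    (\<forall>i<length ts. \<forall>p\<in>\<P>. p (ts ! i) (down i \<nu>) = p (ts' ! i) (down i \<nu>')) \<longrightarrow>
    (\<forall>p\<in>\<P>. p (Node f ts) \<nu> = p (Node f ts') \<nu>'))"

definition regular :: "('f tree \<Rightarrow> (nat list \<Rightarrow> 'b) \<Rightarrow> bool) \<Rightarrow> bool" where
  "regular P \<longleftrightarrow> (\<exists>\<P>. finite \<P> \<and> P \<in> \<P> \<and> congr \<P>)"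

lemma congrD:
  assumes "congr \<P>" "p \<in> \<P>" "length ts = length ts'" "\<nu> [] = \<nu>' []"
    "\<And>i p. i < length ts \<Longrightarrow> p \<in> \<P> \<Longrightarrow> p (ts ! i) (down i \<nu>) = p (ts' ! i) (down i \<nu>')"
  shows "p (Node f ts) \<nu> = p (Node f ts') \<nu>'"
  using assms unfolding congr_def by blast

lemma congr_Un: "congr \<P> \<Longrightarrow> congr \<Q> \<Longrightarrow> congr (\<P> \<union> \<Q>)"
  unfolding congr_def by (simp add: ball_Un)

text \<open>Adding \<open>Q\<close> to \<open>\<P>\<close> keeps it congruent: the truth value of
  \<open>Q\<close> at a node depends only on those of \<open>\<P>\<close> there, and these only on
  those at the children.\<close>

lemma regular_determined:
  assumes "finite \<P>" "congr \<P>"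
    and "\<And>\<xi> \<nu> \<xi>' \<nu>'. \<forall>p\<in>\<P>. p \<xi> \<nu> = p \<xi>' \<nu>' \<Longrightarrow> Q \<xi> \<nu> = Q \<xi>' \<nu>'"
  shows "regular Q"
proof -
  have "congr (insert Q \<P>)"
    unfolding congr_def using congrD[OF assms(2)] assms(3) by simp
  then show ?thesis using assms(1) by (auto simp: regular_def)
qed

lemma congrI:
  assumes "\<And>p f ts ts' \<nu> \<nu>'. p \<in> \<P> \<Longrightarrow> length ts = length ts' \<Longrightarrow> \<nu> [] = \<nu>' [] \<Longrightarrow>
    (\<And>i p. i < length ts' \<Longrightarrow> p \<in> \<P> \<Longrightarrow> p (ts ! i) (down i \<nu>) = p (ts' ! i) (down i \<nu>')) \<Longrightarrow>
    p (Node f ts) \<nu> = p (Node f ts') \<nu>'"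
  shows "congr \<P>"
  unfolding congr_def by (intro allI impI ballI, rule assms) simp_all

lemma congr_pairI:
  assumes "\<And>f ts ts' \<nu> \<nu>'. length ts = length ts' \<Longrightarrow> \<nu> [] = \<nu>' [] \<Longrightarrow>
    (\<And>i. i < length ts' \<Longrightarrow> p (ts ! i) (down i \<nu>) = p (ts' ! i) (down i \<nu>')) \<Longrightarrow>
    (\<And>i. i < length ts' \<Longrightarrow> q (ts ! i) (down i \<nu>) = q (ts' ! i) (down i \<nu>')) \<Longrightarrow>
    p (Node f ts) \<nu> = p (Node f ts') \<nu>' \<and> q (Node f ts) \<nu> = q (Node f ts') \<nu>'"
  shows "congr {p, q}"
proof (rule congrI)
  fix r f ts ts' and \<nu> \<nu>' :: "nat list \<Rightarrow> 'b"
  assume r: "r \<in> {p, q}" and *: "length ts = length ts'" "\<nu> [] = \<nu>' []"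
    and IH: "\<And>i r. i < length ts' \<Longrightarrow> r \<in> {p, q} \<Longrightarrow> r (ts ! i) (down i \<nu>) = r (ts' ! i) (down i \<nu>')"
  show "r (Node f ts) \<nu> = r (Node f ts') \<nu>'"
    using assms[OF * IH IH, of f] r by auto
qed

lemma regular_not: "regular P \<Longrightarrow> regular (\<lambda>\<xi> \<nu>. \<not> P \<xi> \<nu>)"
proof -
  assume "regular P"
  then obtain \<P> where \<P>: "finite \<P>" "P \<in> \<P>" "congr \<P>" unfolding regular_def by blast
  then show ?thesis by (intro regular_determined[OF \<P>(1,3)]) (blast dest: bspec)
qed

lemma regular_conj:
  assumes "regular P" "regular Q"
  shows "regular (\<lambda>\<xi> \<nu>. P \<xi> \<nu> \<and> Q \<xi> \<nu>)"
proof -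
  obtain \<P> \<Q> where \<P>: "finite \<P>" "P \<in> \<P>" "congr \<P>" and \<Q>: "finite \<Q>" "Q \<in> \<Q>" "congr \<Q>"
    using assms unfolding regular_def by blast
  show ?thesis
  proof (rule regular_determined[OF _ congr_Un[OF \<P>(3) \<Q>(3)]])
    fix \<xi> \<nu> \<xi>' \<nu>' assume *: "\<forall>p\<in>\<P> \<union> \<Q>. p \<xi> \<nu> = p \<xi>' \<nu>'"
    have "P \<xi> \<nu> = P \<xi>' \<nu>'" by (rule bspec[OF *]) (use \<P> in simp)
    moreover have "Q \<xi> \<nu> = Q \<xi>' \<nu>'" by (rule bspec[OF *]) (use \<Q> in simp)
    ultimately show "(P \<xi> \<nu> \<and> Q \<xi> \<nu>) = (P \<xi>' \<nu>' \<and> Q \<xi>' \<nu>')" by simp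
  qed (use \<P> \<Q> in simp)
qed

lemma regular_True: "regular (\<lambda>\<xi> \<nu>. True)"
  by (rule regular_determined[of "{}"]) (auto simp: congr_def)

lemma regular_disj: "regular P \<Longrightarrow> regular Q \<Longrightarrow> regular (\<lambda>\<xi> \<nu>. P \<xi> \<nu> \<or> Q \<xi> \<nu>)"
  using regular_not[OF regular_conj[OF regular_not[of P] regular_not[of Q]]] by simp

lemma regular_bex:
  "finite I \<Longrightarrow> (\<And>i. i \<in> I \<Longrightarrow> regular (P i)) \<Longrightarrow> regular (\<lambda>\<xi> \<nu>. \<exists>i\<in>I. P i \<xi> \<nu>)"
proof (induction I rule: finite_induct)
  case empty
  then show ?case using regular_not[OF regular_True] by simp
next
  case (insert i I)
  then show ?case by (simp add: regular_disj)
qed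

lemma down_comp: "down i (\<lambda>w. h (\<nu> w)) = (\<lambda>w. h (down i \<nu> w))"
  by (simp add: down_def)

text \<open>The same states work, evaluated at the relabelled annotation. This serves to rearrange
  or discard components after a quantifier has added one.\<close>

lemma regular_map:
  assumes "regular P"
  shows "regular (\<lambda>\<xi> \<nu>. P \<xi> (\<lambda>w. h (\<nu> w)))"
proof -
  obtain \<P> where \<P>: "finite \<P>" "P \<in> \<P>" "congr \<P>" using assms unfolding regular_def by blast
  let ?f = "\<lambda>p \<xi> \<nu>. p \<xi> (\<lambda>w. h (\<nu> w))"
  let ?R = "?f ` \<P>"
  have "congr ?R"
  proof (rule congrI)
    fix p f ts ts' and \<nu> \<nu>' :: "nat list \<Rightarrow> 'c"
    assume p: "p \<in> ?R"
      and *: "length ts = length ts'" "\<nu> [] = \<nu>' []"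
      and IH: "\<And>i p. i < length ts' \<Longrightarrow> p \<in> ?R \<Longrightarrow>
        p (ts ! i) (down i \<nu>) = p (ts' ! i) (down i \<nu>')"
    obtain q where q: "q \<in> \<P>" "p = ?f q" using p by (rule imageE)
    show "p (Node f ts) \<nu> = p (Node f ts') \<nu>'"
      unfolding q(2)
    proof (rule congrD[OF \<P>(3) q(1)])
      fix i q assume "i < length ts" "q \<in> \<P>"
      then show "q (ts ! i) (down i (\<lambda>w. h (\<nu> w))) = q (ts' ! i) (down i (\<lambda>w. h (\<nu>' w)))"
        using IH[of i "?f q"] * imageI[of q \<P> ?f] unfolding down_comp by simp
    qed (use * in auto)
  qed
  then have "finite ?R \<and> ?f P \<in> ?R \<and> congr ?R" using \<P>(1) imageI[OF \<P>(2), of ?f] by simp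
  then show ?thesis unfolding regular_def by (rule exI)
qed

text \<open>Annotations are total functions; their values outside the tree are irrelevant because a
  node contributes only \<open>\<nu> []\<close> and its children.\<close>

lemma congr_local:
  assumes "congr \<P>"
  shows "p \<in> \<P> \<Longrightarrow> \<forall>w\<in>pos \<xi>. \<nu> w = \<nu>' w \<Longrightarrow> p \<xi> \<nu> = p \<xi> \<nu>'"
proof (induction \<xi> arbitrary: p \<nu> \<nu>')
  case (Node f ts)
  show ?case
  proof (rule congrD[OF assms Node.prems(1)])
    fix i p assume i: "i < length ts" "p \<in> \<P>"
    then have "\<forall>w\<in>pos (ts ! i). down i \<nu> w = down i \<nu>' w"
      using Node.prems(2) by (simp add: ball_pos_Node down_def)
    with i show "p (ts ! i) (down i \<nu>) = p (ts ! i) (down i \<nu>')"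
      by (intro Node.IH) simp_all
  qed (use Node.prems(2) in \<open>simp_all add: ball_pos_Node\<close>)
qed

lemma regular_local:
  assumes "regular P" "\<forall>w\<in>pos \<xi>. \<nu> w = \<nu>' w"
  shows "P \<xi> \<nu> = P \<xi> \<nu>'"
  using assms congr_local unfolding regular_def by blast

definition graft :: "'b \<Rightarrow> (nat \<Rightarrow> nat list \<Rightarrow> 'b) \<Rightarrow> nat list \<Rightarrow> 'b" where
  "graft b \<nu>s w = (case w of [] \<Rightarrow> b | i # u \<Rightarrow> \<nu>s (i - 1) u)"

lemma graft_simps [simp]: "graft b \<nu>s [] = b" "down i (graft b \<nu>s) = \<nu>s i"
  by (auto simp: graft_def down_def)

text \<open>Power set construction: the new state is the set of all truth vectors \<open>S\<close>
  that some guess \<open>\<mu>\<close> can produce, and \<open>E S\<close> is one bit of it. The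
  guesses for different children are independent, so they can be glued with
  \<open>graft\<close>.\<close>

lemma regular_proj:
  fixes P :: "'f tree \<Rightarrow> (nat list \<Rightarrow> 'b \<times> 'c) \<Rightarrow> bool"
  assumes "regular P"
  shows "regular (\<lambda>\<xi> \<nu>. \<exists>\<mu>. P \<xi> (\<lambda>w. (\<nu> w, \<mu> w)))"
proof -
  obtain \<P> where \<P>: "finite \<P>" "P \<in> \<P>" "congr \<P>" using assms unfolding regular_def by blast
  define vec where "vec \<xi> \<nu> = {p\<in>\<P>. p \<xi> \<nu>}" for \<xi> :: "'f tree" and \<nu> :: "nat list \<Rightarrow> 'b \<times> 'c"
  have vec_sub: "vec \<xi> \<nu> \<subseteq> \<P>" for \<xi> \<nu> by (auto simp: vec_def)
  define E where "E S \<xi> \<nu> \<longleftrightarrow> (\<exists>\<mu>. vec \<xi> (\<lambda>w. (\<nu> w, \<mu> w)) = S)" for S \<xi> \<nu>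
  \<comment> \<open>One direction suffices, because the assumptions are symmetric in the two
    trees.\<close>
  have tr: "E S (Node f ts') \<nu>'"
    if *: "length ts = length ts'" "\<nu> [] = \<nu>' []"
      and IH: "\<And>i S. i < length ts' \<Longrightarrow> S \<subseteq> \<P> \<Longrightarrow> E S (ts ! i) (down i \<nu>) = E S (ts' ! i) (down i \<nu>')"
      and E: "E S (Node f ts) \<nu>" for S f ts ts' \<nu> \<nu>'
  proof -
    obtain \<mu> where \<mu>: "vec (Node f ts) (\<lambda>w. (\<nu> w, \<mu> w)) = S"
      using E by (auto simp: E_def)
    have "\<exists>\<mu>'. vec (ts' ! i) (\<lambda>w. (down i \<nu>' w, \<mu>' w)) = vec (ts ! i) (\<lambda>w. (down i \<nu> w, down i \<mu> w))"
      if "i < length ts'" for i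
      using IH[OF that, of "vec (ts ! i) (\<lambda>w. (down i \<nu> w, down i \<mu> w))"]
      unfolding E_def by (metis vec_sub)
    then obtain \<mu>s where \<mu>s: "\<And>i. i < length ts' \<Longrightarrow>
        vec (ts' ! i) (\<lambda>w. (down i \<nu>' w, \<mu>s i w)) = vec (ts ! i) (\<lambda>w. (down i \<nu> w, down i \<mu> w))"
      by metis
    define \<mu>' where "\<mu>' = graft (\<mu> []) \<mu>s"
    have d: "down i (\<lambda>w. (\<nu>' w, \<mu>' w)) = (\<lambda>w. (down i \<nu>' w, \<mu>s i w))"
      "down i (\<lambda>w. (\<nu> w, \<mu> w)) = (\<lambda>w. (down i \<nu> w, down i \<mu> w))" for i
      by (auto simp: down_def \<mu>'_def fun_eq_iff graft_def)
    have "p (Node f ts) (\<lambda>w. (\<nu> w, \<mu> w)) = p (Node f ts') (\<lambda>w. (\<nu>' w, \<mu>' w))" if p: "p \<in> \<P>" for p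
    proof (rule congrD[OF \<P>(3) p *(1)])
      fix i p assume "i < length ts" "p \<in> \<P>"
      then have "p (ts' ! i) (\<lambda>w. (down i \<nu>' w, \<mu>s i w)) = p (ts ! i) (\<lambda>w. (down i \<nu> w, down i \<mu> w))"
        using \<mu>s[of i] * unfolding vec_def by auto
      then show "p (ts ! i) (down i (\<lambda>w. (\<nu> w, \<mu> w))) = p (ts' ! i) (down i (\<lambda>w. (\<nu>' w, \<mu>' w)))"
        unfolding d by simp
    qed (simp add: * \<mu>'_def)
    then have "vec (Node f ts') (\<lambda>w. (\<nu>' w, \<mu>' w)) = S" using \<mu> unfolding vec_def by blast
    then show ?thesis unfolding E_def by blast
  qed
  have E_congr: "congr (E ` Pow \<P>)"
  proof (rule congrI)
    fix p f ts ts' and \<nu> \<nu>' :: "nat list \<Rightarrow> 'b"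
    assume p: "p \<in> E ` Pow \<P>" and *: "length ts = length ts'" "\<nu> [] = \<nu>' []"
      and IH: "\<And>i p. i < length ts' \<Longrightarrow> p \<in> E ` Pow \<P> \<Longrightarrow> p (ts ! i) (down i \<nu>) = p (ts' ! i) (down i \<nu>')"
    obtain S where S: "p = E S" using p by (rule imageE)
    have IH': "E S (ts ! i) (down i \<nu>) = E S (ts' ! i) (down i \<nu>')" if "i < length ts'" "S \<subseteq> \<P>" for i S
      by (rule IH[OF that(1) imageI]) (use that in simp)
    have "E S (Node f ts') \<nu>'" if "E S (Node f ts) \<nu>"
      by (rule tr[OF * IH' that])
    moreover have "E S (Node f ts) \<nu>" if "E S (Node f ts') \<nu>'"
      by (rule tr[OF *(1)[symmetric] *(2)[symmetric] IH'[symmetric] that]) (use * in simp_all)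
    ultimately show "p (Node f ts) \<nu> = p (Node f ts') \<nu>'" unfolding S by blast
  qed
  have fin: "finite (E ` Pow \<P>)" using \<P> by simp
  show ?thesis
  proof (rule regular_determined[OF fin E_congr])
    fix \<xi> \<nu> \<xi>' \<nu>' assume E: "\<forall>p\<in>E ` Pow \<P>. p \<xi> \<nu> = p \<xi>' \<nu>'"
    have *: "(\<exists>\<mu>. P \<xi> (\<lambda>w. (\<nu> w, \<mu> w))) \<longleftrightarrow> (\<exists>S\<in>Pow \<P>. P \<in> S \<and> E S \<xi> \<nu>)" for \<xi> \<nu>
      unfolding E_def using \<P>(2) by (auto simp: vec_def)
    show "(\<exists>\<mu>. P \<xi> (\<lambda>w. (\<nu> w, \<mu> w))) = (\<exists>\<mu>. P \<xi>' (\<lambda>w. (\<nu>' w, \<mu> w)))"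
      unfolding * using bspec[OF E imageI] by blast
  qed
qed

lemma regular_ex_pos: "regular (\<lambda>\<xi> \<nu>. \<exists>w\<in>pos \<xi>. R (label_at \<xi> w) (\<nu> w))"
proof -
  have "congr {\<lambda>\<xi> \<nu>. \<exists>w\<in>pos \<xi>. R (label_at \<xi> w) (\<nu> w)}"
    by (rule congrI) (auto simp: bex_pos_Node down_def)
  then show ?thesis unfolding regular_def by blast
qed

lemma regular_ex_pos':
  "regular (\<lambda>\<xi> \<nu>. \<exists>w\<in>pos \<xi>. R (\<nu> w))"
  using regular_ex_pos[of "\<lambda>_. R"] .

text \<open>Two bits per subtree suffice: whether a marked position exists and whether two different
  ones do. Two marks lie at the root and in a child, in two children, or inside one child.\<close>

lemma regular_unique: "regular (\<lambda>(\<xi> :: 'f tree) (\<nu> :: nat list \<Rightarrow> 'b). \<exists>!w. w \<in> pos \<xi> \<and> R (\<nu> w))"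
proof -
  define some where "some = (\<lambda>(\<xi> :: 'f tree) (\<nu> :: nat list \<Rightarrow> 'b). \<exists>w\<in>pos \<xi>. R (\<nu> w))"
  define two where "two = (\<lambda>(\<xi> :: 'f tree) (\<nu> :: nat list \<Rightarrow> 'b). \<exists>w\<in>pos \<xi>. \<exists>w'\<in>pos \<xi>. w \<noteq> w' \<and> R (\<nu> w) \<and> R (\<nu> w'))"
  have some: "some (Node f ts) \<nu> \<longleftrightarrow> R (\<nu> []) \<or> (\<exists>i<length ts. some (ts ! i) (down i \<nu>))" for f :: 'f and ts \<nu>
    by (simp add: some_def bex_pos_Node down_def)
  have "two (Node f ts) \<nu> \<longleftrightarrow> (R (\<nu> []) \<and> (\<exists>i<length ts. some (ts ! i) (down i \<nu>))) \<or>
    (\<exists>i<length ts. two (ts ! i) (down i \<nu>)) \<or>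
    (\<exists>i<length ts. \<exists>j<length ts. i \<noteq> j \<and> some (ts ! i) (down i \<nu>) \<and> some (ts ! j) (down j \<nu>))"
    for f :: 'f and ts \<nu>
    unfolding two_def some_def bex_pos_Node down_def by blast
  then have "congr {some, two}"
    by (intro congr_pairI) (simp add: some cong: conj_cong)
  then have "regular (\<lambda>\<xi> \<nu>. some \<xi> \<nu> \<and> \<not> two \<xi> \<nu>)"
    by (rule regular_determined[rotated]) auto
  moreover have "(\<lambda>\<xi> \<nu>. some \<xi> \<nu> \<and> \<not> two \<xi> \<nu>) = (\<lambda>\<xi> \<nu>. \<exists>!w. w \<in> pos \<xi> \<and> R (\<nu> w))"
    unfolding some_def two_def by (intro ext) blast
  ultimately show ?thesis by simp
qed

text \<open>A position is a guessed set with exactly one element in the tree. Outside the tree the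
  guess may differ from \<open>\<lambda>w. w = v\<close>, which locality absorbs.\<close>

lemma regular_ex1:
  assumes "regular P"
  shows "regular (\<lambda>\<xi> \<nu>. \<exists>v\<in>pos \<xi>. P \<xi> (\<lambda>w. (\<nu> w, w = v)))"
proof -
  have "regular (\<lambda>\<xi> \<nu>. \<exists>\<mu>. (\<exists>!w. w \<in> pos \<xi> \<and> snd (\<nu> w, \<mu> w)) \<and> P \<xi> (\<lambda>w. (\<nu> w, \<mu> w)))"
    by (rule regular_proj[OF regular_conj[OF regular_unique assms]])
  also have "(\<lambda>\<xi> \<nu>. \<exists>\<mu>. (\<exists>!w. w \<in> pos \<xi> \<and> snd (\<nu> w, \<mu> w)) \<and> P \<xi> (\<lambda>w. (\<nu> w, \<mu> w))) =
    (\<lambda>\<xi> \<nu>. \<exists>v\<in>pos \<xi>. P \<xi> (\<lambda>w. (\<nu> w, w = v)))"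
  proof (intro ext iffI)
    fix \<xi> \<nu> assume "\<exists>\<mu>. (\<exists>!w. w \<in> pos \<xi> \<and> snd (\<nu> w, \<mu> w)) \<and> P \<xi> (\<lambda>w. (\<nu> w, \<mu> w))"
    then obtain \<mu> v where v: "v \<in> pos \<xi>" "\<And>w. w \<in> pos \<xi> \<Longrightarrow> \<mu> w = (w = v)"
      and P: "P \<xi> (\<lambda>w. (\<nu> w, \<mu> w))" by auto
    have "P \<xi> (\<lambda>w. (\<nu> w, w = v)) = P \<xi> (\<lambda>w. (\<nu> w, \<mu> w))"
      by (rule regular_local[OF assms]) (use v in auto)
    then show "\<exists>v\<in>pos \<xi>. P \<xi> (\<lambda>w. (\<nu> w, w = v))" using P v(1) by blast
  next
    fix \<xi> \<nu> assume "\<exists>v\<in>pos \<xi>. P \<xi> (\<lambda>w. (\<nu> w, w = v))"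
    then obtain v where "v \<in> pos \<xi>" "P \<xi> (\<lambda>w. (\<nu> w, w = v))" by blast
    then show "\<exists>\<mu>. (\<exists>!w. w \<in> pos \<xi> \<and> snd (\<nu> w, \<mu> w)) \<and> P \<xi> (\<lambda>w. (\<nu> w, \<mu> w))"
      by (intro exI[of _ "\<lambda>w. w = v"]) auto
  qed
  finally show ?thesis .
qed

text \<open>An edge starting at the root is detected by asking the child about its own root, which
  is what the auxiliary predicate \<open>root\<close> is for.\<close>

lemma regular_edge:
  "regular (\<lambda>(\<xi> :: 'f tree) \<nu>. \<exists>w\<in>pos \<xi>. R (\<nu> w) \<and> w @ [Suc i] \<in> pos \<xi> \<and> R' (\<nu> (w @ [Suc i])))"
  (is "regular ?E")
proof -
  define E where "E = ?E"
  define root where "root = (\<lambda>(\<xi> :: 'f tree) \<nu>. R' (\<nu> ([] :: nat list)))"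
  have "E (Node f ts) \<nu> \<longleftrightarrow> (R (\<nu> []) \<and> i < length ts \<and> root (ts ! i) (down i \<nu>)) \<or>
      (\<exists>j<length ts. E (ts ! j) (down j \<nu>))" for f ts \<nu>
    by (auto simp: E_def root_def bex_pos_Node down_def Suc_Cons_in_pos_Node Nil_in_pos)
  moreover have "root (Node f ts) \<nu> \<longleftrightarrow> R' (\<nu> [])" for f ts \<nu>
    by (simp add: root_def)
  ultimately have "congr {E, root}" by (intro congr_pairI) (simp cong: conj_cong)
  then have "regular E" by (rule regular_determined[rotated]) auto
  then show ?thesis by (simp add: E_def)
qed

lemma regular_le:
  "regular (\<lambda>(\<xi> :: 'f tree) \<nu>. \<exists>w\<in>pos \<xi>. \<exists>w'\<in>pos \<xi>. R (\<nu> w) \<and> R' (\<nu> w') \<and> prefix w w')"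
  (is "regular ?E")
proof -
  define E where "E = ?E"
  define some where "some = (\<lambda>(\<xi> :: 'f tree) \<nu>. \<exists>w\<in>pos \<xi>. R' (\<nu> w))"
  have some: "some (Node f ts) \<nu> \<longleftrightarrow> R' (\<nu> []) \<or> (\<exists>j<length ts. some (ts ! j) (down j \<nu>))" for f ts \<nu>
    by (simp add: some_def bex_pos_Node down_def)
  have inner: "(\<exists>w'\<in>pos (Node f ts). R' (\<nu> w') \<and> prefix (Suc i # w) w') \<longleftrightarrow>
      (\<exists>w'\<in>pos (ts ! i). R' (down i \<nu> w') \<and> prefix w w')" if "i < length ts" for i w f ts \<nu>
    using that by (auto simp: bex_pos_Node down_def)
  have E: "E \<xi> \<nu> \<longleftrightarrow> (\<exists>w\<in>pos \<xi>. R (\<nu> w) \<and> (\<exists>w'\<in>pos \<xi>. R' (\<nu> w') \<and> prefix w w'))" for \<xi> \<nu>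
    by (auto simp: E_def)
  have "E (Node f ts) \<nu> \<longleftrightarrow> (R (\<nu> []) \<and> some (Node f ts) \<nu>) \<or>
      (\<exists>j<length ts. E (ts ! j) (down j \<nu>))" for f ts \<nu>
    unfolding E bex_pos_Node[of f ts "\<lambda>w. R (\<nu> w) \<and> (\<exists>w'\<in>pos (Node f ts). R' (\<nu> w') \<and> prefix w w')"]
    by (simp add: inner some_def down_def cong: conj_cong)
  then have "congr {E, some}" by (intro congr_pairI) (simp add: some cong: conj_cong)
  then have "regular E" by (rule regular_determined[rotated]) auto
  then show ?thesis by (simp add: E_def)
qed

section \<open>Recognizable functions on annotated trees\<close>

lemma prod_sum_distrib_PiE:
  fixes F :: "'i \<Rightarrow> 'x \<Rightarrow> 's::{comm_semiring_0, comm_monoid_mult}"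
  assumes "finite I" "\<And>i. i \<in> I \<Longrightarrow> finite (A i)"
  shows "(\<Prod>i\<in>I. \<Sum>x\<in>A i. F i x) = (\<Sum>h\<in>PiE I A. \<Prod>i\<in>I. F i (h i))"
  using assms
proof (induction I rule: finite_induct)
  case empty
  then show ?case by simp
next
  case (insert j J)
  have fin: "finite (PiE J A)" using insert by (intro finite_PiE) auto
  have "(\<Sum>h\<in>PiE (insert j J) A. \<Prod>i\<in>insert j J. F i (h i)) =
      (\<Sum>(y, h)\<in>A j \<times> PiE J A. \<Prod>i\<in>insert j J. F i ((h(j := y)) i))"
    unfolding PiE_insert_eq by (subst sum.reindex[OF inj_combinator[OF insert(2)]]) (simp add: case_prod_unfold)
  also have "\<dots> = (\<Sum>(y, h)\<in>A j \<times> PiE J A. F j y * (\<Prod>i\<in>J. F i (h i)))"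
  proof (rule sum.cong[OF refl], clarify)
    fix y h
    have "(\<Prod>i\<in>J. F i ((h(j := y)) i)) = (\<Prod>i\<in>J. F i (h i))"
      using insert(2) by (intro prod.cong) auto
    then show "(\<Prod>i\<in>insert j J. F i ((h(j := y)) i)) = F j y * (\<Prod>i\<in>J. F i (h i))"
      using insert by simp
  qed
  also have "\<dots> = (\<Sum>y\<in>A j. \<Sum>h\<in>PiE J A. F j y * (\<Prod>i\<in>J. F i (h i)))"
    by (simp add: sum.cartesian_product)
  also have "\<dots> = (\<Sum>x\<in>A j. F j x) * (\<Sum>h\<in>PiE J A. \<Prod>i\<in>J. F i (h i))"
    by (simp add: sum_product)
  finally show ?case using insert by simp
qed

lemma sum_tv:
  fixes F :: "'i \<Rightarrow> 's::{comm_semiring_0, comm_monoid_mult}"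
  assumes "finite I"
  shows "(\<Sum>i\<in>I. tv (i = j) * F i) = tv (j \<in> I) * F j"
proof -
  have "(\<Sum>i\<in>I. tv (i = j) * F i) = (\<Sum>i\<in>I. if i = j then F i else 0)"
    by (intro sum.cong) auto
  then show ?thesis using assms by simp
qed

definition tuples :: "'g set \<Rightarrow> nat \<Rightarrow> 'g list set" where
  "tuples G k = {gs. length gs = k \<and> set gs \<subseteq> G}"

lemma finite_tuples: "finite G \<Longrightarrow> finite (tuples G k)"
  using finite_lists_length_eq[of G k] by (simp add: tuples_def conj_commute)

lemma tuples_nth: "gs \<in> tuples G k \<Longrightarrow> i < k \<Longrightarrow> gs ! i \<in> G"
  unfolding tuples_def using nth_mem by blast

lemma tuples_map: "gs \<in> tuples G k \<Longrightarrow> map t gs \<in> tuples (t ` G) k"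
  by (auto simp: tuples_def)

lemma tuples_mono: "G \<subseteq> H \<Longrightarrow> tuples G k \<subseteq> tuples H k"
  by (auto simp: tuples_def)

type_synonym ('f, 'b, 's) wfun = "'f tree \<Rightarrow> (nat list \<Rightarrow> 'b) \<Rightarrow> 's"

text \<open>
  The weighted counterpart of regularity: the states of an automaton are the functions of a finite
  family, and the value of each of them at a tree is a fixed linear combination of products of
  values of the family at the children.
\<close>

definition mono_of ::
  "('f, 'b, 's::{comm_semiring_0, comm_monoid_mult}) wfun list \<Rightarrow> 'f tree list \<Rightarrow> (nat list \<Rightarrow> 'b) \<Rightarrow> 's" where
  "mono_of gs ts \<nu> = (\<Prod>i<length gs. (gs ! i) (ts ! i) (down i \<nu>))"

definition spanned :: "('f, 'b, 's::{comm_semiring_0, comm_monoid_mult}) wfun set \<Rightarrow> nat \<Rightarrow> 'b \<Rightarrow>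
    ('f tree list \<Rightarrow> (nat list \<Rightarrow> 'b) \<Rightarrow> 's) \<Rightarrow> bool" where
  "spanned G k b F \<longleftrightarrow> (\<exists>c. \<forall>ts \<nu>. length ts = k \<longrightarrow> \<nu> [] = b \<longrightarrow>
    F ts \<nu> = (\<Sum>gs\<in>tuples G k. c gs * mono_of gs ts \<nu>))"

text \<open>The combination may be indexed by any finite set and may use a tuple repeatedly; the
  coefficients of equal tuples are added up.\<close>

lemma spannedI:
  assumes "finite G" "finite I" "\<And>i. i \<in> I \<Longrightarrow> gs i \<in> tuples G k"
    and "\<And>ts \<nu>. length ts = k \<Longrightarrow> \<nu> [] = b \<Longrightarrow> F ts \<nu> = (\<Sum>i\<in>I. a i * mono_of (gs i) ts \<nu>)"
  shows "spanned G k b F"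
proof -
  have *: "F ts \<nu> = (\<Sum>g\<in>tuples G k. (\<Sum>i\<in>{i\<in>I. gs i = g}. a i) * mono_of g ts \<nu>)"
    if "length ts = k" "\<nu> [] = b" for ts \<nu>
  proof -
    have "F ts \<nu> = (\<Sum>g\<in>tuples G k. \<Sum>i\<in>{i\<in>I. gs i = g}. a i * mono_of (gs i) ts \<nu>)"
      unfolding assms(4)[of ts \<nu>, OF that]
      by (rule sum.group[symmetric, OF assms(2) finite_tuples[OF assms(1)]]) (use assms(3) in blast)
    also have "\<dots> = (\<Sum>g\<in>tuples G k. (\<Sum>i\<in>{i\<in>I. gs i = g}. a i) * mono_of g ts \<nu>)"
      by (intro sum.cong refl) (simp add: sum_distrib_right)
    finally show ?thesis .
  qed
  show ?thesis unfolding spanned_def by (intro exI allI impI) (rule *)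
qed

lemma spanned_mono:
  assumes "spanned G k b F" "G \<subseteq> H" "finite H"
  shows "spanned H k b F"
proof -
  obtain c where c: "\<And>ts \<nu>. length ts = k \<Longrightarrow> \<nu> [] = b \<Longrightarrow>
    F ts \<nu> = (\<Sum>gs\<in>tuples G k. c gs * mono_of gs ts \<nu>)" using assms(1) unfolding spanned_def by blast
  show ?thesis
    by (rule spannedI[OF assms(3), where gs = "\<lambda>g. g", OF finite_tuples[of G k]])
      (use assms tuples_mono[of G H k] finite_subset c in auto)
qed

lemma spanned_sum:
  assumes "\<And>i. i \<in> I \<Longrightarrow> spanned G k b (F i)"
  shows "spanned G k b (\<lambda>ts \<nu>. \<Sum>i\<in>I. F i ts \<nu>)"
proof -
  have "\<forall>i\<in>I. \<exists>c. \<forall>ts \<nu>. length ts = k \<longrightarrow> \<nu> [] = b \<longrightarrow>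
    F i ts \<nu> = (\<Sum>gs\<in>tuples G k. c gs * mono_of gs ts \<nu>)"
    using assms unfolding spanned_def by blast
  from bchoice[OF this] obtain c where c: "\<And>i ts \<nu>. i \<in> I \<Longrightarrow> length ts = k \<Longrightarrow> \<nu> [] = b \<Longrightarrow>
    F i ts \<nu> = (\<Sum>gs\<in>tuples G k. c i gs * mono_of gs ts \<nu>)"
    by blast
  have "(\<Sum>i\<in>I. F i ts \<nu>) = (\<Sum>gs\<in>tuples G k. (\<Sum>i\<in>I. c i gs) * mono_of gs ts \<nu>)"
    if "length ts = k" "\<nu> [] = b" for ts \<nu>
  proof -
    have "(\<Sum>i\<in>I. F i ts \<nu>) = (\<Sum>i\<in>I. \<Sum>gs\<in>tuples G k. c i gs * mono_of gs ts \<nu>)"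
      by (rule sum.cong[OF refl]) (rule c[of _ ts \<nu>, OF _ that])
    then show ?thesis unfolding sum_distrib_right by (simp add: sum.swap[of _ I])
  qed
  then show ?thesis unfolding spanned_def by (intro exI[of _ "\<lambda>gs. \<Sum>i\<in>I. c i gs"]) simp
qed

lemma spanned_scale:
  assumes "spanned G k b F"
  shows "spanned G k b (\<lambda>ts \<nu>. a * F ts \<nu>)"
proof -
  obtain c where c: "\<And>ts \<nu>. length ts = k \<Longrightarrow> \<nu> [] = b \<Longrightarrow>
    F ts \<nu> = (\<Sum>gs\<in>tuples G k. c gs * mono_of gs ts \<nu>)" using assms(1) unfolding spanned_def by blast
  then have "a * F ts \<nu> = (\<Sum>gs\<in>tuples G k. (a * c gs) * mono_of gs ts \<nu>)"
    if "length ts = k" "\<nu> [] = b" for ts \<nu>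
    using that by (simp add: sum_distrib_left mult.assoc)
  then show ?thesis unfolding spanned_def by (intro exI[of _ "\<lambda>gs. a * c gs"]) simp
qed

definition closed_family :: "('f, 'b, 's::{comm_semiring_0, comm_monoid_mult}) wfun set \<Rightarrow> bool" where
  "closed_family G \<longleftrightarrow> finite G \<and> (\<forall>g\<in>G. \<forall>f k b. spanned G k b (\<lambda>ts. g (Node f ts)))"

definition wreg :: "('f, 'b, 's::{comm_semiring_0, comm_monoid_mult}) wfun \<Rightarrow> bool" where
  "wreg g \<longleftrightarrow> (\<exists>G. closed_family G \<and> g \<in> G)"

lemma wregI:
  assumes "finite G" "g \<in> G" "\<And>g f k b. g \<in> G \<Longrightarrow> spanned G k b (\<lambda>ts. g (Node f ts))"
  shows "wreg g"
  using assms unfolding wreg_def closed_family_def by blast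

text \<open>A function that expands in the old family at the children occurs as a state only at the
  root, so the enlarged family is still closed.\<close>

lemma wreg_insertI:
  assumes "closed_family G" "\<And>f k b. spanned G k b (\<lambda>ts. g (Node f ts))"
  shows "wreg g"
proof (rule wregI[of "insert g G"])
  fix g' f k b assume "g' \<in> insert g G"
  then have "spanned G k b (\<lambda>ts. g' (Node f ts))"
    using assms unfolding closed_family_def by blast
  then show "spanned (insert g G) k b (\<lambda>ts. g' (Node f ts))"
    by (rule spanned_mono) (use assms in \<open>auto simp: closed_family_def\<close>)
qed (use assms in \<open>auto simp: closed_family_def\<close>)

lemma closed_family_UN:
  assumes "finite I" "\<And>i. i \<in> I \<Longrightarrow> closed_family (G i)"
  shows "closed_family (\<Union>i\<in>I. G i)"
  unfolding closed_family_def
proof (intro conjI ballI allI)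
  show fin: "finite (\<Union>i\<in>I. G i)" using assms unfolding closed_family_def by blast
  fix g f k b assume "g \<in> (\<Union>i\<in>I. G i)"
  then obtain i where "i \<in> I" "g \<in> G i" by blast
  then show "spanned (\<Union>i\<in>I. G i) k b (\<lambda>ts. g (Node f ts))"
    using assms(2)[of i] unfolding closed_family_def by (intro spanned_mono[OF _ _ fin]) blast+
qed

lemma wreg_sum:
  assumes "finite I" "\<And>i. i \<in> I \<Longrightarrow> wreg (g i)"
  shows "wreg (\<lambda>\<xi> \<nu>. \<Sum>i\<in>I. g i \<xi> \<nu>)"
proof -
  obtain G where G: "\<And>i. i \<in> I \<Longrightarrow> closed_family (G i) \<and> g i \<in> G i"
    using assms(2) unfolding wreg_def by metis
  have cl: "closed_family (\<Union>i\<in>I. G i)"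
    by (rule closed_family_UN[OF assms(1)]) (use G in blast)
  then have "spanned (\<Union>i\<in>I. G i) k b (\<lambda>ts. g i (Node f ts))" if "i \<in> I" for i k b f
    using G that unfolding closed_family_def by blast
  then show ?thesis
    by (intro wreg_insertI[OF cl] spanned_sum)
qed

lemma wreg_add:
  assumes "wreg g" "wreg h"
  shows "wreg (\<lambda>\<xi> \<nu>. g \<xi> \<nu> + h \<xi> \<nu>)"
  using wreg_sum[of "UNIV :: bool set" "\<lambda>i. if i then g else h"] assms by (simp add: UNIV_bool add.commute)

lemma wreg_scale:
  assumes "wreg g"
  shows "wreg (\<lambda>\<xi> \<nu>. a * g \<xi> \<nu>)"
proof -
  obtain G where G: "closed_family G" "g \<in> G" using assms unfolding wreg_def by blast
  show ?thesis
    by (rule wreg_insertI[OF G(1)], rule spanned_scale) (use G in \<open>simp add: closed_family_def\<close>)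
qed

text \<open>The annotation of the root is read only there and never passed on by
  \<open>down\<close>. Hence one new top state that behaves as if it had read \<open>b\<close> is
  enough.\<close>

lemma wreg_root:
  assumes "wreg g"
  shows "wreg (\<lambda>\<xi> \<nu>. g \<xi> (\<nu>([] := b)))"
proof -
  obtain G where G: "closed_family G" "finite G" "g \<in> G"
    "\<And>g f k b. g \<in> G \<Longrightarrow> spanned G k b (\<lambda>ts. g (Node f ts))"
    using assms unfolding wreg_def closed_family_def by blast
  have d: "down i (\<nu>([] := b)) = down i \<nu>" for i \<nu>
    by (simp add: down_def)
  show ?thesis
  proof (rule wreg_insertI[OF G(1)])
    fix f k b'
    obtain c where c: "\<And>ts \<nu>. length ts = k \<Longrightarrow> \<nu> [] = b \<Longrightarrow>
      g (Node f ts) \<nu> = (\<Sum>gs\<in>tuples G k. c gs * mono_of gs ts \<nu>)"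
      using G(4)[OF G(3)] unfolding spanned_def by blast
    then have "\<And>ts \<nu>. length ts = k \<Longrightarrow>
      g (Node f ts) (\<nu>([] := b)) = (\<Sum>gs\<in>tuples G k. c gs * mono_of gs ts \<nu>)"
      by (simp add: mono_of_def d)
    then show "spanned G k b' (\<lambda>ts \<nu>. g (Node f ts) (\<nu>([] := b)))"
      unfolding spanned_def by blast
  qed
qed

lemma wreg_map:
  fixes g :: "('f, 'b, 's::{comm_semiring_0, comm_monoid_mult}) wfun" and h :: "'c \<Rightarrow> 'b"
  assumes "wreg g"
  shows "wreg (\<lambda>\<xi> \<nu>. g \<xi> (\<lambda>w. h (\<nu> w)))"
proof -
  obtain G where G: "closed_family G" "finite G" "g \<in> G"
    "\<And>g f k b. g \<in> G \<Longrightarrow> spanned G k b (\<lambda>ts. g (Node f ts))"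
    using assms unfolding wreg_def closed_family_def by blast
  let ?t = "\<lambda>g \<xi> \<nu>. g \<xi> (\<lambda>w. h (\<nu> w))"
  show ?thesis
  proof (rule wregI[of "?t ` G"])
    fix g' f k and b :: 'c assume "g' \<in> ?t ` G"
    then obtain g where g: "g' = ?t g" "g \<in> G" by (rule imageE)
    obtain c where c: "\<And>ts \<nu>. length ts = k \<Longrightarrow> \<nu> [] = h b \<Longrightarrow>
      g (Node f ts) \<nu> = (\<Sum>gs\<in>tuples G k. c gs * mono_of gs ts \<nu>)"
      using G(4)[OF g(2)] unfolding spanned_def by blast
    show "spanned (?t ` G) k b (\<lambda>ts. g' (Node f ts))"
      unfolding g(1)
    proof (rule spannedI[where gs = "map ?t" and I = "tuples G k" and a = c])
      fix ts :: "'f tree list" and \<nu> :: "nat list \<Rightarrow> 'c" assume "length ts = k" "\<nu> [] = b"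
      then have "g (Node f ts) (\<lambda>w. h (\<nu> w)) = (\<Sum>gs\<in>tuples G k. c gs * mono_of gs ts (\<lambda>w. h (\<nu> w)))"
        by (intro c) simp_all
      also have "\<dots> = (\<Sum>gs\<in>tuples G k. c gs * mono_of (map ?t gs) ts \<nu>)"
        by (intro sum.cong refl) (simp add: mono_of_def down_comp)
      finally show "g (Node f ts) (\<lambda>w. h (\<nu> w)) = \<dots>" .
    qed (use G(2) in \<open>simp_all add: finite_tuples tuples_map\<close>)
  qed (use G(2,3) in auto)
qed

text \<open>Product automaton: by commutativity the product of two monomials is a monomial in the
  products of pairs.\<close>

lemma wreg_mult:
  assumes "wreg g" "wreg h"
  shows "wreg (\<lambda>\<xi> \<nu>. g \<xi> \<nu> * h \<xi> \<nu>)"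
proof -
  obtain G where G: "closed_family G" "finite G" "g \<in> G"
    "\<And>g f k b. g \<in> G \<Longrightarrow> spanned G k b (\<lambda>ts. g (Node f ts))"
    using assms(1) unfolding wreg_def closed_family_def by blast
  obtain H where H: "closed_family H" "finite H" "h \<in> H"
    "\<And>g f k b. g \<in> H \<Longrightarrow> spanned H k b (\<lambda>ts. g (Node f ts))"
    using assms(2) unfolding wreg_def closed_family_def by blast
  let ?t = "\<lambda>(g, h) \<xi> \<nu>. g \<xi> \<nu> * h \<xi> \<nu>"
  let ?R = "?t ` (G \<times> H)"
  show ?thesis
  proof (rule wregI[of ?R])
    fix g' f k b assume "g' \<in> ?R"
    then obtain p where p: "g' = ?t p" "p \<in> G \<times> H" by (rule imageE)
    obtain g h where gh: "p = (g, h)" "g \<in> G" "h \<in> H" using p(2) by (rule SigmaE)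
    obtain c where c: "\<And>ts \<nu>. length ts = k \<Longrightarrow> \<nu> [] = b \<Longrightarrow>
      g (Node f ts) \<nu> = (\<Sum>gs\<in>tuples G k. c gs * mono_of gs ts \<nu>)"
      using G(4)[OF gh(2)] unfolding spanned_def by blast
    obtain d where d: "\<And>ts \<nu>. length ts = k \<Longrightarrow> \<nu> [] = b \<Longrightarrow>
      h (Node f ts) \<nu> = (\<Sum>gs\<in>tuples H k. d gs * mono_of gs ts \<nu>)"
      using H(4)[OF gh(3)] unfolding spanned_def by blast
    have "spanned ?R k b (\<lambda>ts \<nu>. g (Node f ts) \<nu> * h (Node f ts) \<nu>)"
    proof (rule spannedI[where gs = "\<lambda>(p, q). map ?t (zip p q)" and I = "tuples G k \<times> tuples H k"
          and a = "\<lambda>(p, q). c p * d q"])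
      fix ts :: "'a tree list" and \<nu> :: "nat list \<Rightarrow> 'b" assume len: "length ts = k" "\<nu> [] = b"
      have "c p * mono_of p ts \<nu> * (d q * mono_of q ts \<nu>) = (c p * d q) * mono_of (map ?t (zip p q)) ts \<nu>"
        if "p \<in> tuples G k" "q \<in> tuples H k" for p q
      proof -
        have "mono_of (map ?t (zip p q)) ts \<nu> = mono_of p ts \<nu> * mono_of q ts \<nu>"
          using that by (simp add: mono_of_def tuples_def prod.distrib)
        then show ?thesis by (simp add: mult.assoc mult.left_commute)
      qed
      then show "g (Node f ts) \<nu> * h (Node f ts) \<nu> = (\<Sum>i\<in>tuples G k \<times> tuples H k.
          (case i of (p, q) \<Rightarrow> c p * d q) * mono_of (case i of (p, q) \<Rightarrow> map ?t (zip p q)) ts \<nu>)"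
        unfolding c[of ts \<nu>, OF len] d[of ts \<nu>, OF len] sum_product sum.cartesian_product
        by (intro sum.cong refl) auto
    next
      fix i assume "i \<in> tuples G k \<times> tuples H k"
      then obtain p q where i: "i = (p, q)" "p \<in> tuples G k" "q \<in> tuples H k" by blast
      then have "set (zip p q) \<subseteq> G \<times> H" "length (zip p q) = k"
        by (auto simp: tuples_def dest: set_zip_leftD set_zip_rightD)
      then show "(case i of (p, q) \<Rightarrow> map ?t (zip p q)) \<in> tuples ?R k"
        unfolding i(1) tuples_def by auto
    qed (use G(2) H(2) in \<open>simp_all add: finite_tuples\<close>)
    then show "spanned ?R k b (\<lambda>ts. g' (Node f ts))" unfolding p(1) gh(1) by simp
  next
    show "(\<lambda>\<xi> \<nu>. g \<xi> \<nu> * h \<xi> \<nu>) \<in> ?R"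
      using imageI[of "(g, h)" "G \<times> H" ?t] G(3) H(3) by simp
  qed (use G(2) H(2) in simp)
qed

section \<open>Locality and projection of recognizable functions\<close>

lemma closed_family_local:
  assumes "closed_family G"
  shows "g \<in> G \<Longrightarrow> \<forall>w\<in>pos \<xi>. \<nu> w = \<nu>' w \<Longrightarrow> g \<xi> \<nu> = g \<xi> \<nu>'"
proof (induction \<xi> arbitrary: g \<nu> \<nu>')
  case (Node f ts)
  have root: "\<nu>' [] = \<nu> []" using Node.prems(2) by (simp add: ball_pos_Node)
  have child: "g (ts ! i) (down i \<nu>) = g (ts ! i) (down i \<nu>')" if "i < length ts" "g \<in> G" for i g
    using that Node.prems(2) by (intro Node.IH) (simp_all add: ball_pos_Node down_def)
  have "spanned G (length ts) (\<nu> []) (\<lambda>ts. g (Node f ts))"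
    using assms Node.prems(1) unfolding closed_family_def by blast
  then obtain c where c: "\<And>ts' \<nu>'. length ts' = length ts \<Longrightarrow> \<nu>' [] = \<nu> [] \<Longrightarrow>
      g (Node f ts') \<nu>' = (\<Sum>gs\<in>tuples G (length ts). c gs * mono_of gs ts' \<nu>')"
    unfolding spanned_def by blast
  have "mono_of gs ts \<nu> = mono_of gs ts \<nu>'" if "gs \<in> tuples G (length ts)" for gs
    unfolding mono_of_def using that tuples_nth[OF that]
    by (intro prod.cong refl child) (auto simp: tuples_def)
  then show ?case unfolding c[of ts \<nu>, OF refl refl] c[of ts \<nu>', OF refl root] by (simp cong: sum.cong)
qed

lemma wreg_local:
  assumes "wreg g" "\<forall>w\<in>pos \<xi>. \<nu> w = \<nu>' w"
  shows "g \<xi> \<nu> = g \<xi> \<nu>'"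
  using assms closed_family_local unfolding wreg_def by blast

text \<open>A function on a disjoint union is a family of functions on its parts.
  \<open>graft\<close> also yields values at lists that start with 0, outside \<open>S\<close>;
  hence the restrictions and the assumption \<open>local\<close>.\<close>

lemma sum_PiE_children:
  fixes F :: "(nat list \<Rightarrow> 'c) \<Rightarrow> 's::comm_monoid_add"
  assumes S: "S = (\<Union>i<k. (#) (Suc i) ` P i)"
    and local: "\<And>\<eta> \<eta>'. \<forall>w\<in>S. \<eta> w = \<eta>' w \<Longrightarrow> F \<eta> = F \<eta>'"
  shows "(\<Sum>\<eta>\<in>S \<rightarrow>\<^sub>E C. F \<eta>) = (\<Sum>\<eta>s\<in>PiE {..<k} (\<lambda>i. P i \<rightarrow>\<^sub>E C). F (graft undefined \<eta>s))"
proof -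
  let ?D = "PiE {..<k} (\<lambda>i. P i \<rightarrow>\<^sub>E C)"
  let ?to = "\<lambda>\<eta>s. restrict (graft undefined \<eta>s) S"
  let ?from = "\<lambda>\<eta>. restrict (\<lambda>i. restrict (down i \<eta>) (P i)) {..<k}"
  have mem: "Suc i # w \<in> S \<longleftrightarrow> i < k \<and> w \<in> P i" for i w
    unfolding S by auto
  have "(\<Sum>\<eta>s\<in>?D. F (graft undefined \<eta>s)) = (\<Sum>\<eta>\<in>S \<rightarrow>\<^sub>E C. F \<eta>)"
  proof (rule sum.reindex_bij_witness[where i = ?from and j = ?to])
    fix \<eta>s assume \<eta>s: "\<eta>s \<in> ?D"
    have "graft undefined \<eta>s w \<in> C" if wS: "w \<in> S" for w
    proof -
      obtain i u where w: "w = Suc i # u" "i < k" "u \<in> P i" using wS unfolding S by auto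
      have "\<eta>s i \<in> P i \<rightarrow>\<^sub>E C" using \<eta>s w(2) by (auto dest: PiE_mem)
      then show ?thesis using w by (auto simp: graft_def)
    qed
    then show "?to \<eta>s \<in> S \<rightarrow>\<^sub>E C" by simp
    show "?from (?to \<eta>s) = \<eta>s"
    proof (rule ext)
      fix i
      show "?from (?to \<eta>s) i = \<eta>s i"
      proof (cases "i < k")
        case True
        then have *: "\<eta>s i \<in> P i \<rightarrow>\<^sub>E C" using \<eta>s by (auto dest: PiE_mem)
        have "restrict (down i (?to \<eta>s)) (P i) u = \<eta>s i u" for u
          using PiE_arb[OF *, of u] True by (cases "u \<in> P i") (simp_all add: down_def mem graft_def)
        then show ?thesis using True by auto
      next
        case False
        then show ?thesis using PiE_arb[OF \<eta>s, of i] by simp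
      qed
    qed
    show "F (?to \<eta>s) = F (graft undefined \<eta>s)" by (rule local) simp
  next
    fix \<eta> assume \<eta>: "\<eta> \<in> S \<rightarrow>\<^sub>E C"
    show "?to (?from \<eta>) = \<eta>"
    proof
      fix w
      show "?to (?from \<eta>) w = \<eta> w"
      proof (cases "w \<in> S")
        case True
        then obtain i u where "w = Suc i # u" "i < k" "u \<in> P i" unfolding S by auto
        then show ?thesis using True by (simp add: graft_def down_def)
      next
        case False
        then show ?thesis using PiE_arb[OF \<eta> False] by simp
      qed
    qed
    show "?from \<eta> \<in> ?D" using \<eta> by (auto simp: down_def mem)
  qed
  then show ?thesis by simp
qed

lemma pos_Node_eq: "pos (Node f ts) = insert [] (\<Union>i<length ts. (#) (Suc i) ` pos (ts ! i))"
proof (intro set_eqI)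
  fix w
  show "w \<in> pos (Node f ts) \<longleftrightarrow> w \<in> insert [] (\<Union>i<length ts. (#) (Suc i) ` pos (ts ! i))"
    using bex_pos_Node[of f ts "\<lambda>u. w = u"] by auto
qed

lemma sum_pos_Node:
  fixes F :: "(nat list \<Rightarrow> 'c) \<Rightarrow> 's::comm_monoid_add"
  assumes local: "\<And>\<mu> \<mu>'. \<forall>w\<in>pos (Node f ts). \<mu> w = \<mu>' w \<Longrightarrow> F \<mu> = F \<mu>'"
  shows "(\<Sum>\<mu>\<in>pos (Node f ts) \<rightarrow>\<^sub>E C. F \<mu>) =
    (\<Sum>c\<in>C. \<Sum>\<mu>s\<in>PiE {..<length ts} (\<lambda>i. pos (ts ! i) \<rightarrow>\<^sub>E C). F (graft c \<mu>s))"
proof -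
  let ?S = "\<Union>i<length ts. (#) (Suc i) ` pos (ts ! i)"
  have graft: "(graft undefined \<mu>s)([] := c) = graft c \<mu>s" for c :: 'c and \<mu>s
    by (auto simp: graft_def fun_eq_iff split: list.split)
  have "[] \<notin> ?S" by auto
  then have "(\<Sum>\<mu>\<in>pos (Node f ts) \<rightarrow>\<^sub>E C. F \<mu>) = (\<Sum>(c, \<eta>)\<in>C \<times> (?S \<rightarrow>\<^sub>E C). F (\<eta>([] := c)))"
    unfolding pos_Node_eq PiE_insert_eq by (subst sum.reindex[OF inj_combinator]) (simp_all add: case_prod_unfold)
  also have "\<dots> = (\<Sum>c\<in>C. \<Sum>\<eta>\<in>?S \<rightarrow>\<^sub>E C. F (\<eta>([] := c)))"
    by (simp add: sum.cartesian_product)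
  also have "\<dots> = (\<Sum>c\<in>C. \<Sum>\<mu>s\<in>PiE {..<length ts} (\<lambda>i. pos (ts ! i) \<rightarrow>\<^sub>E C). F ((graft undefined \<mu>s)([] := c)))"
    by (rule sum.cong[OF refl], rule sum_PiE_children[OF refl], rule local) (auto simp: pos_Node_eq)
  finally show ?thesis by (simp only: graft)
qed

text \<open>The guesses at the root and in the children are independent. So the sum over all guesses
  is a sum over the root guess \<open>c\<close> of products of such sums at the children, and the
  projections of a closed family form a closed family.\<close>

lemma wreg_proj:
  fixes g :: "('f, 'b \<times> 'c, 's::{comm_semiring_0, comm_monoid_mult}) wfun"
  assumes "wreg g" "finite C"
  shows "wreg (\<lambda>\<xi> \<nu>. \<Sum>\<mu>\<in>pos \<xi> \<rightarrow>\<^sub>E C. g \<xi> (\<lambda>w. (\<nu> w, \<mu> w)))"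
proof -
  obtain G where G: "closed_family G" "finite G" "g \<in> G"
    "\<And>g f k b. g \<in> G \<Longrightarrow> spanned G k b (\<lambda>ts. g (Node f ts))"
    using assms(1) unfolding wreg_def closed_family_def by blast
  define pr where "pr = (\<lambda>g \<xi> \<nu>. \<Sum>\<mu>\<in>pos \<xi> \<rightarrow>\<^sub>E C. (g :: ('f, 'b \<times> 'c, 's) wfun) \<xi> (\<lambda>w. (\<nu> w, \<mu> w)))"
  have "wreg (pr g)"
  proof (rule wregI[of "pr ` G"])
    fix g' f k b assume "g' \<in> pr ` G"
    then obtain g where g: "g' = pr g" "g \<in> G" by (rule imageE)
    have "\<forall>c. \<exists>a. \<forall>ts \<nu>. length ts = k \<longrightarrow> \<nu> [] = (b, c) \<longrightarrow>
      g (Node f ts) \<nu> = (\<Sum>gs\<in>tuples G k. a gs * mono_of gs ts \<nu>)"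
      using G(4)[OF g(2)] unfolding spanned_def by blast
    from choice[OF this] obtain a where a: "\<And>c ts \<nu>. length ts = k \<Longrightarrow> \<nu> [] = (b, c) \<Longrightarrow>
      g (Node f ts) \<nu> = (\<Sum>gs\<in>tuples G k. a c gs * mono_of gs ts \<nu>)"
      by blast
    show "spanned (pr ` G) k b (\<lambda>ts. g' (Node f ts))"
      unfolding g(1)
    proof (rule spannedI[where gs = "\<lambda>(c, gs). map pr gs" and I = "C \<times> tuples G k"
          and a = "\<lambda>(c, gs). a c gs"])
      fix ts :: "'f tree list" and \<nu> :: "nat list \<Rightarrow> 'b" assume len: "length ts = k" and b: "\<nu> [] = b"
      let ?D = "PiE {..<length ts} (\<lambda>i. pos (ts ! i) \<rightarrow>\<^sub>E C)"
      have "pr g (Node f ts) \<nu> = (\<Sum>c\<in>C. \<Sum>\<mu>s\<in>?D. g (Node f ts) (\<lambda>w. (\<nu> w, graft c \<mu>s w)))"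
        unfolding pr_def by (rule sum_pos_Node) (intro closed_family_local[OF G(1) g(2)], simp)
      also have "\<dots> = (\<Sum>c\<in>C. \<Sum>gs\<in>tuples G k. a c gs * mono_of (map pr gs) ts \<nu>)"
      proof (rule sum.cong[OF refl])
        fix c :: 'c
        have d: "down i (\<lambda>w. (\<nu> w, graft c \<mu>s w)) = (\<lambda>w. (down i \<nu> w, \<mu>s i w))" for i \<mu>s
          by (simp add: down_def graft_def)
        have "(\<Sum>\<mu>s\<in>?D. g (Node f ts) (\<lambda>w. (\<nu> w, graft c \<mu>s w))) =
            (\<Sum>\<mu>s\<in>?D. \<Sum>gs\<in>tuples G k. a c gs * mono_of gs ts (\<lambda>w. (\<nu> w, graft c \<mu>s w)))"
          by (intro sum.cong refl a) (simp_all add: len b)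
        also have "\<dots> = (\<Sum>gs\<in>tuples G k. a c gs * (\<Sum>\<mu>s\<in>?D. mono_of gs ts (\<lambda>w. (\<nu> w, graft c \<mu>s w))))"
          by (subst sum.swap) (simp add: sum_distrib_left)
        also have "\<dots> = (\<Sum>gs\<in>tuples G k. a c gs * mono_of (map pr gs) ts \<nu>)"
        proof (rule sum.cong[OF refl])
          fix gs assume gs: "gs \<in> tuples G k"
          then have lg: "length gs = length ts" by (simp add: tuples_def len)
          have "mono_of (map pr gs) ts \<nu> =
              (\<Prod>i<length ts. \<Sum>\<mu>\<in>pos (ts ! i) \<rightarrow>\<^sub>E C. (gs ! i) (ts ! i) (\<lambda>w. (down i \<nu> w, \<mu> w)))"
            by (simp add: mono_of_def pr_def lg)
          also have "\<dots> = (\<Sum>\<mu>s\<in>?D. mono_of gs ts (\<lambda>w. (\<nu> w, graft c \<mu>s w)))"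
            by (subst prod_sum_distrib_PiE) (simp_all add: finite_PiE finite_pos assms(2) mono_of_def lg d)
          finally show "a c gs * (\<Sum>\<mu>s\<in>?D. mono_of gs ts (\<lambda>w. (\<nu> w, graft c \<mu>s w))) =
            a c gs * mono_of (map pr gs) ts \<nu>" by simp
        qed
        finally show "(\<Sum>\<mu>s\<in>?D. g (Node f ts) (\<lambda>w. (\<nu> w, graft c \<mu>s w))) =
          (\<Sum>gs\<in>tuples G k. a c gs * mono_of (map pr gs) ts \<nu>)" .
      qed
      finally show "pr g (Node f ts) \<nu> = (\<Sum>i\<in>C \<times> tuples G k.
          (case i of (c, gs) \<Rightarrow> a c gs) * mono_of (case i of (c, gs) \<Rightarrow> map pr gs) ts \<nu>)"
        by (simp add: sum.cartesian_product case_prod_unfold)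
    next
      fix i assume "i \<in> C \<times> tuples G k"
      then show "(case i of (c, gs) \<Rightarrow> map pr gs) \<in> tuples (pr ` G) k"
        by (auto simp: tuples_map)
    qed (use G(2) assms(2) in \<open>simp_all add: finite_tuples\<close>)
  qed (use G(2,3) in simp_all)
  then show ?thesis by (simp add: pr_def)
qed

text \<open>The states are indicators of complete truth vectors rather than of single predicates.
  Exactly one tuple of vectors matches the children, so at most one summand survives.\<close>

lemma wreg_regular:
  fixes P :: "'f tree \<Rightarrow> (nat list \<Rightarrow> 'b) \<Rightarrow> bool"
  assumes "regular P"
  shows "wreg (\<lambda>\<xi> \<nu>. tv (P \<xi> \<nu>) :: 's::{comm_semiring_0, comm_monoid_mult})"
proof -
  obtain \<P> where \<P>: "finite \<P>" "P \<in> \<P>" "congr \<P>" using assms unfolding regular_def by blast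
  define vec where "vec \<xi> \<nu> = {p\<in>\<P>. p \<xi> \<nu>}" for \<xi> :: "'f tree" and \<nu> :: "nat list \<Rightarrow> 'b"
  define ind where "ind S = (\<lambda>\<xi> \<nu>. tv (vec \<xi> \<nu> = S) :: 's)" for S
  have reg: "wreg (ind S)" if "S \<in> Pow \<P>" for S
  proof (rule wregI[of "ind ` Pow \<P>"])
    fix g' and f :: 'f and k b assume "g' \<in> ind ` Pow \<P>"
    then obtain S where S: "g' = ind S" by (rule imageE)
    let ?steps = "\<lambda>Ss (ts :: 'f tree list) \<nu>. length ts = k \<and> \<nu> [] = b \<and> (\<forall>i<k. vec (ts ! i) (down i \<nu>) = Ss ! i)"
    \<comment> \<open>\<open>T\<close> collects the transitions of the deterministic automaton into
      \<open>S\<close>. By congruence it does not matter which \<open>ts\<close> and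
      \<open>\<nu>\<close> witness membership.\<close>
    define T where "T = {Ss\<in>tuples (Pow \<P>) k. \<exists>ts \<nu>. ?steps Ss ts \<nu> \<and> vec (Node f ts) \<nu> = S}"
    have fin: "finite T" using \<P>(1) by (simp add: T_def finite_tuples)
    show "spanned (ind ` Pow \<P>) k b (\<lambda>ts. g' (Node f ts))"
      unfolding S
    proof (rule spannedI[where gs = "map ind" and I = T and a = "\<lambda>_. 1"])
      fix ts :: "'f tree list" and \<nu> :: "nat list \<Rightarrow> 'b" assume len: "length ts = k" "\<nu> [] = b"
      define Ss where "Ss = map (\<lambda>i. vec (ts ! i) (down i \<nu>)) [0..<k]"
      have Ss: "?steps Ss ts \<nu>" using len by (simp add: Ss_def)
      have "vec (Node f ts) \<nu> = vec (Node f ts') \<nu>'" if s: "?steps Ss ts' \<nu>'" for ts' \<nu>'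
      proof -
        have v: "vec (ts ! i) (down i \<nu>) = vec (ts' ! i) (down i \<nu>')" if "i < k" for i
          using s Ss that by simp
        have "p (Node f ts) \<nu> = p (Node f ts') \<nu>'" if p: "p \<in> \<P>" for p
        proof (rule congrD[OF \<P>(3) p])
          fix i p assume "i < length ts" "p \<in> \<P>"
          then show "p (ts ! i) (down i \<nu>) = p (ts' ! i) (down i \<nu>')"
            using v[of i] len unfolding vec_def by auto
        qed (use s len in simp_all)
        then show ?thesis unfolding vec_def by blast
      qed
      then have "Ss \<in> T \<longleftrightarrow> vec (Node f ts) \<nu> = S"
        using Ss unfolding T_def by (auto simp: tuples_def Ss_def vec_def)
      moreover have "mono_of (map ind Us) ts \<nu> = tv (Us = Ss)" if "Us \<in> T" for Us
      proof -
        have l: "length Us = k" using that by (auto simp: T_def tuples_def)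
        have "mono_of (map ind Us) ts \<nu> = (\<Prod>i<k. tv (vec (ts ! i) (down i \<nu>) = Us ! i))"
          by (simp add: mono_of_def l ind_def)
        also have "\<dots> = tv (\<forall>i\<in>{..<k}. vec (ts ! i) (down i \<nu>) = Us ! i)" by (rule prod_tv) simp
        also have "(\<forall>i\<in>{..<k}. vec (ts ! i) (down i \<nu>) = Us ! i) \<longleftrightarrow> Us = Ss"
          by (auto simp: list_eq_iff_nth_eq l Ss_def)
        finally show ?thesis .
      qed
      ultimately show "ind S (Node f ts) \<nu> = (\<Sum>Ss\<in>T. 1 * mono_of (map ind Ss) ts \<nu>)"
        using sum_tv[OF fin, of Ss "\<lambda>_. 1 :: 's"] by (simp add: ind_def)
    qed (use \<P>(1) fin in \<open>auto simp: T_def tuples_def\<close>)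
  qed (use \<P>(1) that in simp_all)
  have "tv (P \<xi> \<nu>) = (\<Sum>S\<in>{S\<in>Pow \<P>. P \<in> S}. ind S \<xi> \<nu>)" for \<xi> \<nu>
  proof -
    have "(\<Sum>S\<in>{S\<in>Pow \<P>. P \<in> S}. ind S \<xi> \<nu>) = (\<Sum>S\<in>{S\<in>Pow \<P>. P \<in> S}. tv (S = vec \<xi> \<nu>) * 1)"
      by (intro sum.cong) (auto simp: ind_def)
    also have "\<dots> = tv (vec \<xi> \<nu> \<in> {S\<in>Pow \<P>. P \<in> S}) * 1"
      using \<P>(1) by (intro sum_tv) simp
    finally show ?thesis using \<P>(2) by (simp add: vec_def)
  qed
  moreover have "wreg (\<lambda>\<xi> \<nu>. \<Sum>S\<in>{S\<in>Pow \<P>. P \<in> S}. ind S \<xi> \<nu>)"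
    by (rule wreg_sum) (use \<P>(1) reg in simp_all)
  ultimately show ?thesis by simp
qed

lemma wreg_const: "wreg (\<lambda>\<xi> \<nu>. a)"
  using wreg_scale[OF wreg_regular[OF regular_True], of a] by simp

lemma prod_pos_Node:
  fixes F :: "nat list \<Rightarrow> 's::comm_monoid_mult"
  shows "(\<Prod>w\<in>pos (Node f ts). F w) = F [] * (\<Prod>i<length ts. \<Prod>w\<in>pos (ts ! i). F (Suc i # w))"
proof -
  have "(\<Prod>w\<in>(\<Union>i\<in>{..<length ts}. (#) (Suc i) ` pos (ts ! i)). F w) =
      (\<Prod>i<length ts. \<Prod>w\<in>(#) (Suc i) ` pos (ts ! i). F w)"
    by (rule prod.UNION_disjoint) (auto simp: finite_pos)
  also have "\<dots> = (\<Prod>i<length ts. \<Prod>w\<in>pos (ts ! i). F (Suc i # w))"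
    by (rule prod.cong[OF refl], subst prod.reindex) auto
  finally show ?thesis
    unfolding pos_Node_eq by (subst prod.insert) (auto simp: finite_pos)
qed

text \<open>One state is enough, with the factor of the root as its transition weight.\<close>

lemma wreg_prod_pos: "wreg (\<lambda>\<xi> \<nu>. \<Prod>w\<in>pos \<xi>. a (\<nu> w))"
proof (rule wregI[of "{\<lambda>\<xi> \<nu>. \<Prod>w\<in>pos \<xi>. a (\<nu> w)}"])
  fix g :: "('a, 'b, 'c) wfun" and f k b assume g: "g \<in> {\<lambda>\<xi> \<nu>. \<Prod>w\<in>pos \<xi>. a (\<nu> w)}"
  then have "spanned {g} k b (\<lambda>ts. g (Node f ts))"
    by (intro spannedI[where gs = "\<lambda>_. replicate k g" and I = "{()}" and a = "\<lambda>_. a b"])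
      (auto simp: tuples_def mono_of_def prod_pos_Node down_def set_replicate_conv_if)
  then show "spanned {\<lambda>\<xi> \<nu>. \<Prod>w\<in>pos \<xi>. a (\<nu> w)} k b (\<lambda>ts. g (Node f ts))" using g by simp
qed simp_all

section \<open>From restricted MSO to automata\<close>

text \<open>Subsets of the tree correspond to extensional Boolean guesses; any difference between
  the two lies outside the tree.\<close>

lemma wreg_ex2:
  assumes "wreg g"
  shows "wreg (\<lambda>\<xi> \<nu>. \<Sum>V\<in>Pow (pos \<xi>). g \<xi> (\<lambda>w. (\<nu> w, w \<in> V)))"
proof -
  have "(\<Sum>V\<in>Pow (pos \<xi>). g \<xi> (\<lambda>w. (\<nu> w, w \<in> V))) =
      (\<Sum>\<mu>\<in>pos \<xi> \<rightarrow>\<^sub>E UNIV. g \<xi> (\<lambda>w. (\<nu> w, \<mu> w)))" for \<xi> \<nu>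
  proof (rule sum.reindex_bij_witness
      [where i = "\<lambda>\<mu>. {w\<in>pos \<xi>. \<mu> w}" and j = "\<lambda>V. restrict (\<lambda>w. w \<in> V) (pos \<xi>)"])
    fix V
    show "g \<xi> (\<lambda>w. (\<nu> w, restrict (\<lambda>w. w \<in> V) (pos \<xi>) w)) = g \<xi> (\<lambda>w. (\<nu> w, w \<in> V))"
      by (rule wreg_local[OF assms]) simp
  next
    fix \<mu> :: "nat list \<Rightarrow> bool" assume \<mu>: "\<mu> \<in> pos \<xi> \<rightarrow>\<^sub>E UNIV"
    show "restrict (\<lambda>w. w \<in> {w \<in> pos \<xi>. \<mu> w}) (pos \<xi>) = \<mu>"
    proof
      fix w
      show "restrict (\<lambda>w. w \<in> {w \<in> pos \<xi>. \<mu> w}) (pos \<xi>) w = \<mu> w"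
        using PiE_arb[OF \<mu>, of w] by (cases "w \<in> pos \<xi>") simp_all
    qed
  qed auto
  then show ?thesis using wreg_proj[OF assms, of UNIV] by simp
qed

text \<open>The uniqueness test as a factor removes all sets but the singletons, and each singleton
  stands for one position.\<close>

lemma wreg_ex1:
  fixes g :: "('f, 'b \<times> bool, 's::{comm_semiring_0, comm_monoid_mult}) wfun"
  assumes "wreg g"
  shows "wreg (\<lambda>\<xi> \<nu>. \<Sum>v\<in>pos \<xi>. g \<xi> (\<lambda>w. (\<nu> w, w = v)))"
proof -
  let ?one = "\<lambda>(\<xi> :: 'f tree) \<nu>. \<exists>!w. w \<in> pos \<xi> \<and> snd (\<nu> w :: 'b \<times> bool)"
  let ?F = "\<lambda>\<xi> \<nu>. tv (?one \<xi> \<nu>) * g \<xi> \<nu>"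
  have "(\<Sum>v\<in>pos \<xi>. g \<xi> (\<lambda>w. (\<nu> w, w = v))) = (\<Sum>V\<in>Pow (pos \<xi>). ?F \<xi> (\<lambda>w. (\<nu> w, w \<in> V)))" for \<xi> \<nu>
  proof -
    have "(\<Sum>V\<in>Pow (pos \<xi>). ?F \<xi> (\<lambda>w. (\<nu> w, w \<in> V))) = (\<Sum>V\<in>(\<lambda>v. {v}) ` pos \<xi>. ?F \<xi> (\<lambda>w. (\<nu> w, w \<in> V)))"
    proof (rule sum.mono_neutral_right)
      show "\<forall>V\<in>Pow (pos \<xi>) - (\<lambda>v. {v}) ` pos \<xi>. ?F \<xi> (\<lambda>w. (\<nu> w, w \<in> V)) = 0"
      proof
        fix V assume V: "V \<in> Pow (pos \<xi>) - (\<lambda>v. {v}) ` pos \<xi>"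
        have False if one: "\<exists>!w. w \<in> pos \<xi> \<and> w \<in> V"
        proof -
          from one obtain v where "v \<in> pos \<xi>" "V = {v}" using V by auto
          then show False using V by simp
        qed
        then show "?F \<xi> (\<lambda>w. (\<nu> w, w \<in> V)) = 0" by auto
      qed
    qed (auto simp: finite_pos)
    also have "\<dots> = (\<Sum>v\<in>pos \<xi>. g \<xi> (\<lambda>w. (\<nu> w, w = v)))"
      by (subst sum.reindex) (auto intro!: sum.cong)
    finally show ?thesis by simp
  qed
  moreover have "wreg ?F"
    by (intro wreg_mult wreg_regular regular_unique assms)
  ultimately show ?thesis using wreg_ex2[of ?F] by simp
qed

text \<open>These are the recognizable step functions. The definition uses no algebraic structure on
  the values, so arbitrary operations can be applied to them.\<close>

definition stepfun :: "('f, 'b, 's) wfun \<Rightarrow> bool" where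
  "stepfun g \<longleftrightarrow> (\<exists>A. finite A \<and> (\<forall>\<xi> \<nu>. g \<xi> \<nu> \<in> A) \<and> (\<forall>a. regular (\<lambda>\<xi> \<nu>. g \<xi> \<nu> = a)))"

text \<open>Each value of the combination is attained on a finite union of intersections of regular
  sets. With one argument ignored this also covers negation.\<close>

lemma stepfun_combine:
  assumes "stepfun g" "stepfun h"
  shows "stepfun (\<lambda>\<xi> \<nu>. F (g \<xi> \<nu>) (h \<xi> \<nu>))"
proof -
  obtain A where A: "finite A" "\<And>\<xi> \<nu>. g \<xi> \<nu> \<in> A" "\<And>a. regular (\<lambda>\<xi> \<nu>. g \<xi> \<nu> = a)"
    using assms(1) unfolding stepfun_def by blast
  obtain B where B: "finite B" "\<And>\<xi> \<nu>. h \<xi> \<nu> \<in> B" "\<And>a. regular (\<lambda>\<xi> \<nu>. h \<xi> \<nu> = a)"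
    using assms(2) unfolding stepfun_def by blast
  have "regular (\<lambda>\<xi> \<nu>. \<exists>p\<in>{p\<in>A \<times> B. F (fst p) (snd p) = c}. g \<xi> \<nu> = fst p \<and> h \<xi> \<nu> = snd p)" for c
    by (rule regular_bex) (use A B in \<open>simp_all add: regular_conj\<close>)
  moreover have "(\<exists>p\<in>{p\<in>A \<times> B. F (fst p) (snd p) = c}. g \<xi> \<nu> = fst p \<and> h \<xi> \<nu> = snd p) \<longleftrightarrow>
      F (g \<xi> \<nu>) (h \<xi> \<nu>) = c" for c \<xi> \<nu>
    using A(2) B(2) by auto
  ultimately have "regular (\<lambda>\<xi> \<nu>. F (g \<xi> \<nu>) (h \<xi> \<nu>) = c)" for c by simp
  moreover have "finite ((\<lambda>(a, b). F a b) ` (A \<times> B))" using A(1) B(1) by simp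
  moreover have "F (g \<xi> \<nu>) (h \<xi> \<nu>) \<in> (\<lambda>(a, b). F a b) ` (A \<times> B)" for \<xi> \<nu>
    using A(2) B(2) by auto
  ultimately show ?thesis unfolding stepfun_def by blast
qed

lemma stepfun_regular:
  assumes "regular P"
  shows "stepfun (\<lambda>\<xi> \<nu>. if P \<xi> \<nu> then a else b)"
proof -
  have "regular (\<lambda>\<xi> \<nu>. (P \<xi> \<nu> \<and> a = c) \<or> (\<not> P \<xi> \<nu> \<and> b = c))" for c
    using assms regular_not[OF regular_True]
    by (cases "a = c"; cases "b = c") (simp_all add: regular_True regular_not)
  moreover have "(P \<xi> \<nu> \<and> a = c) \<or> (\<not> P \<xi> \<nu> \<and> b = c) \<longleftrightarrow> (if P \<xi> \<nu> then a else b) = c" for \<xi> \<nu> c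
    by simp
  ultimately have "regular (\<lambda>\<xi> \<nu>. (if P \<xi> \<nu> then a else b) = c)" for c by simp
  then show ?thesis unfolding stepfun_def by (intro exI[of _ "{a, b}"]) simp
qed

lemma stepfun_const: "stepfun (\<lambda>\<xi> \<nu>. a)"
  using stepfun_regular[OF regular_True, of a a] by simp

lemma stepfun_map:
  assumes "stepfun g"
  shows "stepfun (\<lambda>\<xi> \<nu>. g \<xi> (\<lambda>w. h (\<nu> w)))"
proof -
  obtain A where A: "finite A" "\<And>\<xi> \<nu>. g \<xi> \<nu> \<in> A" "\<And>a. regular (\<lambda>\<xi> \<nu>. g \<xi> \<nu> = a)"
    using assms unfolding stepfun_def by blast
  show ?thesis
    unfolding stepfun_def
    by (intro exI[of _ A] conjI allI A regular_map[where h = h])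
qed

lemma wreg_stepfun:
  fixes g :: "('f, 'b, 's::{comm_semiring_0, comm_monoid_mult}) wfun"
  assumes "stepfun g"
  shows "wreg g"
proof -
  obtain A where A: "finite A" "\<And>\<xi> \<nu>. g \<xi> \<nu> \<in> A" "\<And>a. regular (\<lambda>\<xi> \<nu>. g \<xi> \<nu> = a)"
    using assms unfolding stepfun_def by blast
  have "(\<Sum>a\<in>A. a * tv (g \<xi> \<nu> = a)) = g \<xi> \<nu>" for \<xi> \<nu>
    using sum_tv[OF A(1), of "g \<xi> \<nu>" "\<lambda>a. a"] A(2)[of \<xi> \<nu>] by (simp add: mult.commute eq_commute)
  moreover have "wreg (\<lambda>\<xi> \<nu>. \<Sum>a\<in>A. a * tv (g \<xi> \<nu> = a))"
    by (intro wreg_sum wreg_scale wreg_regular A)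
  ultimately show ?thesis by simp
qed

text \<open>
  The product over all positions of a step function is obtained by guessing its value at every
  position, checking the guess, and multiplying the guessed values.
\<close>

lemma wreg_prod_stepfun:
  fixes g :: "('f, 'b \<times> bool, 's::{comm_semiring_0, comm_monoid_mult}) wfun"
  assumes "stepfun g"
  shows "wreg (\<lambda>\<xi> \<nu>. \<Prod>v\<in>pos \<xi>. g \<xi> (\<lambda>w. (\<nu> w, w = v)))"
proof -
  obtain A where A: "finite A" "\<And>\<xi> \<nu>. g \<xi> \<nu> \<in> A" "\<And>a. regular (\<lambda>\<xi> \<nu>. g \<xi> \<nu> = a)"
    using assms unfolding stepfun_def by blast
  \<comment> \<open>An annotation has the form \<open>((b, guess), mark)\<close>. At the marked
    position the guess is compared with the value of \<open>g\<close>; finiteness of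
    \<open>A\<close> makes this a finite disjunction of regular conditions.\<close>
  define ok where "ok = (\<lambda>(\<xi> :: 'f tree) (\<nu> :: nat list \<Rightarrow> ('b \<times> 's) \<times> bool).
    \<exists>a\<in>A. (\<exists>w\<in>pos \<xi>. snd (\<nu> w) \<and> snd (fst (\<nu> w)) = a) \<and> g \<xi> (\<lambda>w. (fst (fst (\<nu> w)), snd (\<nu> w))) = a)"
  have "regular (\<lambda>\<xi> \<nu>. g \<xi> (\<lambda>w. (fst (fst (\<nu> w)), snd (\<nu> w))) = a)" for a
    using regular_map[OF A(3), where h = "\<lambda>p. (fst (fst p), snd p)"] .
  then have "regular ok"
    unfolding ok_def by (intro regular_bex regular_conj A regular_ex_pos')
  then have all: "regular (\<lambda>\<xi> \<nu>. \<not> (\<exists>v\<in>pos \<xi>. \<not> ok \<xi> (\<lambda>w. (\<nu> w, w = v))))"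
    by (intro regular_not regular_ex1)
  define check where "check = (\<lambda>\<xi> \<nu>. \<not> (\<exists>v\<in>pos \<xi>. \<not> ok \<xi> (\<lambda>w. (\<nu> w, w = v))))"
  have check: "check \<xi> (\<lambda>w. (\<nu> w, \<mu> w)) \<longleftrightarrow> (\<forall>v\<in>pos \<xi>. g \<xi> (\<lambda>w. (\<nu> w, w = v)) = \<mu> v)" for \<xi> \<nu> \<mu>
    unfolding check_def ok_def using A(2) by simp metis
  have "(\<Sum>\<mu>\<in>pos \<xi> \<rightarrow>\<^sub>E A. tv (check \<xi> (\<lambda>w. (\<nu> w, \<mu> w))) * (\<Prod>v\<in>pos \<xi>. snd (\<nu> v, \<mu> v))) =
      (\<Prod>v\<in>pos \<xi>. g \<xi> (\<lambda>w. (\<nu> w, w = v)))" for \<xi> \<nu>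
  proof -
    let ?m = "restrict (\<lambda>v. g \<xi> (\<lambda>w. (\<nu> w, w = v))) (pos \<xi>)"
    have m: "?m \<in> pos \<xi> \<rightarrow>\<^sub>E A" using A(2) by simp
    \<comment> \<open>Exactly one extensional guess passes the check, so the sum reduces to one
      summand.\<close>
    have "check \<xi> (\<lambda>w. (\<nu> w, \<mu> w)) \<longleftrightarrow> \<mu> = ?m" if "\<mu> \<in> pos \<xi> \<rightarrow>\<^sub>E A" for \<mu>
      unfolding check
    proof (intro iffI ext ballI)
      fix w assume "\<forall>v\<in>pos \<xi>. g \<xi> (\<lambda>w. (\<nu> w, w = v)) = \<mu> v"
      then show "\<mu> w = ?m w" using PiE_arb[OF that, of w] by (cases "w \<in> pos \<xi>") simp_all
    qed simp
    then have "(\<Sum>\<mu>\<in>pos \<xi> \<rightarrow>\<^sub>E A. tv (check \<xi> (\<lambda>w. (\<nu> w, \<mu> w))) * (\<Prod>v\<in>pos \<xi>. snd (\<nu> v, \<mu> v))) =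
        (\<Sum>\<mu>\<in>pos \<xi> \<rightarrow>\<^sub>E A. tv (\<mu> = ?m) * (\<Prod>v\<in>pos \<xi>. snd (\<nu> v, \<mu> v)))"
      by (intro sum.cong refl) simp
    also have "\<dots> = tv (?m \<in> pos \<xi> \<rightarrow>\<^sub>E A) * (\<Prod>v\<in>pos \<xi>. snd (\<nu> v, ?m v))"
      by (rule sum_tv) (simp add: finite_PiE finite_pos A(1))
    finally show ?thesis using m by (simp cong: prod.cong)
  qed
  moreover have "wreg (\<lambda>\<xi> \<nu>. tv (check \<xi> \<nu>) * (\<Prod>v\<in>pos \<xi>. snd (\<nu> v)))"
    unfolding check_def by (rule wreg_mult[OF wreg_regular[OF all] wreg_prod_pos])
  from wreg_proj[OF this A(1)]
  have "wreg (\<lambda>\<xi> \<nu>. \<Sum>\<mu>\<in>pos \<xi> \<rightarrow>\<^sub>E A. tv (check \<xi> (\<lambda>w. (\<nu> w, \<mu> w))) * (\<Prod>v\<in>pos \<xi>. snd (\<nu> v, \<mu> v)))" .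
  ultimately show ?thesis by simp
qed

text \<open>
  An assignment annotates every position with the variables that it interprets. Since the labels
  need not come from a finite alphabet, all variables can be encoded at once.
\<close>

definition ann :: "(nat \<Rightarrow> nat list) \<Rightarrow> (nat \<Rightarrow> nat list set) \<Rightarrow> nat list \<Rightarrow> nat set \<times> nat set" where
  "ann \<rho> \<tau> w = ({x. \<rho> x = w}, {X. w \<in> \<tau> X})"

definition upd1 :: "nat \<Rightarrow> (nat set \<times> nat set) \<times> bool \<Rightarrow> nat set \<times> nat set" where
  "upd1 x p = (if snd p then insert x (fst (fst p)) else fst (fst p) - {x}, snd (fst p))"

definition upd2 :: "nat \<Rightarrow> (nat set \<times> nat set) \<times> bool \<Rightarrow> nat set \<times> nat set" where
  "upd2 X p = (fst (fst p), if snd p then insert X (snd (fst p)) else snd (fst p) - {X})"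

lemma ann_upd1: "ann (\<rho>(x := v)) \<tau> = (\<lambda>w. upd1 x (ann \<rho> \<tau> w, w = v))"
  by (auto simp: ann_def upd1_def fun_eq_iff)

lemma ann_upd2: "ann \<rho> (\<tau>(X := V)) = (\<lambda>w. upd2 X (ann \<rho> \<tau> w, w \<in> V))"
  by (auto simp: ann_def upd2_def fun_eq_iff)

lemma fst_ann: "x \<in> fst (ann \<rho> \<tau> w) \<longleftrightarrow> \<rho> x = w"
  and snd_ann: "X \<in> snd (ann \<rho> \<tau> w) \<longleftrightarrow> w \<in> \<tau> X"
  by (simp_all add: ann_def)

text \<open>All variables, free or not, must denote positions of the tree, since otherwise their
  marks would lie outside it and the atoms could not be read off the annotation.\<close>

definition represents ::
  "('f, nat set \<times> nat set, 's) wfun \<Rightarrow> ('f, 's::{comm_semiring_0, comm_monoid_mult}, nat) mso \<Rightarrow> bool" where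
  "represents g \<phi> \<longleftrightarrow> (\<forall>\<xi> \<rho> \<tau>. (\<forall>x. \<rho> x \<in> pos \<xi>) \<longrightarrow> sem \<phi> \<xi> \<rho> \<tau> = g \<xi> (ann \<rho> \<tau>))"

lemma representsD: "represents g \<phi> \<Longrightarrow> (\<And>x. \<rho> x \<in> pos \<xi>) \<Longrightarrow> sem \<phi> \<xi> \<rho> \<tau> = g \<xi> (ann \<rho> \<tau>)"
  unfolding represents_def by blast

lemma representsI:
  "(\<And>\<xi> \<rho> \<tau>. (\<And>x. \<rho> x \<in> pos \<xi>) \<Longrightarrow> sem \<phi> \<xi> \<rho> \<tau> = g \<xi> (ann \<rho> \<tau>)) \<Longrightarrow> represents g \<phi>"
  unfolding represents_def by blast

lemma represents_Ex1:
  "represents g \<phi> \<Longrightarrow>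
    represents (\<lambda>\<xi> \<nu>. \<Sum>v\<in>pos \<xi>. g \<xi> (\<lambda>w. upd1 x (\<nu> w, w = v))) (Ex1 x \<phi>)"
  by (rule representsI) (simp add: representsD flip: ann_upd1)

lemma represents_All1:
  "represents g \<phi> \<Longrightarrow>
    represents (\<lambda>\<xi> \<nu>. \<Prod>v\<in>pos \<xi>. g \<xi> (\<lambda>w. upd1 x (\<nu> w, w = v))) (All1 x \<phi>)"
  by (rule representsI) (simp add: representsD flip: ann_upd1)

lemma represents_Ex2:
  "represents g \<phi> \<Longrightarrow>
    represents (\<lambda>\<xi> \<nu>. \<Sum>V\<in>Pow (pos \<xi>). g \<xi> (\<lambda>w. upd2 X (\<nu> w, w \<in> V))) (Ex2 X \<phi>)"
  by (rule representsI) (simp add: representsD flip: ann_upd2)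

lemma represents_All2:
  "represents g \<phi> \<Longrightarrow>
    represents (\<lambda>\<xi> \<nu>. \<Prod>V\<in>Pow (pos \<xi>). g \<xi> (\<lambda>w. upd2 X (\<nu> w, w \<in> V))) (All2 X \<phi>)"
  by (rule representsI) (simp add: representsD flip: ann_upd2)

lemma regular_all1:
  "regular P \<Longrightarrow> regular (\<lambda>\<xi> \<nu>. \<forall>v\<in>pos \<xi>. P \<xi> (\<lambda>w. (\<nu> w, w = v)))"
  using regular_not[OF regular_ex1[OF regular_not[of P]]] by simp

lemma regular_all2:
  assumes "regular P"
  shows "regular (\<lambda>\<xi> \<nu>. \<forall>V\<in>Pow (pos \<xi>). P \<xi> (\<lambda>w. (\<nu> w, w \<in> V)))"
proof -
  have "(\<forall>\<mu>. P \<xi> (\<lambda>w. (\<nu> w, \<mu> w))) \<longleftrightarrow> (\<forall>V\<in>Pow (pos \<xi>). P \<xi> (\<lambda>w. (\<nu> w, w \<in> V)))" for \<xi> \<nu>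
  proof (intro iffI ballI allI)
    fix \<mu> assume *: "\<forall>V\<in>Pow (pos \<xi>). P \<xi> (\<lambda>w. (\<nu> w, w \<in> V))"
    have "P \<xi> (\<lambda>w. (\<nu> w, w \<in> {w\<in>pos \<xi>. \<mu> w}))" by (rule bspec[OF *]) auto
    also have "P \<xi> (\<lambda>w. (\<nu> w, w \<in> {w\<in>pos \<xi>. \<mu> w})) = P \<xi> (\<lambda>w. (\<nu> w, \<mu> w))"
      by (rule regular_local[OF assms]) simp
    finally show "P \<xi> (\<lambda>w. (\<nu> w, \<mu> w))" .
  next
    fix V assume "\<forall>\<mu>. P \<xi> (\<lambda>w. (\<nu> w, \<mu> w))"
    then show "P \<xi> (\<lambda>w. (\<nu> w, w \<in> V))" by (rule spec)
  qed
  then show ?thesis using regular_not[OF regular_proj[OF regular_not[OF assms]]] by simp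
qed

text \<open>The classical translation of formulas into tree automata. An atom becomes the statement
  that some position carries the required marks, which is equivalent as each first-order variable
  marks exactly one position of the tree.\<close>

lemma BMSO_regular:
  fixes \<phi> :: "('f::finite, 's::{comm_semiring_0, comm_monoid_mult}, nat) mso"
  assumes "\<phi> \<in> BMSO rk"
  shows "\<exists>P. regular P \<and> represents (\<lambda>\<xi> \<nu>. tv (P \<xi> \<nu>)) \<phi>"
  using assms
proof induction
  case 1
  show ?case
    by (rule exI[of _ "\<lambda>_ _. False"]) (use regular_not[OF regular_True] in \<open>simp add: represents_def\<close>)
next
  case 2
  show ?case
    by (rule exI[of _ "\<lambda>_ _. True"]) (simp add: regular_True represents_def)
next
  case (3 f x)
  show ?case
    by (intro exI[of _ "\<lambda>\<xi> \<nu>. \<exists>w\<in>pos \<xi>. x \<in> fst (\<nu> w) \<and> label_at \<xi> w = f"] conjI representsI)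
      (use regular_ex_pos[of "\<lambda>l p. x \<in> fst p \<and> l = f"] in \<open>auto simp: fst_ann\<close>)
next
  case (4 i x y)
  then have i: "i = Suc (i - 1)" by simp
  show ?case
  proof (intro exI[of _ "\<lambda>\<xi> \<nu>. \<exists>w\<in>pos \<xi>. x \<in> fst (\<nu> w) \<and> w @ [i] \<in> pos \<xi> \<and> y \<in> fst (\<nu> (w @ [i]))"] conjI representsI)
    show "regular (\<lambda>\<xi> (\<nu> :: nat list \<Rightarrow> nat set \<times> nat set).
        \<exists>w\<in>pos \<xi>. x \<in> fst (\<nu> w) \<and> w @ [i] \<in> pos \<xi> \<and> y \<in> fst (\<nu> (w @ [i])))"
      using regular_edge[of "\<lambda>p. x \<in> fst p" "i - 1" "\<lambda>p. y \<in> fst p"] i by simp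
  next
    fix \<xi> :: "'f tree" and \<rho> :: "nat \<Rightarrow> nat list" and \<tau> assume \<rho>: "\<And>x. \<rho> x \<in> pos \<xi>"
    show "(sem (Edge i x y) \<xi> \<rho> \<tau> :: 's) = tv (\<exists>w\<in>pos \<xi>. x \<in> fst (ann \<rho> \<tau> w) \<and> w @ [i] \<in> pos \<xi> \<and> y \<in> fst (ann \<rho> \<tau> (w @ [i])))"
      using \<rho>[of x] \<rho>[of y] by (auto simp: fst_ann)
  qed
next
  case (5 x y)
  show ?case
  proof (intro exI[of _ "\<lambda>\<xi> \<nu>. \<exists>w\<in>pos \<xi>. \<exists>w'\<in>pos \<xi>. x \<in> fst (\<nu> w) \<and> y \<in> fst (\<nu> w') \<and> prefix w w'"] conjI representsI)
    show "regular (\<lambda>\<xi> (\<nu> :: nat list \<Rightarrow> nat set \<times> nat set).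
        \<exists>w\<in>pos \<xi>. \<exists>w'\<in>pos \<xi>. x \<in> fst (\<nu> w) \<and> y \<in> fst (\<nu> w') \<and> prefix w w')"
      using regular_le[of "\<lambda>p. x \<in> fst p" "\<lambda>p. y \<in> fst p"] .
  next
    fix \<xi> :: "'f tree" and \<rho> :: "nat \<Rightarrow> nat list" and \<tau> assume \<rho>: "\<And>x. \<rho> x \<in> pos \<xi>"
    show "(sem (Le x y) \<xi> \<rho> \<tau> :: 's) = tv (\<exists>w\<in>pos \<xi>. \<exists>w'\<in>pos \<xi>. x \<in> fst (ann \<rho> \<tau> w) \<and> y \<in> fst (ann \<rho> \<tau> w') \<and> prefix w w')"
      using \<rho>[of x] \<rho>[of y] by (auto simp: fst_ann)
  qed
next
  case (6 x X)
  show ?case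
    by (intro exI[of _ "\<lambda>\<xi> \<nu>. \<exists>w\<in>pos \<xi>. x \<in> fst (\<nu> w) \<and> X \<in> snd (\<nu> w)"] conjI representsI)
      (use regular_ex_pos'[of "\<lambda>p. x \<in> fst p \<and> X \<in> snd p"] in \<open>auto simp: fst_ann snd_ann\<close>)
next
  case (7 \<phi>)
  then obtain P where P: "regular P" "represents (\<lambda>\<xi> \<nu>. tv (P \<xi> \<nu>)) \<phi>" by blast
  show ?case
    by (intro exI[of _ "\<lambda>\<xi> \<nu>. \<not> P \<xi> \<nu>"] conjI regular_not P representsI sem_Neg representsD[OF P(2)])
next
  case (8 \<phi> \<psi>)
  then obtain P Q where P: "regular P" "represents (\<lambda>\<xi> \<nu>. tv (P \<xi> \<nu>)) \<phi>"
    and Q: "regular Q" "represents (\<lambda>\<xi> \<nu>. tv (Q \<xi> \<nu>)) \<psi>" by blast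
  show ?case
    by (intro exI[of _ "\<lambda>\<xi> \<nu>. P \<xi> \<nu> \<and> Q \<xi> \<nu>"] conjI regular_conj P Q representsI)
      (simp add: representsD[OF P(2)] representsD[OF Q(2)])
next
  case (9 \<phi> x)
  then obtain P where P: "regular P" "represents (\<lambda>\<xi> \<nu>. tv (P \<xi> \<nu>)) \<phi>" by blast
  let ?P = "\<lambda>\<xi> \<nu>. \<forall>v\<in>pos \<xi>. P \<xi> (\<lambda>w. upd1 x (\<nu> w, w = v))"
  have "regular ?P" using regular_all1[OF regular_map[OF P(1), where h = "upd1 x"]] .
  moreover have "represents (\<lambda>\<xi> \<nu>. tv (?P \<xi> \<nu>)) (All1 x \<phi>)"
    using represents_All1[OF P(2), of x] by (simp add: prod_tv finite_pos)
  ultimately show ?case by blast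
next
  case (10 \<phi> X)
  then obtain P where P: "regular P" "represents (\<lambda>\<xi> \<nu>. tv (P \<xi> \<nu>)) \<phi>" by blast
  let ?P = "\<lambda>\<xi> \<nu>. \<forall>V\<in>Pow (pos \<xi>). P \<xi> (\<lambda>w. upd2 X (\<nu> w, w \<in> V))"
  have "regular ?P" using regular_all2[OF regular_map[OF P(1), where h = "upd2 X"]] .
  moreover have "represents (\<lambda>\<xi> \<nu>. tv (?P \<xi> \<nu>)) (All2 X \<phi>)"
    using represents_All2[OF P(2), of X] by (simp add: prod_tv finite_pos)
  ultimately show ?case by blast
qed

lemma step_BMSO_stepfun:
  fixes \<phi> :: "('f::finite, 's::{comm_semiring_0, comm_monoid_mult}, nat) mso"
  assumes "\<phi> \<in> step (BMSO rk)"
  shows "\<exists>g. stepfun g \<and> represents g \<phi>"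
  using assms
proof induction
  case (1 a)
  show ?case by (intro exI[of _ "\<lambda>_ _. a"] conjI stepfun_const representsI) simp
next
  case (2 \<alpha>)
  then obtain P where "regular P" "represents (\<lambda>\<xi> \<nu>. tv (P \<xi> \<nu>)) \<alpha>" using BMSO_regular by blast
  then show ?case by (intro exI[of _ "\<lambda>\<xi> \<nu>. tv (P \<xi> \<nu>)"] conjI stepfun_regular)
next
  case (3 \<phi>)
  then obtain g where g: "stepfun g" "represents g \<phi>" by blast
  have "represents (\<lambda>\<xi> \<nu>. tv (g \<xi> \<nu> = 0)) (Neg \<phi>)"
    by (rule representsI) (simp add: representsD[OF g(2)])
  then show ?case using stepfun_combine[OF g(1,1), of "\<lambda>a _. tv (a = 0)"] by blast
next
  case (4 \<phi> \<psi>)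
  then obtain g h where g: "stepfun g" "represents g \<phi>" and h: "stepfun h" "represents h \<psi>" by blast
  have "represents (\<lambda>\<xi> \<nu>. g \<xi> \<nu> + h \<xi> \<nu>) (Or \<phi> \<psi>)"
    by (rule representsI) (simp add: representsD[OF g(2)] representsD[OF h(2)])
  then show ?case using stepfun_combine[OF g(1) h(1), of "(+)"] by blast
next
  case (5 \<phi> \<psi>)
  then obtain g h where g: "stepfun g" "represents g \<phi>" and h: "stepfun h" "represents h \<psi>" by blast
  have "represents (\<lambda>\<xi> \<nu>. g \<xi> \<nu> * h \<xi> \<nu>) (And \<phi> \<psi>)"
    by (rule representsI) (simp add: representsD[OF g(2)] representsD[OF h(2)])
  then show ?case using stepfun_combine[OF g(1) h(1), of "(*)"] by blast
qed

lemma BMSO_wreg: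
  fixes \<phi> :: "('f::finite, 's::{comm_semiring_0, comm_monoid_mult}, nat) mso"
  assumes "\<phi> \<in> BMSO rk"
  shows "\<exists>g. wreg g \<and> represents g \<phi>"
proof -
  obtain P where "regular P" "represents (\<lambda>\<xi> \<nu>. tv (P \<xi> \<nu>)) \<phi>" using BMSO_regular[OF assms] by blast
  then show ?thesis by (intro exI[of _ "\<lambda>\<xi> \<nu>. tv (P \<xi> \<nu>)"] conjI wreg_regular)
qed

text \<open>Here the restrictions on universal quantifiers enter: products over all positions are
  available for step functions, and products over all sets for formulas with values 0 and 1.\<close>

lemma RMSO_wreg:
  fixes \<phi> :: "('f::finite, 's::{comm_semiring_0, comm_monoid_mult}, nat) mso"
  assumes "\<phi> \<in> RMSO rk"
  shows "\<exists>g. wreg g \<and> represents g \<phi>"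
  using assms
proof induction
  case (1 a)
  show ?case by (intro exI[of _ "\<lambda>_ _. a"] conjI wreg_const representsI) simp
next
  case (2 f x)
  show ?case by (rule BMSO_wreg) (rule BMSO.intros)
next
  case (3 i x y)
  then show ?case by (intro BMSO_wreg[of _ rk] BMSO.intros)
next
  case (4 x y)
  show ?case by (rule BMSO_wreg) (rule BMSO.intros)
next
  case (5 x X)
  show ?case by (rule BMSO_wreg) (rule BMSO.intros)
next
  case (6 \<psi>)
  then show ?case using step_BMSO_stepfun[OF step.intros(3)] wreg_stepfun by blast
next
  case (7 \<phi> \<psi>)
  then obtain g h where g: "wreg g" "represents g \<phi>" and h: "wreg h" "represents h \<psi>" by blast
  have "represents (\<lambda>\<xi> \<nu>. g \<xi> \<nu> + h \<xi> \<nu>) (Or \<phi> \<psi>)"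
    by (rule representsI) (simp add: representsD[OF g(2)] representsD[OF h(2)])
  then show ?case using wreg_add[OF g(1) h(1)] by blast
next
  case (8 \<phi> \<psi>)
  then obtain g h where g: "wreg g" "represents g \<phi>" and h: "wreg h" "represents h \<psi>" by blast
  have "represents (\<lambda>\<xi> \<nu>. g \<xi> \<nu> * h \<xi> \<nu>) (And \<phi> \<psi>)"
    by (rule representsI) (simp add: representsD[OF g(2)] representsD[OF h(2)])
  then show ?case using wreg_mult[OF g(1) h(1)] by blast
next
  case (9 \<phi> x)
  then obtain g where g: "wreg g" "represents g \<phi>" by blast
  show ?case
    using wreg_ex1[OF wreg_map[OF g(1), where h = "upd1 x"]] represents_Ex1[OF g(2), of x] by blast
next
  case (10 \<psi> x)
  then obtain g where g: "stepfun g" "represents g \<psi>" using step_BMSO_stepfun by blast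
  show ?case
    using wreg_prod_stepfun[OF stepfun_map[OF g(1), where h = "upd1 x"]] represents_All1[OF g(2), of x] by blast
next
  case (11 \<phi> X)
  then obtain g where g: "wreg g" "represents g \<phi>" by blast
  show ?case
    using wreg_ex2[OF wreg_map[OF g(1), where h = "upd2 X"]] represents_Ex2[OF g(2), of X] by blast
next
  case (12 \<chi> X)
  then show ?case by (intro BMSO_wreg[of _ rk] BMSO.intros)
qed

lemma tuples_image: "tuples (e ` G) k = map e ` tuples G k"
proof -
  have "{xs \<in> lists (e ` G). length xs = k} = map e ` {xs \<in> lists G. length xs = k}"
    unfolding lists_image by auto
  then show ?thesis by (simp add: tuples_def in_lists_conv_set subset_eq conj_commute)
qed

text \<open>Under a constant annotation every child sees what the root sees. So the members of the
  closed family are the states, numbered by \<open>e\<close>, and the expansion coefficients are the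
  transition weights.\<close>

lemma wreg_recognizable:
  fixes g :: "('f, 'b, 's::{comm_semiring_0, comm_monoid_mult}) wfun"
  assumes "wreg g"
  shows "recognizable rk (\<lambda>\<xi>. g \<xi> (\<lambda>_. b))"
proof -
  obtain G where G: "closed_family G" "finite G" "g \<in> G"
    "\<And>g f k b. g \<in> G \<Longrightarrow> spanned G k b (\<lambda>ts. g (Node f ts))"
    using assms unfolding wreg_def closed_family_def by blast
  \<comment> \<open>One choice for all triples \<open>p\<close> of a state, a symbol and a
    rank.\<close>
  have "\<forall>p. \<exists>c. fst p \<in> G \<longrightarrow> (\<forall>ts \<nu>. length ts = snd (snd p) \<longrightarrow> \<nu> [] = b \<longrightarrow>
      (fst p) (Node (fst (snd p)) ts) \<nu> = (\<Sum>gs\<in>tuples G (snd (snd p)). c gs * mono_of gs ts \<nu>))"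
    using G(4) unfolding spanned_def by blast
  from choice[OF this] obtain c0 where c0: "\<And>p ts \<nu>. fst p \<in> G \<Longrightarrow> length ts = snd (snd p) \<Longrightarrow> \<nu> [] = b \<Longrightarrow>
      (fst p) (Node (fst (snd p)) ts) \<nu> = (\<Sum>gs\<in>tuples G (snd (snd p)). c0 p gs * mono_of gs ts \<nu>)"
    by blast
  define c where "c g f gs = c0 (g, f, length gs) gs" for g f gs
  have c: "g (Node f ts) (\<lambda>_. b) = (\<Sum>gs\<in>tuples G (length ts). c g f gs * (\<Prod>i<length ts. (gs ! i) (ts ! i) (\<lambda>_. b)))"
    if "g \<in> G" for g f ts
    using c0[of "(g, f, length ts)" ts "\<lambda>_. b"] that
    by (auto simp: c_def mono_of_def down_def tuples_def intro!: sum.cong)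
  obtain e :: "('f, 'b, 's) wfun \<Rightarrow> nat" where e: "inj_on e G"
    using finite_imp_inj_to_nat_seg[OF G(2)] by blast
  define d where "d = the_inv_into G e"
  have de: "d (e g) = g" if "g \<in> G" for g
    unfolding d_def by (rule the_inv_into_f_f[OF e that])
  define A :: "(nat, 'f, 's) wta" where
    "A = \<lparr>states = e ` G, trans = (\<lambda>qs f q. c (d q) f (map d qs)), final = {e g}\<rparr>"
  have A: "is_wta A" using G(2,3) by (auto simp: is_wta_def A_def)
  have "run_weight A \<xi> (e g) = g \<xi> (\<lambda>_. b)" if "g \<in> G" for g \<xi>
    using that
  proof (induction \<xi> arbitrary: g)
    case (Node f ts)
    let ?k = "length ts"
    have "run_weight A (Node f ts) (e g) = (\<Sum>qs\<in>tuples (e ` G) ?k.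
        c g f (map d qs) * (\<Prod>i<?k. run_weight A (ts ! i) (qs ! i)))"
      using Node.prems by (simp add: A_def tuples_def de)
    also have "\<dots> = (\<Sum>gs\<in>tuples G ?k. c g f gs * (\<Prod>i<?k. (gs ! i) (ts ! i) (\<lambda>_. b)))"
    proof (rule sum.reindex_bij_witness[where i = "map e" and j = "map d"])
      fix qs assume qs: "qs \<in> tuples (e ` G) ?k"
      then obtain gs where gs: "qs = map e gs" "gs \<in> tuples G ?k"
        unfolding tuples_image by blast
      have dq: "map d qs = gs"
        using gs(2) by (auto simp: gs(1) tuples_def de intro!: map_idI)
      then show "map e (map d qs) = qs" "map d qs \<in> tuples G ?k" using gs by simp_all
      have "(gs ! i) (ts ! i) (\<lambda>_. b) = run_weight A (ts ! i) (qs ! i)" if "i < ?k" for i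
        using Node.IH[of "ts ! i" "gs ! i"] tuples_nth[OF gs(2) that] that gs by (simp add: tuples_def)
      then show "c g f (map d qs) * (\<Prod>i<?k. (map d qs ! i) (ts ! i) (\<lambda>_. b)) =
          c g f (map d qs) * (\<Prod>i<?k. run_weight A (ts ! i) (qs ! i))"
        unfolding dq by simp
    next
      fix gs assume gs: "gs \<in> tuples G ?k"
      then show "map d (map e gs) = gs" by (auto simp: tuples_def de intro!: map_idI)
      show "map e gs \<in> tuples (e ` G) ?k" using gs by (rule tuples_map)
    qed
    also have "\<dots> = g (Node f ts) (\<lambda>_. b)" using c[OF Node.prems] by simp
    finally show ?case .
  qed
  then have "wta_language A \<xi> = g \<xi> (\<lambda>_. b)" for \<xi>
    using G(3) by (simp add: wta_language_def A_def)
  then show ?thesis unfolding recognizable_def using A by metis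
qed

lemma recognizable_cong:
  "recognizable rk r \<Longrightarrow> (\<And>\<xi>. \<xi> \<in> trees rk \<Longrightarrow> r' \<xi> = r \<xi>) \<Longrightarrow> recognizable rk r'"
  unfolding recognizable_def by simp

theorem RMSO_recognizable:
  fixes r :: "'f::finite tree \<Rightarrow> 's::{comm_semiring_0, comm_monoid_mult}"
  assumes "definable rk (RMSO rk) r"
  shows "recognizable rk r"
proof -
  obtain \<phi> where \<phi>: "\<phi> \<in> RMSO rk" "\<And>\<xi>. \<xi> \<in> trees rk \<Longrightarrow> r \<xi> = sem \<phi> \<xi> (\<lambda>_. []) (\<lambda>_. {})"
    using assms unfolding definable_def by blast
  obtain g where g: "wreg g" "represents g \<phi>" using RMSO_wreg[OF \<phi>(1)] by blast
  \<comment> \<open>The dummy assignment puts every first-order variable at the root, so the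
    annotation is constant except there; \<open>wreg_root\<close> removes this exception.\<close>
  have "recognizable rk (\<lambda>\<xi>. g \<xi> ((\<lambda>_. ({}, {}))([] := (UNIV, {}))))"
    by (rule wreg_recognizable[OF wreg_root[OF g(1)]])
  moreover have "(\<lambda>_. ({}, {}))([] := (UNIV, {})) = ann (\<lambda>_. []) (\<lambda>_. {})"
    by (auto simp: ann_def fun_eq_iff)
  ultimately have "recognizable rk (\<lambda>\<xi>. g \<xi> (ann (\<lambda>_. []) (\<lambda>_. {})))" by simp
  then show ?thesis
    by (rule recognizable_cong) (simp add: \<phi>(2) representsD[OF g(2)] Nil_in_pos)
qed

section \<open>The fixpoint equation of branching transitive closures\<close>

lemma tuples_0 [simp]: "tuples A 0 = {[]}"
  by (auto simp: tuples_def)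

lemma sum_tuples_Suc:
  "(\<Sum>xs\<in>tuples A (Suc k). F xs) = (\<Sum>x\<in>A. \<Sum>xs\<in>tuples A k. F (x # xs))"
proof -
  have "(\<Sum>xs\<in>tuples A (Suc k). F xs) = (\<Sum>(x, xs)\<in>A \<times> tuples A k. F (x # xs))"
    by (rule sum.reindex_bij_witness[where j = "\<lambda>xs. (hd xs, tl xs)" and i = "\<lambda>(x, xs). x # xs"])
      (auto simp: tuples_def length_Suc_conv)
  then show ?thesis by (simp add: sum.cartesian_product)
qed

lemma prod_sum_distrib_tuples:
  fixes F :: "nat \<Rightarrow> 'x \<Rightarrow> 's::{comm_semiring_0, comm_monoid_mult}"
  shows "(\<Prod>i<k. \<Sum>x\<in>A. F i x) = (\<Sum>xs\<in>tuples A k. \<Prod>i<k. F i (xs ! i))"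
proof (induction k arbitrary: F)
  case (Suc k)
  show ?case
    by (simp add: prod.lessThan_Suc_shift sum_tuples_Suc Suc sum_product del: prod.lessThan_Suc)
qed simp

lemma prod_eq_0:
  fixes F :: "'i \<Rightarrow> 's::{comm_semiring_0, comm_monoid_mult}"
  assumes "finite I" "i \<in> I" "F i = 0"
  shows "(\<Prod>i\<in>I. F i) = 0"
  using assms by (simp add: prod.remove)

text \<open>By injectivity, updating a renamed variable changes only the corresponding original one,
  so renaming passes through quantifiers.\<close>

lemma sem_map_mso:
  assumes "inj h"
  shows "sem (map_mso id id h \<phi>) \<xi> \<rho> \<tau> = sem \<phi> \<xi> (\<rho> \<circ> h) \<tau>"
proof -
  have "\<rho>(h x := v) \<circ> h = (\<rho> \<circ> h)(x := v)" for \<rho> x and v :: "nat list"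
    by (auto simp: fun_eq_iff inj_eq[OF assms])
  then show ?thesis by (induction \<phi> arbitrary: \<rho> \<tau>) simp_all
qed

lemma sem_cong_free:
  assumes "\<And>x. x \<in> free1 \<phi> \<Longrightarrow> \<rho> x = \<rho>' x" "\<And>X. X \<in> free2 \<phi> \<Longrightarrow> \<tau> X = \<tau>' X"
  shows "sem \<phi> \<xi> \<rho> \<tau> = sem \<phi> \<xi> \<rho>' \<tau>'"
  using assms
proof (induction \<phi> arbitrary: \<rho> \<tau> \<rho>' \<tau>')
  case (Neg \<phi>)
  have "sem \<phi> \<xi> \<rho> \<tau> = sem \<phi> \<xi> \<rho>' \<tau>'" using Neg.prems by (intro Neg.IH) auto
  then show ?case by simp
next
  case (Or \<phi> \<psi>)
  have "sem \<phi> \<xi> \<rho> \<tau> = sem \<phi> \<xi> \<rho>' \<tau>'" using Or.prems by (intro Or.IH) auto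
  moreover have "sem \<psi> \<xi> \<rho> \<tau> = sem \<psi> \<xi> \<rho>' \<tau>'" using Or.prems by (intro Or.IH) auto
  ultimately show ?case by simp
next
  case (And \<phi> \<psi>)
  have "sem \<phi> \<xi> \<rho> \<tau> = sem \<phi> \<xi> \<rho>' \<tau>'" using And.prems by (intro And.IH) auto
  moreover have "sem \<psi> \<xi> \<rho> \<tau> = sem \<psi> \<xi> \<rho>' \<tau>'" using And.prems by (intro And.IH) auto
  ultimately show ?case by simp
next
  case (Ex1 x \<phi>)
  show ?case unfolding sem.simps
    by (rule sum.cong[OF refl], rule Ex1.IH) (use Ex1.prems in auto)
next
  case (All1 x \<phi>)
  show ?case unfolding sem.simps
    by (rule prod.cong[OF refl], rule All1.IH) (use All1.prems in auto)
next
  case (Ex2 x \<phi>)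
  show ?case unfolding sem.simps
    by (rule sum.cong[OF refl], rule Ex2.IH) (use Ex2.prems in auto)
next
  case (All2 x \<phi>)
  show ?case unfolding sem.simps
    by (rule prod.cong[OF refl], rule All2.IH) (use All2.prems in auto)
qed auto

lemma inj_subst_var:
  assumes "0 \<notin> set w"
  shows "inj (subst_var k w)"
proof (rule injI)
  fix i j assume eq: "subst_var k w i = subst_var k w j"
  have "w \<noteq> [0, i]" "w @ [j] \<noteq> [0, i]" for i j using assms by (auto simp: append_eq_Cons_conv)
  then show "i = j" using eq by (auto simp: subst_var_def split: if_splits dest: sym)
qed

fun upds :: "('v \<Rightarrow> 'a) \<Rightarrow> 'v list \<Rightarrow> 'a list \<Rightarrow> 'v \<Rightarrow> 'a" where
  "upds \<rho> (x # xs) (v # vs) = upds (\<rho>(x := v)) xs vs"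
| "upds \<rho> _ _ = \<rho>"

lemma sem_Ex1s:
  "sem (foldr Ex1 xs \<phi>) \<xi> \<rho> \<tau> = (\<Sum>vs\<in>tuples (pos \<xi>) (length xs). sem \<phi> \<xi> (upds \<rho> xs vs) \<tau>)"
  by (induction xs arbitrary: \<rho>) (simp_all add: sum_tuples_Suc)

lemma upds_notin: "y \<notin> set xs \<Longrightarrow> upds \<rho> xs vs y = \<rho> y"
  by (induction \<rho> xs vs rule: upds.induct) auto

lemma upds_nth:
  "distinct xs \<Longrightarrow> length xs = length vs \<Longrightarrow> i < length xs \<Longrightarrow> upds \<rho> xs vs (xs ! i) = vs ! i"
proof (induction \<rho> xs vs arbitrary: i rule: upds.induct)
  case (1 \<rho> x xs v vs)
  show ?case
  proof (cases i)
    case 0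
    with 1 show ?thesis by (simp add: upds_notin)
  next
    case (Suc j)
    with 1 show ?thesis by (simp del: fun_upd_apply)
  qed
qed auto

lemma sem_Disj: "sem (Disj \<phi>s) \<xi> \<rho> \<tau> = (\<Sum>\<phi>\<leftarrow>\<phi>s. sem \<phi> \<xi> \<rho> \<tau>)"
  by (induction \<phi>s) (simp_all add: Disj_def)

lemma sem_Disj_map:
  "distinct xs \<Longrightarrow> sem (Disj (map F xs)) \<xi> \<rho> \<tau> = (\<Sum>x\<in>set xs. sem (F x) \<xi> \<rho> \<tau>)"
  by (simp add: sem_Disj sum_list_distinct_conv_sum_set o_def)

lemma sem_Conj_prod_list: "sem (Conj \<phi>s) \<xi> \<rho> \<tau> = prod_list (map (\<lambda>\<phi>. sem \<phi> \<xi> \<rho> \<tau>) \<phi>s)"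
  by (induction \<phi>s) (simp_all add: Conj_def)

lemma sem_Conj_upt:
  "sem (Conj (map F [1..<Suc k])) \<xi> \<rho> \<tau> = (\<Prod>i<k. sem (F (Suc i)) \<xi> \<rho> \<tau>)"
proof -
  have "sem (Conj (map F [1..<Suc k])) \<xi> \<rho> \<tau> = (\<Prod>i\<in>set [1..<Suc k]. sem (F i) \<xi> \<rho> \<tau>)"
    by (simp add: sem_Conj_prod_list prod.distinct_set_conv_list o_def del: upt_Suc set_upt)
  also have "\<dots> = (\<Prod>i<k. sem (F (Suc i)) \<xi> \<rho> \<tau>)"
    by (simp only: set_upt One_nat_def prod.atLeast_Suc_lessThan_Suc_shift lessThan_atLeast0 o_def)
  finally show ?thesis .
qed

text \<open>The semantics of \<open>BTC\<close>, with the values of the family as a parameter \<open>F\<close>.\<close>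

function btc :: "nat \<Rightarrow> nat list set \<Rightarrow> (nat list \<Rightarrow> nat list list \<Rightarrow> 's::{comm_semiring_0, comm_monoid_mult}) \<Rightarrow>
    nat \<Rightarrow> nat list \<Rightarrow> 's" where
  "btc m P F 0 v = 0"
| "btc m P F (Suc 0) v = F v []"
| "btc m P F (Suc (Suc l)) v = (\<Sum>k\<in>{1..<Suc m}. \<Sum>vs\<in>tuples P k. F v vs *
    (\<Sum>ls\<in>set (compositions k (Suc l)). \<Prod>i\<in>{..<k}. btc m P F (ls ! i) (vs ! i)))"
  by pat_completeness auto
termination
proof (relation "measure (\<lambda>(m, P, F, l, v). l)", simp, goal_cases)
  case (1 m P F l v k vs ls i)
  then have "ls ! i \<in> set ls" "sum_list ls = Suc l"
    by (auto simp: set_compositions)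
  with member_le_sum_list[of "ls ! i" ls] show ?case by simp
qed

text \<open>The induction is for all \<open>w\<close> and \<open>\<rho>\<close>: the recursive calls
  start at the variables \<open>w @ [i]\<close> that have just been quantified, and the value
  depends on the assignment only through the current variable.\<close>

lemma sem_BTC:
  fixes \<Phi> :: "nat \<Rightarrow> ('f, 's::{comm_semiring_0, comm_monoid_mult}, nat) mso"
  assumes "is_family L m \<Phi>" "0 \<notin> set w"
  shows "sem (BTC m \<Phi> l w) \<xi> \<rho> (\<lambda>_. {}) =
    btc m (pos \<xi>) (\<lambda>v vs. sem (\<Phi> (length vs)) \<xi> (assign v vs) (\<lambda>_. {})) l (\<rho> w)"
  using assms(2)
proof (induction l arbitrary: w \<rho> rule: less_induct)
  case (less l)
  let ?F = "\<lambda>v vs. sem (\<Phi> (length vs)) \<xi> (assign v vs) (\<lambda>_. {})"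
  have sub: "sem (subst k w (\<Phi> k)) \<xi> \<rho> (\<lambda>_. {}) = ?F (\<rho> w) vs"
    if "k \<le> m" "length vs = k" and eq: "\<And>i. i < k \<Longrightarrow> \<rho> (w @ [Suc i]) = vs ! i" for k \<rho> vs
  proof -
    have "sem (subst k w (\<Phi> k)) \<xi> \<rho> (\<lambda>_. {}) = sem (\<Phi> k) \<xi> (\<rho> \<circ> subst_var k w) (\<lambda>_. {})"
      unfolding subst_def by (rule sem_map_mso[OF inj_subst_var[OF less.prems]])
    also have "\<dots> = sem (\<Phi> k) \<xi> (assign (\<rho> w) vs) (\<lambda>_. {})"
    proof (rule sem_cong_free)
      fix j assume "j \<in> free1 (\<Phi> k)"
      then have "j \<le> k" using assms(1) \<open>k \<le> m\<close> unfolding is_family_def by fastforce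
      then show "(\<rho> \<circ> subst_var k w) j = assign (\<rho> w) vs j"
        using eq[of "j - 1"] \<open>length vs = k\<close> by (cases j) (auto simp: subst_var_def assign_def)
    qed simp
    finally show ?thesis using \<open>length vs = k\<close> by simp
  qed
  consider "l = 0" | "l = Suc 0" | l' where "l = Suc (Suc l')" by (metis not0_implies_Suc)
  then show ?case
  proof cases
    case 2
    then show ?thesis using sub[of 0 "[]" \<rho>] by simp
  next
    case 3
    have inner: "sem (foldr Ex1 (map (\<lambda>i. w @ [i]) [1..<Suc k])
        (And (subst k w (\<Phi> k))
          (Disj (map (\<lambda>ls. Conj (map (\<lambda>i. BTC m \<Phi> (ls ! (i - 1)) (w @ [i])) [1..<Suc k]))
            (compositions k (Suc l')))))) \<xi> \<rho> (\<lambda>_. {}) =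
      (\<Sum>vs\<in>tuples (pos \<xi>) k. ?F (\<rho> w) vs *
        (\<Sum>ls\<in>set (compositions k (Suc l')). \<Prod>i\<in>{..<k}. btc m (pos \<xi>) ?F (ls ! i) (vs ! i)))"
      if k: "k \<in> {1..<Suc m}" for k
    proof -
      let ?xs = "map (\<lambda>i. w @ [i]) [1..<Suc k]"
      have xs: "length ?xs = k" "distinct ?xs" "w \<notin> set ?xs"
        by (auto simp: distinct_map inj_on_def simp del: upt_Suc)
      show ?thesis
        unfolding sem_Ex1s xs(1)
      proof (rule sum.cong[OF refl])
        fix vs assume "vs \<in> tuples (pos \<xi>) k"
        then have vs: "length vs = k" by (simp add: tuples_def)
        define \<rho>' where "\<rho>' = upds \<rho> ?xs vs"
        have \<rho>': "\<rho>' (w @ [Suc i]) = vs ! i" if "i < k" for i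
          using upds_nth[of ?xs vs i \<rho>] xs vs that by (simp add: \<rho>'_def del: upt_Suc)
        have w: "\<rho>' w = \<rho> w" unfolding \<rho>'_def by (rule upds_notin[OF xs(3)])
        have "sem (subst k w (\<Phi> k)) \<xi> \<rho>' (\<lambda>_. {}) = ?F (\<rho> w) vs"
          using sub[of k vs \<rho>'] k vs \<rho>' by (simp add: w)
        moreover have "sem (Disj (map (\<lambda>ls. Conj (map (\<lambda>i. BTC m \<Phi> (ls ! (i - 1)) (w @ [i])) [1..<Suc k]))
            (compositions k (Suc l')))) \<xi> \<rho>' (\<lambda>_. {}) =
            (\<Sum>ls\<in>set (compositions k (Suc l')). \<Prod>i\<in>{..<k}. btc m (pos \<xi>) ?F (ls ! i) (vs ! i))"
          unfolding sem_Disj_map[OF distinct_compositions] sem_Conj_upt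
        proof (intro sum.cong prod.cong refl)
          fix ls i assume ls: "ls \<in> set (compositions k (Suc l'))" and i: "i \<in> {..<k}"
          then have "ls ! i \<in> set ls" "sum_list ls = Suc l'"
            by (auto simp: set_compositions)
          then have "ls ! i < l" using member_le_sum_list[of "ls ! i" ls] 3 by simp
          then show "sem (BTC m \<Phi> (ls ! (Suc i - 1)) (w @ [Suc i])) \<xi> \<rho>' (\<lambda>_. {}) =
            btc m (pos \<xi>) ?F (ls ! i) (vs ! i)"
            using less.IH[of "ls ! i" "w @ [Suc i]" \<rho>'] less.prems \<rho>'[of i] i by simp
        qed
        ultimately show "sem (And (subst k w (\<Phi> k))
          (Disj (map (\<lambda>ls. Conj (map (\<lambda>i. BTC m \<Phi> (ls ! (i - 1)) (w @ [i])) [1..<Suc k]))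
            (compositions k (Suc l'))))) \<xi> (upds \<rho> ?xs vs) (\<lambda>_. {}) =
          ?F (\<rho> w) vs * (\<Sum>ls\<in>set (compositions k (Suc l')). \<Prod>i\<in>{..<k}. btc m (pos \<xi>) ?F (ls ! i) (vs ! i))"
          unfolding sem.simps(8) \<rho>'_def by (simp only:)
      qed
    qed
    show ?thesis
      unfolding 3 BTC.simps(3) btc.simps(3) sem_Disj_map[OF distinct_upt] set_upt
      by (rule sum.cong[OF refl]) (rule inner)
  qed simp
qed

section \<open>Descent of base positions and the bound on the size of a run\<close>

lemma prefix_same_length_eq:
  "prefix u w \<Longrightarrow> prefix v w \<Longrightarrow> length u = length v \<Longrightarrow> u = v"
  using prefix_length_prefix[of u w v] by (auto simp: prefix_def)

lemma base_prefix: "0 < n \<Longrightarrow> prefix (base n v) v"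
  by (simp add: base_eq take_is_prefix)

lemma base_in_pos: "0 < n \<Longrightarrow> v \<in> pos \<xi> \<Longrightarrow> base n v \<in> pos \<xi>"
  by (metis base_prefix pos_prefix prefix_def)

text \<open>The number of these positions bounds the size of a run from \<open>v\<close> and is the
  induction measure for progressing families.\<close>

definition below :: "'f tree \<Rightarrow> nat \<Rightarrow> nat list \<Rightarrow> nat list set" where
  "below \<xi> n v = {u\<in>pos \<xi>. prefix (base n v) u}"

lemma finite_below: "finite (below \<xi> n v)"
  by (simp add: below_def finite_pos)

lemma next_base_distinct:
  assumes "next_base n v vs" "i < length vs" "j < length vs" "i \<noteq> j"
  shows "base n (vs ! i) \<noteq> base n (vs ! j)"
proof -
  have irr: "(u, u) \<notin> lexord less_than" for u :: "nat list"
    by (rule lexord_irreflexive) simp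
  have s: "sorted_wrt (\<lambda>u u'. (u, u') \<in> lexord less_than) (map (base n) vs)"
    using assms(1) by (simp add: next_base_def)
  have "base n (vs ! i) \<noteq> base n (vs ! j)" if "i < j" "j < length vs" for i j
    using sorted_wrt_nth_less[OF s that(1)] that irr by (metis length_map less_trans nth_map)
  then show ?thesis using assms(2-4) by (metis linorder_neqE_nat)
qed

text \<open>The bases of the \<open>vs\<close> are distinct and equally long, so the regions below
  them are disjoint; the base of \<open>v\<close> lies in none of them.\<close>

lemma next_base_below:
  assumes n: "0 < n" and "v \<in> pos \<xi>" "next_base n v vs"
  shows "(\<Sum>i<length vs. card (below \<xi> n (vs ! i))) < card (below \<xi> n v)"
proof -
  have nb: "prefix (base n v) (base n u) \<and> length (base n u) = length (base n v) + n" if "u \<in> set vs" for u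
    using assms(3) that by (auto simp: next_base_def)
  have "(\<Sum>i<length vs. card (below \<xi> n (vs ! i))) = card (\<Union>i<length vs. below \<xi> n (vs ! i))"
  proof (rule card_UN_disjoint[symmetric])
    show "\<forall>i\<in>{..<length vs}. \<forall>j\<in>{..<length vs}. i \<noteq> j \<longrightarrow> below \<xi> n (vs ! i) \<inter> below \<xi> n (vs ! j) = {}"
    proof (intro ballI impI)
      fix i j assume ij: "i \<in> {..<length vs}" "j \<in> {..<length vs}" "i \<noteq> j"
      have "length (base n (vs ! i)) = length (base n (vs ! j))" using nb ij by simp
      then show "below \<xi> n (vs ! i) \<inter> below \<xi> n (vs ! j) = {}"
        using next_base_distinct[OF assms(3), of i j] ij prefix_same_length_eq by (auto simp: below_def)
    qed
  qed (simp_all add: finite_below)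
  also have "\<dots> < card (below \<xi> n v)"
  proof (rule psubset_card_mono[OF finite_below])
    have "base n v \<in> below \<xi> n v" using base_in_pos[OF n assms(2)] by (simp add: below_def)
    moreover have "base n v \<notin> (\<Union>i<length vs. below \<xi> n (vs ! i))"
    proof
      assume "base n v \<in> (\<Union>i<length vs. below \<xi> n (vs ! i))"
      then obtain u where "u \<in> set vs" "prefix (base n u) (base n v)"
        unfolding below_def using nth_mem by blast
      then show False using nb[of u] n prefix_length_le[of "base n u" "base n v"] by simp
    qed
    moreover have "(\<Union>i<length vs. below \<xi> n (vs ! i)) \<subseteq> below \<xi> n v"
    proof
      fix u assume "u \<in> (\<Union>i<length vs. below \<xi> n (vs ! i))"
      then obtain i where "i < length vs" "u \<in> pos \<xi>" "prefix (base n (vs ! i)) u"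
        by (auto simp: below_def)
      then show "u \<in> below \<xi> n v"
        using nb[of "vs ! i"] prefix_order.trans unfolding below_def by auto
    qed
    ultimately show "(\<Union>i<length vs. below \<xi> n (vs ! i)) \<subset> below \<xi> n v" by blast
  qed
  finally show ?thesis .
qed

lemma sum_list_nth_less_ex:
  fixes N :: "nat \<Rightarrow> nat"
  assumes "(\<Sum>i<length ls. N i) < sum_list ls"
  shows "\<exists>i<length ls. N i < ls ! i"
proof (rule ccontr)
  assume "\<not> (\<exists>i<length ls. N i < ls ! i)"
  then have "(\<Sum>i<length ls. ls ! i) \<le> (\<Sum>i<length ls. N i)"
    by (intro sum_mono) (meson lessThan_iff not_less)
  then show False using assms by (simp add: sum_list_sum_nth lessThan_atLeast0)
qed

context
  fixes \<xi> :: "'f tree" and n m :: nat and F :: "nat list \<Rightarrow> nat list list \<Rightarrow> 's::{comm_semiring_0, comm_monoid_mult}"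
  assumes n: "0 < n"
    and progress: "\<And>v vs. v \<in> pos \<xi> \<Longrightarrow> set vs \<subseteq> pos \<xi> \<Longrightarrow> length vs \<le> m \<Longrightarrow> F v vs \<noteq> 0 \<Longrightarrow> next_base n v vs"
begin

text \<open>\<open>l\<close> counts the nodes of a run, and each node uses up a base position of its
  own. If \<open>l\<close> is too large, then in every composition some child receives more nodes
  than there is room for below it.\<close>

lemma btc_vanishes: "v \<in> pos \<xi> \<Longrightarrow> card (below \<xi> n v) < l \<Longrightarrow> btc m (pos \<xi>) F l v = 0"
proof (induction l arbitrary: v rule: less_induct)
  case (less l)
  have "base n v \<in> below \<xi> n v" using base_in_pos[OF n less.prems(1)] by (simp add: below_def)
  then have "card (below \<xi> n v) \<noteq> 0" using finite_below[of \<xi> n v] by auto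
  then obtain l' where l: "l = Suc (Suc l')"
    using less.prems(2) by (metis One_nat_def less_one not0_implies_Suc not_less_zero)
  have "F v vs * (\<Sum>ls\<in>set (compositions k (Suc l')). \<Prod>i\<in>{..<k}. btc m (pos \<xi>) F (ls ! i) (vs ! i)) = 0"
    if k: "k \<in> {1..<Suc m}" and vs: "vs \<in> tuples (pos \<xi>) k" for k vs
  proof (cases "F v vs = 0")
    case False
    have vs': "length vs = k" "set vs \<subseteq> pos \<xi>" using vs by (auto simp: tuples_def)
    have "next_base n v vs"
      using k vs' by (intro progress[OF less.prems(1) _ _ False]) auto
    then have lt: "(\<Sum>i<k. card (below \<xi> n (vs ! i))) < card (below \<xi> n v)"
      using next_base_below[OF n less.prems(1)] vs' by auto
    have "(\<Prod>i\<in>{..<k}. btc m (pos \<xi>) F (ls ! i) (vs ! i)) = 0" if "ls \<in> set (compositions k (Suc l'))" for ls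
    proof -
      have ls: "length ls = k" "sum_list ls = Suc l'" using that by (auto simp: set_compositions)
      then obtain i where i: "i < k" "card (below \<xi> n (vs ! i)) < ls ! i"
        using lt less.prems(2) l sum_list_nth_less_ex[of "\<lambda>i. card (below \<xi> n (vs ! i))" ls] by auto
      have "ls ! i \<le> sum_list ls" using i(1) ls member_le_sum_list[of "ls ! i" ls] by simp
      then have "ls ! i < l" using l ls(2) by simp
      moreover have "vs ! i \<in> pos \<xi>" using tuples_nth[OF vs i(1)] .
      ultimately have "btc m (pos \<xi>) F (ls ! i) (vs ! i) = 0"
        using i(2) by (rule less.IH)
      then show ?thesis using i(1) by (intro prod_eq_0[of _ i]) simp_all
    qed
    then show ?thesis by simp
  qed simp
  then show ?case unfolding l btc.simps(3) by (intro sum.neutral ballI) blast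
qed

text \<open>Compositions tie the sizes of the children together. As all terms beyond the possible
  size of a run vanish, the sizes may range independently up to the common bound \<open>L\<close>,
  and the sum over compositions becomes a product of sums.\<close>

lemma btc_sum_fixpoint:
  assumes v: "v \<in> pos \<xi>"
  defines "L \<equiv> card (pos \<xi>)"
  shows "(\<Sum>l\<in>{1..L}. btc m (pos \<xi>) F l v) =
    (\<Sum>k\<le>m. \<Sum>vs\<in>tuples (pos \<xi>) k. F v vs * (\<Prod>i<k. \<Sum>l\<in>{1..L}. btc m (pos \<xi>) F l (vs ! i)))"
proof -
  let ?B = "btc m (pos \<xi>) F"
  have L: "0 < L" using Nil_in_pos finite_pos by (auto simp: L_def card_gt_0_iff)
  have below_L: "card (below \<xi> n v) \<le> L"
    unfolding L_def by (rule card_mono[OF finite_pos]) (auto simp: below_def)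
  have conv: "F v vs * (\<Sum>l\<in>{1..<L}. \<Sum>ls\<in>set (compositions k l). \<Prod>i<k. ?B (ls ! i) (vs ! i)) =
      F v vs * (\<Prod>i<k. \<Sum>l\<in>{1..L}. ?B l (vs ! i))"
    if k: "k \<in> {1..<Suc m}" and vs: "vs \<in> tuples (pos \<xi>) k" for k vs
  proof (cases "F v vs = 0")
    case False
    have vs': "length vs = k" "set vs \<subseteq> pos \<xi>" using vs by (auto simp: tuples_def)
    have "next_base n v vs"
      using k vs' by (intro progress[OF v _ _ False]) auto
    \<comment> \<open>Together the children have room for fewer than \<open>L\<close> nodes; at
      least one position is left for \<open>v\<close>.\<close>
    then have lt: "(\<Sum>i<k. card (below \<xi> n (vs ! i))) < L"
      using next_base_below[OF n v] vs' below_L by fastforce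
    let ?S = "{ls\<in>tuples {1..L} k. sum_list ls < L}"
    let ?P = "\<lambda>ls. \<Prod>i<k. ?B (ls ! i) (vs ! i)"
    have finS: "finite ?S" by (simp add: finite_tuples)
    have comp: "set (compositions k l) = {ls\<in>?S. sum_list ls = l}" if "l \<in> {1..<L}" for l
    proof -
      have "set ls \<subseteq> {1..L} \<longleftrightarrow> 0 \<notin> set ls" if "sum_list ls = l" for ls
      proof
        assume "0 \<notin> set ls"
        then have "x \<noteq> 0" if "x \<in> set ls" for x using that by metis
        moreover have "x \<le> L" if "x \<in> set ls" for x
          using member_le_sum_list[OF that] \<open>sum_list ls = l\<close> \<open>l \<in> {1..<L}\<close> by simp
        ultimately show "set ls \<subseteq> {1..L}" by (simp add: subset_iff Suc_le_eq)
      qed auto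
      then show ?thesis using that by (auto simp: set_compositions tuples_def)
    qed
    have "(\<Sum>l\<in>{1..<L}. \<Sum>ls\<in>set (compositions k l). ?P ls) = (\<Sum>l\<in>{1..<L}. \<Sum>ls\<in>{ls\<in>?S. sum_list ls = l}. ?P ls)"
      by (intro sum.cong[OF refl]) (simp only: comp)
    also have "\<dots> = (\<Sum>ls\<in>?S. ?P ls)"
    proof (rule sum.group[OF finS])
      show "sum_list ` ?S \<subseteq> {1..<L}"
      proof
        fix s assume "s \<in> sum_list ` ?S"
        then obtain ls where ls: "s = sum_list ls" "ls \<in> ?S" by blast
        then have "ls ! 0 \<in> {1..L}" using k by (intro tuples_nth[of ls]) auto
        moreover have "ls ! 0 \<in> set ls" using ls k by (auto simp: tuples_def)
        ultimately show "s \<in> {1..<L}" using ls member_le_sum_list[of "ls ! 0" ls] by auto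
      qed
    qed simp
    \<comment> \<open>Tuples with sum at least \<open>L\<close> may be added: one entry exceeds the
      room below its position, and its factor is 0.\<close>
    also have "\<dots> = (\<Sum>ls\<in>tuples {1..L} k. ?P ls)"
    proof (rule sum.mono_neutral_left)
      show "\<forall>ls\<in>tuples {1..L} k - ?S. ?P ls = 0"
      proof
        fix ls assume "ls \<in> tuples {1..L} k - ?S"
        then have "length ls = k" "L \<le> sum_list ls" by (auto simp: tuples_def)
        then obtain i where i: "i < k" "card (below \<xi> n (vs ! i)) < ls ! i"
          using lt sum_list_nth_less_ex[of "\<lambda>i. card (below \<xi> n (vs ! i))" ls] by auto
        have "?B (ls ! i) (vs ! i) = 0" by (rule btc_vanishes[OF tuples_nth[OF vs i(1)] i(2)])
        then show "?P ls = 0" using i(1) by (intro prod_eq_0[of _ i]) simp_all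
      qed
    qed (auto simp: finite_tuples)
    finally show ?thesis by (simp only: prod_sum_distrib_tuples)
  qed simp
  \<comment> \<open>Runs of size 1 become the summand \<open>k = 0\<close>; the shift by one in the
    rest accounts for the node \<open>v\<close>.\<close>
  have "(\<Sum>l\<in>{1..L}. ?B l v) = ?B (Suc 0) v + (\<Sum>l\<in>{1..<L}. ?B (Suc l) v)"
  proof -
    have eq: "{1..L} = insert (Suc 0) (Suc ` {1..<L})"
      using L by (auto simp: image_Suc_atLeastLessThan)
    show ?thesis
      unfolding eq by (subst sum.insert) (auto simp: sum.reindex simp del: image_Suc_atLeastLessThan)
  qed
  also have "(\<Sum>l\<in>{1..<L}. ?B (Suc l) v) = (\<Sum>l\<in>{1..<L}. \<Sum>k\<in>{1..<Suc m}. \<Sum>vs\<in>tuples (pos \<xi>) k.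
      F v vs * (\<Sum>ls\<in>set (compositions k l). \<Prod>i<k. ?B (ls ! i) (vs ! i)))"
  proof (rule sum.cong[OF refl])
    fix l assume "l \<in> {1..<L}"
    then obtain l' where "l = Suc l'" by (cases l) auto
    then show "?B (Suc l) v = (\<Sum>k\<in>{1..<Suc m}. \<Sum>vs\<in>tuples (pos \<xi>) k.
      F v vs * (\<Sum>ls\<in>set (compositions k l). \<Prod>i<k. ?B (ls ! i) (vs ! i)))"
      by (simp only: btc.simps(3))
  qed
  also have "\<dots> = (\<Sum>k\<in>{1..<Suc m}. \<Sum>vs\<in>tuples (pos \<xi>) k.
      F v vs * (\<Sum>l\<in>{1..<L}. \<Sum>ls\<in>set (compositions k l). \<Prod>i<k. ?B (ls ! i) (vs ! i)))"
    by (subst sum.swap, rule sum.cong[OF refl], subst sum.swap, rule sum.cong[OF refl])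
      (simp only: sum_distrib_left)
  also have "\<dots> = (\<Sum>k\<in>{1..<Suc m}. \<Sum>vs\<in>tuples (pos \<xi>) k. F v vs * (\<Prod>i<k. \<Sum>l\<in>{1..L}. ?B l (vs ! i)))"
    by (intro sum.cong refl conv)
  also have "?B (Suc 0) v + \<dots> = (\<Sum>k\<in>insert 0 {1..<Suc m}.
      \<Sum>vs\<in>tuples (pos \<xi>) k. F v vs * (\<Prod>i<k. \<Sum>l\<in>{1..L}. ?B l (vs ! i)))"
    by simp
  also have "insert 0 {1..<Suc m} = {..m}" by auto
  finally show ?thesis .
qed

end

text \<open>This equation is all that is used later about the semantics of branching transitive
  closures.\<close>

lemma BTC_sem_fixpoint:
  fixes \<Phi> :: "nat \<Rightarrow> ('f, 's::{comm_semiring_0, comm_monoid_mult}, nat) mso"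
  assumes "0 < n" "is_family L m \<Phi>" "progressing rk n m \<Phi>" "\<xi> \<in> trees rk" "v \<in> pos \<xi>"
  shows "BTC_sem m \<Phi> \<xi> v = (\<Sum>k\<le>m. \<Sum>vs\<in>tuples (pos \<xi>) k.
    sem (\<Phi> k) \<xi> (assign v vs) (\<lambda>_. {}) * (\<Prod>i<k. BTC_sem m \<Phi> \<xi> (vs ! i)))"
proof -
  let ?F = "\<lambda>v vs. sem (\<Phi> (length vs)) \<xi> (assign v vs) (\<lambda>_. {})"
  have B: "BTC_sem m \<Phi> \<xi> v = (\<Sum>l\<in>{1..card (pos \<xi>)}. btc m (pos \<xi>) ?F l v)" for v
    unfolding BTC_sem_def by (simp add: sem_BTC[OF assms(2)])
  have "BTC_sem m \<Phi> \<xi> v = (\<Sum>k\<le>m. \<Sum>vs\<in>tuples (pos \<xi>) k. ?F v vs * (\<Prod>i<k. BTC_sem m \<Phi> \<xi> (vs ! i)))"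
    unfolding B
    by (rule btc_sum_fixpoint[OF assms(1) _ assms(5)]) (use assms(3,4) in \<open>auto simp: progressing_def\<close>)
  also have "\<dots> = (\<Sum>k\<le>m. \<Sum>vs\<in>tuples (pos \<xi>) k.
    sem (\<Phi> k) \<xi> (assign v vs) (\<lambda>_. {}) * (\<Prod>i<k. BTC_sem m \<Phi> \<xi> (vs ! i)))"
    by (intro sum.cong refl) (simp add: tuples_def)
  finally show ?thesis .
qed

section \<open>Runs of branching transitive closures as sets of positions\<close>

definition par :: "nat \<Rightarrow> nat list \<Rightarrow> nat list \<Rightarrow> bool" where
  "par n w w' \<longleftrightarrow> prefix (base n w) (base n w') \<and> length (base n w') = length (base n w) + n"

definition children :: "nat \<Rightarrow> nat list set \<Rightarrow> nat list \<Rightarrow> nat list set" where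
  "children n V w = {w'\<in>V. par n w w'}"

definition is_chlist :: "nat \<Rightarrow> nat list set \<Rightarrow> nat list \<Rightarrow> nat list list \<Rightarrow> bool" where
  "is_chlist n V w vs \<longleftrightarrow> next_base n w vs \<and> set vs = children n V w"

lemma next_base_iff:
  "next_base n w vs \<longleftrightarrow> (\<forall>u\<in>set vs. par n w u) \<and> sorted_wrt (<) (map (base n) vs)"
proof -
  have "less_than = {(u, v). u < v}" by auto
  then have "(\<lambda>u u'. (u, u') \<in> lexord less_than) = ((<) :: nat list \<Rightarrow> nat list \<Rightarrow> bool)"
    by (simp add: list_less_def fun_eq_iff)
  then show ?thesis by (simp add: next_base_def par_def)
qed

text \<open>A strictly sorted list is determined by its set, here a set of base positions, and
  injectivity of \<open>base n\<close> on \<open>V\<close> recovers the positions. This uniqueness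
  keeps a run from being counted twice.\<close>

lemma is_chlist_unique:
  assumes "inj_on (base n) V" "is_chlist n V w vs" "is_chlist n V w vs'"
  shows "vs = vs'"
proof -
  have "map (base n) vs = map (base n) vs'"
    using assms(2,3) by (intro strict_sorted_equal) (simp_all add: is_chlist_def next_base_iff)
  moreover have "set vs \<union> set vs' \<subseteq> V"
    using assms(2,3) by (auto simp: is_chlist_def children_def)
  ultimately show ?thesis
    using map_inj_on[of "base n" vs vs'] inj_on_subset[OF assms(1)] by blast
qed

lemma is_chlist_exists:
  assumes "inj_on (base n) V" "finite V"
  shows "\<exists>vs. is_chlist n V w vs"
proof -
  let ?C = "children n V w"
  have C: "?C \<subseteq> V" "finite ?C" using assms(2) by (auto simp: children_def)
  have inj: "inj_on (base n) ?C" by (rule inj_on_subset[OF assms(1) C(1)])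
  let ?bs = "sorted_list_of_set (base n ` ?C)"
  let ?g = "the_inv_into ?C (base n)"
  have bs: "set ?bs = base n ` ?C" using C(2) by simp
  have "map (base n) (map ?g ?bs) = ?bs"
    using f_the_inv_into_f[OF inj] bs by (auto intro!: map_idI)
  moreover have "set (map ?g ?bs) = ?C"
    using the_inv_into_f_f[OF inj] by (simp only: set_map bs) (force simp: image_iff)
  ultimately have "is_chlist n V w (map ?g ?bs)"
    unfolding is_chlist_def next_base_iff using strict_sorted_list_of_set[of "base n ` ?C"]
    by (simp only:) (simp add: children_def)
  then show ?thesis ..
qed

definition chlist :: "nat \<Rightarrow> nat list set \<Rightarrow> nat list \<Rightarrow> nat list list" where
  "chlist n V w = (THE vs. is_chlist n V w vs)"

lemma chlist_eqI: "inj_on (base n) V \<Longrightarrow> is_chlist n V w vs \<Longrightarrow> chlist n V w = vs"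
  unfolding chlist_def by (rule the_equality) (auto intro: is_chlist_unique)

lemma chlist: "inj_on (base n) V \<Longrightarrow> finite V \<Longrightarrow> is_chlist n V w (chlist n V w)"
  using is_chlist_exists[of n V w] chlist_eqI[of n V w] by metis

text \<open>
  The sets of positions that a branching transitive closure started in \<open>v\<close> can visit: every base
  position is used at most once, and every element except \<open>v\<close> has a parent.
\<close>

definition visits :: "'f tree \<Rightarrow> nat \<Rightarrow> nat list \<Rightarrow> nat list set set" where
  "visits \<xi> n v = {V. V \<subseteq> pos \<xi> \<and> v \<in> V \<and> (\<forall>w\<in>V. prefix (base n v) (base n w)) \<and>
    inj_on (base n) V \<and> (\<forall>w\<in>V. w \<noteq> v \<longrightarrow> (\<exists>w'\<in>V. par n w' w))}"

lemma visitsD: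
  assumes "V \<in> visits \<xi> n v"
  shows "V \<subseteq> pos \<xi>" "v \<in> V" "\<And>w. w \<in> V \<Longrightarrow> prefix (base n v) (base n w)" "inj_on (base n) V"
    "\<And>w. w \<in> V \<Longrightarrow> w \<noteq> v \<Longrightarrow> \<exists>w'\<in>V. par n w' w"
  using assms by (auto simp: visits_def)

lemma visits_finite: "V \<in> visits \<xi> n v \<Longrightarrow> finite V"
  by (rule finite_subset[OF visitsD(1) finite_pos])

lemma finite_visits: "finite (visits \<xi> n v)"
  by (rule finite_subset[of _ "Pow (pos \<xi>)"]) (auto simp: visits_def finite_pos)

lemma dvd_length_base: "0 < n \<Longrightarrow> n dvd length (base n v)"
  by (simp add: base_eq dvd_minus_mod)

context
  fixes \<xi> :: "'f tree" and n :: nat and v :: "nat list" and vs :: "nat list list"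
  assumes n: "0 < n" and v: "v \<in> pos \<xi>" and nb: "next_base n v vs"
begin

lemma nb_par: "i < length vs \<Longrightarrow> par n v (vs ! i)"
  using nb by (simp add: next_base_iff)

lemma nb_disjoint:
  assumes "i < length vs" "j < length vs" "prefix (base n (vs ! i)) u" "prefix (base n (vs ! j)) u"
  shows "i = j"
proof (rule ccontr)
  assume "i \<noteq> j"
  moreover have "base n (vs ! i) = base n (vs ! j)"
    using assms nb_par[of i] nb_par[of j] by (intro prefix_same_length_eq) (auto simp: par_def)
  ultimately show False using next_base_distinct[OF nb assms(1,2)] by simp
qed

lemma nb_not_prefix: "i < length vs \<Longrightarrow> \<not> prefix (base n (vs ! i)) (base n v)"
  using nb_par[of i] n prefix_length_le[of "base n (vs ! i)" "base n v"] by (auto simp: par_def)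

definition join :: "(nat \<Rightarrow> nat list set) \<Rightarrow> nat list set" where
  "join Vs = insert v (\<Union>i<length vs. Vs i)"

text \<open>The sets \<open>Vs i\<close> lie in the disjoint regions below the bases of
  \<open>vs ! i\<close>. So each of them can be recovered from the union, and the children of its
  elements stay inside it.\<close>

lemma
  assumes Vs: "\<And>i. i < length vs \<Longrightarrow> Vs i \<in> visits \<xi> n (vs ! i)"
  shows join_part: "\<And>i. i < length vs \<Longrightarrow> {w\<in>join Vs. prefix (base n (vs ! i)) (base n w)} = Vs i"
    and join_chlist_root: "is_chlist n (join Vs) v vs"
    and join_visits: "join Vs \<in> visits \<xi> n v"
    and join_children: "\<And>i w. i < length vs \<Longrightarrow> w \<in> Vs i \<Longrightarrow> children n (join Vs) w = children n (Vs i) w"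
proof -
  have pre: "prefix (base n (vs ! i)) (base n w)" if "i < length vs" "w \<in> Vs i" for i w
    using visitsD(3)[OF Vs[OF that(1)] that(2)] .
  show part: "{w\<in>join Vs. prefix (base n (vs ! i)) (base n w)} = Vs i" if "i < length vs" for i
    using that pre nb_disjoint nb_not_prefix by (auto simp: join_def) blast
  have root: "vs ! i \<in> Vs i" if "i < length vs" for i using visitsD(2)[OF Vs[OF that]] .
  have par_irrefl: "\<not> par n v v" using n by (simp add: par_def)
  have child: "w = vs ! i" if "i < length vs" "w \<in> Vs i" "par n v w" for i w
  proof -
    have "base n (vs ! i) = base n w"
      using pre[OF that(1,2)] that(3) nb_par[OF that(1)]
      by (intro prefix_same_length_eq[of _ "base n w"]) (auto simp: par_def)
    then show ?thesis using inj_onD[OF visitsD(4)[OF Vs[OF that(1)]]] root[OF that(1)] that(2) by simp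
  qed
  have "children n (join Vs) v = set vs"
  proof
    show "children n (join Vs) v \<subseteq> set vs"
      using child par_irrefl nth_mem by (fastforce simp: children_def join_def)
    show "set vs \<subseteq> children n (join Vs) v"
    proof
      fix u assume "u \<in> set vs"
      then obtain i where "i < length vs" "u = vs ! i" by (auto simp: in_set_conv_nth)
      then show "u \<in> children n (join Vs) v"
        using root nb_par unfolding children_def join_def by blast
    qed
  qed
  then show "is_chlist n (join Vs) v vs" using nb by (simp add: is_chlist_def)
  show "join Vs \<in> visits \<xi> n v"
    unfolding visits_def
  proof (intro CollectI conjI ballI impI)
    show "join Vs \<subseteq> pos \<xi>" using v visitsD(1)[OF Vs] by (auto simp: join_def)
    show "v \<in> join Vs" by (simp add: join_def)
    show "prefix (base n v) (base n w)" if w: "w \<in> join Vs" for w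
    proof (cases "w = v")
      case False
      then obtain i where "i < length vs" "w \<in> Vs i" using w by (auto simp: join_def)
      then show ?thesis
        using prefix_order.trans[OF _ pre[of i w], of "base n v"] nb_par[of i] by (simp add: par_def)
    qed simp
    show "inj_on (base n) (join Vs)"
    proof (rule inj_onI)
      fix w w' assume w: "w \<in> join Vs" "w' \<in> join Vs" and eq: "base n w = base n w'"
      show "w = w'"
      proof (cases "\<exists>i<length vs. prefix (base n (vs ! i)) (base n w)")
        case True
        then obtain i where i: "i < length vs" "prefix (base n (vs ! i)) (base n w)" by blast
        have "w \<in> Vs i" unfolding part[OF i(1), symmetric] using w i by simp
        moreover have "w' \<in> Vs i" unfolding part[OF i(1), symmetric] using w i eq by simp
        ultimately show ?thesis using inj_onD[OF visitsD(4)[OF Vs[OF i(1)]] eq] by blast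
      next
        case False
        have "u = v" if u: "u \<in> join Vs" "base n u = base n w" for u
        proof (rule ccontr)
          assume "u \<noteq> v"
          then obtain i where "i < length vs" "u \<in> Vs i" using u(1) unfolding join_def by blast
          then show False using pre[of i u] False u(2) by simp
        qed
        then show ?thesis using w eq by metis
      qed
    qed
    show "\<exists>w'\<in>join Vs. par n w' w" if w: "w \<in> join Vs" "w \<noteq> v" for w
    proof -
      obtain i where i: "i < length vs" "w \<in> Vs i" using w by (auto simp: join_def)
      show ?thesis
      proof (cases "w = vs ! i")
        case True
        then show ?thesis using nb_par[OF i(1)] by (auto simp: join_def)
      next
        case False
        then obtain w' where "w' \<in> Vs i" "par n w' w" using visitsD(5)[OF Vs[OF i(1)] i(2)] by blast
        then show ?thesis using i(1) by (auto simp: join_def)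
      qed
    qed
  qed
  show "children n (join Vs) w = children n (Vs i) w" if i: "i < length vs" "w \<in> Vs i" for i w
  proof -
    have "w' \<in> Vs i" if "w' \<in> join Vs" "par n w w'" for w'
    proof -
      have "prefix (base n (vs ! i)) (base n w')"
        using pre[OF i] that(2) prefix_order.trans unfolding par_def by blast
      then show ?thesis using part[OF i(1)] that(1) by blast
    qed
    then show ?thesis using i by (auto simp: children_def join_def)
  qed
qed

text \<open>The inverse of \<open>join\<close>: a visited set is cut along the regions of the
  children of \<open>v\<close>.\<close>

lemma visits_split:
  assumes V: "V \<in> visits \<xi> n v" and vs: "set vs = children n V v"
  shows "\<And>i. i < length vs \<Longrightarrow> {w\<in>V. prefix (base n (vs ! i)) (base n w)} \<in> visits \<xi> n (vs ! i)"
    and "join (\<lambda>i. {w\<in>V. prefix (base n (vs ! i)) (base n w)}) = V"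
proof -
  let ?Vs = "\<lambda>i. {w\<in>V. prefix (base n (vs ! i)) (base n w)}"
  have vsV: "vs ! i \<in> V" if "i < length vs" for i
    using vs nth_mem[OF that] by (simp add: children_def)
  show "?Vs i \<in> visits \<xi> n (vs ! i)" if i: "i < length vs" for i
    unfolding visits_def
  proof (rule CollectI, intro conjI ballI impI)
    show "?Vs i \<subseteq> pos \<xi>" using visitsD(1)[OF V] by blast
    show "vs ! i \<in> ?Vs i" using vsV[OF i] by simp
    show "inj_on (base n) (?Vs i)" by (rule inj_on_subset[OF visitsD(4)[OF V]]) blast
    show "\<exists>w'\<in>?Vs i. par n w' w" if w: "w \<in> ?Vs i" "w \<noteq> vs ! i" for w
    proof -
      have "w \<noteq> v" using w nb_not_prefix[OF i] by auto
      then obtain w' where w': "w' \<in> V" "par n w' w" using visitsD(5)[OF V] w by blast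
      have "base n w \<noteq> base n (vs ! i)"
        using inj_onD[OF visitsD(4)[OF V]] w vsV[OF i] by auto
      then have "length (base n (vs ! i)) < length (base n w)"
        using w by (metis (mono_tags, lifting) le_neq_implies_less mem_Collect_eq prefix_length_le prefix_order.order_refl prefix_same_length_eq)
      \<comment> \<open>Since base lengths are multiples of \<open>n\<close>, the base of
        \<open>w\<close> is at least \<open>n\<close> longer than that of \<open>vs ! i\<close>, and
        the parent of \<open>w\<close> stays in the same region.\<close>
      moreover have "n dvd length (base n w) - length (base n (vs ! i))"
        by (intro dvd_diff_nat dvd_length_base n)
      ultimately have "n \<le> length (base n w) - length (base n (vs ! i))"
        by (intro dvd_imp_le) simp_all
      then have "length (base n (vs ! i)) \<le> length (base n w')"
        using w'(2) \<open>length (base n (vs ! i)) < length (base n w)\<close> by (simp add: par_def)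
      then have "prefix (base n (vs ! i)) (base n w')"
        using w'(2) w(1) by (auto simp: par_def intro: prefix_length_prefix)
      then show ?thesis using w' by blast
    qed
  qed blast
  \<comment> \<open>Following parents upwards from any other element leads to \<open>v\<close>
    through one of its children.\<close>
  have "w = v \<or> (\<exists>i<length vs. prefix (base n (vs ! i)) (base n w))" if "w \<in> V" for w
    using that
  proof (induction "length (base n w)" arbitrary: w rule: less_induct)
    case less
    show ?case
    proof (cases "w = v")
      case False
      then obtain w' where w': "w' \<in> V" "par n w' w" using visitsD(5)[OF V] less.prems by blast
      show ?thesis
      proof (cases "w' = v")
        case True
        then have "w \<in> set vs" using w' less.prems vs by (simp add: children_def)
        then show ?thesis by (auto simp: in_set_conv_nth)
      next
        case False
        then obtain i where "i < length vs" "prefix (base n (vs ! i)) (base n w')"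
          using less.hyps[OF _ w'(1)] w'(2) n by (auto simp: par_def)
        then show ?thesis using w'(2) prefix_order.trans unfolding par_def by blast
      qed
    qed simp
  qed
  then show "join ?Vs = V" using visitsD(2)[OF V] by (auto simp: join_def)
qed

end

text \<open>With more than \<open>m\<close> children no member of the family applies, and the value
  0 discards the set.\<close>

definition weight :: "nat \<Rightarrow> (nat list \<Rightarrow> nat list list \<Rightarrow> 's::{comm_semiring_0, comm_monoid_mult}) \<Rightarrow> nat \<Rightarrow>
    nat list set \<Rightarrow> nat list \<Rightarrow> 's" where
  "weight m F n V w = (if length (chlist n V w) \<le> m then F w (chlist n V w) else 0)"

text \<open>\<open>T\<close> is any solution of the fixpoint equation. Unfolding it once and using
  the induction hypothesis at the successors gives a sum over pairs of a list of children and
  visited sets below them; cutting and joining put these pairs in bijection with visited sets below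
  \<open>v\<close>.\<close>

lemma visits_fixpoint:
  fixes F :: "nat list \<Rightarrow> nat list list \<Rightarrow> 's::{comm_semiring_0, comm_monoid_mult}" and \<xi> :: "'f tree"
  assumes n: "0 < n"
    and progress: "\<And>v vs. v \<in> pos \<xi> \<Longrightarrow> set vs \<subseteq> pos \<xi> \<Longrightarrow> length vs \<le> m \<Longrightarrow> F v vs \<noteq> 0 \<Longrightarrow> next_base n v vs"
    and T: "\<And>v. v \<in> pos \<xi> \<Longrightarrow> T v = (\<Sum>k\<le>m. \<Sum>vs\<in>tuples (pos \<xi>) k. F v vs * (\<Prod>i<k. T (vs ! i)))"
    and v: "v \<in> pos \<xi>"
  shows "T v = (\<Sum>V\<in>visits \<xi> n v. \<Prod>w\<in>V. weight m F n V w)"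
  using v
proof (induction "card (below \<xi> n v)" arbitrary: v rule: less_induct)
  case less
  note v = less.prems
  let ?W = "weight m F n"
  define S where "S = {vs. set vs \<subseteq> pos \<xi> \<and> length vs \<le> m \<and> next_base n v vs}"
  define D where "D vs = PiE {..<length vs} (\<lambda>i. visits \<xi> n (vs ! i))" for vs
  define J where "J vs Vs = join v vs Vs" for vs Vs
  define parts where "parts V = (chlist n V v, restrict (\<lambda>i. {w\<in>V. prefix (base n (chlist n V v ! i)) (base n w)}) {..<length (chlist n V v)})" for V
  have S: "next_base n v vs" "vs ! i \<in> pos \<xi>" if "vs \<in> S" "i < length vs" for vs i
    using that by (auto simp: S_def)
  have finS: "finite S"
    by (rule finite_subset[OF _ finite_lists_length_le[OF finite_pos]]) (auto simp: S_def)
  have step: "F v vs * (\<Prod>i<length vs. T (vs ! i)) = (\<Sum>Vs\<in>D vs. \<Prod>w\<in>J vs Vs. ?W (J vs Vs) w)"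
    if vs: "vs \<in> S" for vs
  proof -
    have nb: "next_base n v vs" using vs by (simp add: S_def)
    have "T (vs ! i) = (\<Sum>V\<in>visits \<xi> n (vs ! i). \<Prod>w\<in>V. ?W V w)" if i: "i < length vs" for i
    proof (rule less.hyps)
      have "card (below \<xi> n (vs ! i)) \<le> (\<Sum>i<length vs. card (below \<xi> n (vs ! i)))"
        using i by (intro member_le_sum) auto
      also have "\<dots> < card (below \<xi> n v)" by (rule next_base_below[OF n v nb])
      finally show "card (below \<xi> n (vs ! i)) < card (below \<xi> n v)" .
    qed (use S[OF vs i] in simp)
    then have "F v vs * (\<Prod>i<length vs. T (vs ! i)) =
        F v vs * (\<Prod>i<length vs. \<Sum>V\<in>visits \<xi> n (vs ! i). \<Prod>w\<in>V. ?W V w)"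
      by simp
    also have "\<dots> = F v vs * (\<Sum>Vs\<in>D vs. \<Prod>i<length vs. \<Prod>w\<in>Vs i. ?W (Vs i) w)"
      unfolding D_def by (subst prod_sum_distrib_PiE) (simp_all add: finite_visits)
    also have "\<dots> = (\<Sum>Vs\<in>D vs. F v vs * (\<Prod>i<length vs. \<Prod>w\<in>Vs i. ?W (Vs i) w))"
      by (rule sum_distrib_left)
    also have "\<dots> = (\<Sum>Vs\<in>D vs. \<Prod>w\<in>J vs Vs. ?W (J vs Vs) w)"
    proof (rule sum.cong[OF refl])
      fix Vs assume "Vs \<in> D vs"
      then have Vs: "Vs i \<in> visits \<xi> n (vs ! i)" if "i < length vs" for i
        using that by (auto simp: D_def)
      note jn = join_part[OF n v nb Vs] join_chlist_root[OF n v nb Vs] join_visits[OF n v nb Vs]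
        join_children[OF n v nb Vs]
      have inj: "inj_on (base n) (J vs Vs)" using visitsD(4)[OF jn(3)] by (simp add: J_def)
      have "chlist n (J vs Vs) v = vs" using chlist_eqI[OF inj] jn(2) by (simp add: J_def)
      then have Wv: "?W (J vs Vs) v = F v vs" using vs by (simp add: weight_def S_def)
      have Ww: "?W (J vs Vs) w = ?W (Vs i) w" if "i < length vs" "w \<in> Vs i" for i w
      proof -
        have "is_chlist n (J vs Vs) w = is_chlist n (Vs i) w"
          using jn(4)[OF _ that] by (simp add: is_chlist_def J_def fun_eq_iff)
        then show ?thesis by (simp add: weight_def chlist_def)
      qed
      have notin: "v \<notin> Vs i" if "i < length vs" for i
        using visitsD(3)[OF Vs[OF that], of v] nb_not_prefix[OF n v nb that] by blast
      have disj: "Vs i \<inter> Vs j = {}" if "i < length vs" "j < length vs" "i \<noteq> j" for i j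
        using visitsD(3)[OF Vs[OF that(1)]] visitsD(3)[OF Vs[OF that(2)]]
          nb_disjoint[OF n v nb that(1,2)] that(3) by blast
      have fin: "finite (Vs i)" if "i < length vs" for i using visits_finite[OF Vs[OF that]] .
      have "(\<Prod>w\<in>J vs Vs. ?W (J vs Vs) w) = ?W (J vs Vs) v * (\<Prod>w\<in>(\<Union>i<length vs. Vs i). ?W (J vs Vs) w)"
        unfolding J_def join_def[OF n v nb] using notin fin by (subst prod.insert) auto
      also have "(\<Prod>w\<in>(\<Union>i<length vs. Vs i). ?W (J vs Vs) w) = (\<Prod>i<length vs. \<Prod>w\<in>Vs i. ?W (J vs Vs) w)"
        using disj fin by (intro prod.UNION_disjoint) auto
      also have "\<dots> = (\<Prod>i<length vs. \<Prod>w\<in>Vs i. ?W (Vs i) w)"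
        by (intro prod.cong refl) (simp add: Ww)
      finally show "F v vs * (\<Prod>i<length vs. \<Prod>w\<in>Vs i. ?W (Vs i) w) = (\<Prod>w\<in>J vs Vs. ?W (J vs Vs) w)"
        by (simp add: Wv)
    qed
    finally show ?thesis .
  qed
  have "T v = (\<Sum>k\<le>m. \<Sum>vs\<in>tuples (pos \<xi>) k. F v vs * (\<Prod>i<length vs. T (vs ! i)))"
    unfolding T[OF v] by (intro sum.cong refl) (simp add: tuples_def)
  also have "\<dots> = (\<Sum>k\<le>m. \<Sum>vs\<in>{vs\<in>{vs. set vs \<subseteq> pos \<xi> \<and> length vs \<le> m}. length vs = k}. F v vs * (\<Prod>i<length vs. T (vs ! i)))"
    by (intro sum.cong refl) (auto simp: tuples_def)
  also have "\<dots> = (\<Sum>vs\<in>{vs. set vs \<subseteq> pos \<xi> \<and> length vs \<le> m}. F v vs * (\<Prod>i<length vs. T (vs ! i)))"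
    by (rule sum.group) (auto simp: finite_lists_length_le finite_pos)
  \<comment> \<open>Lists that violate progress have value 0. For the others the regions are
    disjoint, which makes joining reversible.\<close>
  also have "\<dots> = (\<Sum>vs\<in>S. F v vs * (\<Prod>i<length vs. T (vs ! i)))"
  proof (rule sum.mono_neutral_right)
    show "\<forall>vs\<in>{vs. set vs \<subseteq> pos \<xi> \<and> length vs \<le> m} - S. F v vs * (\<Prod>i<length vs. T (vs ! i)) = 0"
    proof
      fix vs assume vs: "vs \<in> {vs. set vs \<subseteq> pos \<xi> \<and> length vs \<le> m} - S"
      then have "F v vs = 0" using progress[OF v, of vs] by (auto simp: S_def)
      then show "F v vs * (\<Prod>i<length vs. T (vs ! i)) = 0" by simp
    qed
  qed (auto simp: finite_lists_length_le finite_pos S_def)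
  also have "\<dots> = (\<Sum>vs\<in>S. \<Sum>Vs\<in>D vs. \<Prod>w\<in>J vs Vs. ?W (J vs Vs) w)"
    by (rule sum.cong[OF refl]) (rule step)
  also have "\<dots> = (\<Sum>(vs, Vs)\<in>Sigma S D. \<Prod>w\<in>J vs Vs. ?W (J vs Vs) w)"
    by (rule sum.Sigma[OF finS]) (simp add: D_def finite_PiE finite_visits)
  \<comment> \<open>Only sets in which \<open>v\<close> has at most \<open>m\<close> children arise
    this way; the last step adds the others, whose weight at \<open>v\<close> is 0.\<close>
  also have "\<dots> = (\<Sum>V\<in>{V\<in>visits \<xi> n v. length (chlist n V v) \<le> m}. \<Prod>w\<in>V. ?W V w)"
  proof (rule sum.reindex_bij_witness[where j = "\<lambda>(vs, Vs). J vs Vs" and i = parts])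
    fix p assume "p \<in> Sigma S D"
    then obtain vs Vs where p: "p = (vs, Vs)" "vs \<in> S" "Vs \<in> D vs" by blast
    then have nb: "next_base n v vs" and ext: "Vs \<in> extensional {..<length vs}"
      by (auto simp: S_def D_def PiE_iff)
    have Vs: "Vs i \<in> visits \<xi> n (vs ! i)" if "i < length vs" for i
      using p that by (auto simp: D_def)
    note jn = join_part[OF n v nb Vs] join_chlist_root[OF n v nb Vs] join_visits[OF n v nb Vs]
    have inj: "inj_on (base n) (J vs Vs)" using visitsD(4)[OF jn(3)] by (simp add: J_def)
    have ch: "chlist n (J vs Vs) v = vs" using chlist_eqI[OF inj] jn(2) by (simp add: J_def)
    have "restrict (\<lambda>i. {w\<in>J vs Vs. prefix (base n (vs ! i)) (base n w)}) {..<length vs} = Vs"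
    proof
      fix i
      show "restrict (\<lambda>i. {w\<in>J vs Vs. prefix (base n (vs ! i)) (base n w)}) {..<length vs} i = Vs i"
        using jn(1)[of i] ext by (cases "i < length vs") (simp_all add: J_def extensional_def)
    qed
    then show "parts (case p of (vs, Vs) \<Rightarrow> J vs Vs) = p"
      by (simp add: p(1) ch parts_def)
    show "(case p of (vs, Vs) \<Rightarrow> J vs Vs) \<in> {V\<in>visits \<xi> n v. length (chlist n V v) \<le> m}"
      using jn(3) p(2) by (simp add: p(1) ch S_def) (simp add: J_def)
    show "(\<Prod>w\<in>(case p of (vs, Vs) \<Rightarrow> J vs Vs). ?W (case p of (vs, Vs) \<Rightarrow> J vs Vs) w) =
      (case p of (vs, Vs) \<Rightarrow> \<Prod>w\<in>J vs Vs. ?W (J vs Vs) w)"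
      by (simp add: p(1))
  next
    fix V assume "V \<in> {V\<in>visits \<xi> n v. length (chlist n V v) \<le> m}"
    then have V: "V \<in> visits \<xi> n v" and len: "length (chlist n V v) \<le> m" by auto
    define vs where "vs = chlist n V v"
    have ch: "is_chlist n V v vs"
      unfolding vs_def by (rule chlist[OF visitsD(4)[OF V] visits_finite[OF V]])
    then have nb: "next_base n v vs" and set: "set vs = children n V v" by (auto simp: is_chlist_def)
    let ?Vs = "\<lambda>i. {w\<in>V. prefix (base n (vs ! i)) (base n w)}"
    note sp = visits_split[OF n v nb V set]
    have "J vs (restrict ?Vs {..<length vs}) = J vs ?Vs"
      by (simp add: J_def join_def[OF n v nb])
    then show "(case parts V of (vs, Vs) \<Rightarrow> J vs Vs) = V"
      using sp(2) unfolding parts_def vs_def[symmetric] by (simp add: J_def)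
    have "set vs \<subseteq> pos \<xi>" using set visitsD(1)[OF V] by (auto simp: children_def)
    then show "parts V \<in> Sigma S D"
      unfolding parts_def vs_def[symmetric] using sp(1) nb len by (simp add: S_def D_def vs_def[symmetric])
  qed
  also have "\<dots> = (\<Sum>V\<in>visits \<xi> n v. \<Prod>w\<in>V. ?W V w)"
  proof (rule sum.mono_neutral_left)
    show "\<forall>V\<in>visits \<xi> n v - {V\<in>visits \<xi> n v. length (chlist n V v) \<le> m}. (\<Prod>w\<in>V. ?W V w) = 0"
    proof
      fix V assume V: "V \<in> visits \<xi> n v - {V\<in>visits \<xi> n v. length (chlist n V v) \<le> m}"
      then show "(\<Prod>w\<in>V. ?W V w) = 0"
        using visits_finite[of V] visitsD(2)[of V] by (intro prod_eq_0[of _ v]) (auto simp: weight_def)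
    qed
  qed (auto simp: finite_visits)
  finally show ?case .
qed

section \<open>Definability and the formula for runs\<close>

lemma BMSO_boolean:
  fixes \<phi> :: "('f::finite, 's::{comm_semiring_0, comm_monoid_mult}, nat) mso"
  assumes "\<phi> \<in> BMSO rk"
  shows "sem \<phi> \<xi> \<rho> \<tau> = tv (sem \<phi> \<xi> \<rho> \<tau> = 1)"
  using assms
proof (induction arbitrary: \<rho> \<tau>)
  case (8 \<phi> \<psi>)
  from 8(3,4)[of \<rho> \<tau>] show ?case by (auto split: if_splits)
next
  case (9 \<phi> x)
  have "(\<Prod>v\<in>pos \<xi>. sem \<phi> \<xi> (\<rho>(x := v)) \<tau>) = (\<Prod>v\<in>pos \<xi>. tv (sem \<phi> \<xi> (\<rho>(x := v)) \<tau> = 1))"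
    by (rule prod.cong[OF refl]) (rule 9(2))
  then show ?case by (simp add: prod_tv finite_pos)
next
  case (10 \<phi> X)
  have "(\<Prod>V\<in>Pow (pos \<xi>). sem \<phi> \<xi> \<rho> (\<tau>(X := V))) = (\<Prod>V\<in>Pow (pos \<xi>). tv (sem \<phi> \<xi> \<rho> (\<tau>(X := V)) = 1))"
    by (rule prod.cong[OF refl]) (rule 10(2))
  then show ?case by (simp add: prod_tv finite_pos)
qed auto

lemma BFO_mod_subset_BMSO: "BFO_mod rk \<subseteq> BMSO rk"
proof
  fix \<phi> :: "('a, 'b, nat) mso"
  assume "\<phi> \<in> BFO_mod rk"
  then show "\<phi> \<in> BMSO rk"
    by induction (auto intro: BMSO.intros Mod_eq_in_BMSO)
qed

lemma step_mono: "L \<subseteq> L' \<Longrightarrow> step L \<subseteq> step L'"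
proof
  fix \<phi> assume "L \<subseteq> L'" "\<phi> \<in> step L"
  from this(2,1) show "\<phi> \<in> step L'"
    by induction (auto intro: step.intros)
qed

text \<open>A common interface of \<open>BFO_mod rk\<close> and \<open>BMSO rk\<close>, so that both
  constructions are carried out once. Closure under set quantifiers is not assumed;
  \<open>Mod_eq\<close> is a given atom.\<close>

locale fo_class =
  fixes rk :: "'f::finite \<Rightarrow> nat"
    and L :: "('f, 's::{comm_semiring_0, comm_monoid_mult}, nat) mso set"
  assumes Const_0: "Const 0 \<in> L"
    and Const_1: "Const 1 \<in> L"
    and Label: "Label f x \<in> L"
    and Edge: "1 \<le> i \<Longrightarrow> i \<le> maxrk rk \<Longrightarrow> Edge i x y \<in> L"
    and Le: "Le x y \<in> L"
    and In: "In x X \<in> L"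
    and Mod: "m < n \<Longrightarrow> Mod_eq rk n m x \<in> L"
    and Neg: "\<phi> \<in> L \<Longrightarrow> Neg \<phi> \<in> L"
    and And: "\<phi> \<in> L \<Longrightarrow> \<psi> \<in> L \<Longrightarrow> And \<phi> \<psi> \<in> L"
    and All1: "\<phi> \<in> L \<Longrightarrow> All1 x \<phi> \<in> L"
    and boolean: "\<phi> \<in> L \<Longrightarrow> sem \<phi> \<xi> \<rho> \<tau> = tv (sem \<phi> \<xi> \<rho> \<tau> = 1)"

lemma fo_class_BMSO: "fo_class rk (BMSO rk)"
proof unfold_locales
  show "sem \<phi> \<xi> \<rho> \<tau> = tv (sem \<phi> \<xi> \<rho> \<tau> = 1)" if "\<phi> \<in> BMSO rk" for \<phi> \<xi> \<rho> \<tau>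
    using that by (rule BMSO_boolean)
qed (auto intro: BMSO.intros Mod_eq_in_BMSO)

lemma fo_class_BFO_mod: "fo_class rk (BFO_mod rk)"
proof unfold_locales
  show "sem \<phi> \<xi> \<rho> \<tau> = tv (sem \<phi> \<xi> \<rho> \<tau> = 1)" if "\<phi> \<in> BFO_mod rk" for \<phi> \<xi> \<rho> \<tau>
    using that BFO_mod_subset_BMSO BMSO_boolean by blast
qed (auto intro: BFO_mod.intros)

context fo_class
begin

text \<open>Formulas are built through the properties that they define: closure rules for
  \<open>Def\<close> replace explicit syntax, and \<open>V\<close> and \<open>W\<close> keep track
  of the variables that may be free.\<close>

definition expresses :: "nat set \<Rightarrow> nat set \<Rightarrow> ('f, 's, nat) mso \<Rightarrow>
    ('f tree \<Rightarrow> (nat \<Rightarrow> nat list) \<Rightarrow> (nat \<Rightarrow> nat list set) \<Rightarrow> bool) \<Rightarrow> bool" where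
  "expresses V W \<phi> P \<longleftrightarrow> \<phi> \<in> L \<and> free1 \<phi> \<subseteq> V \<and> free2 \<phi> \<subseteq> W \<and>
    (\<forall>\<xi>\<in>trees rk. \<forall>\<rho> \<tau>. (\<forall>x. \<rho> x \<in> pos \<xi>) \<longrightarrow> sem \<phi> \<xi> \<rho> \<tau> = tv (P \<xi> \<rho> \<tau>))"

definition "Def V W P \<longleftrightarrow> (\<exists>\<phi>. expresses V W \<phi> P)"

lemma expressesD:
  assumes "expresses V W \<phi> P"
  shows "\<phi> \<in> L" "free1 \<phi> \<subseteq> V" "free2 \<phi> \<subseteq> W"
  using assms by (simp_all add: expresses_def)

lemma sem_expresses:
  "expresses V W \<phi> P \<Longrightarrow> \<xi> \<in> trees rk \<Longrightarrow> (\<And>x. \<rho> x \<in> pos \<xi>) \<Longrightarrow> sem \<phi> \<xi> \<rho> \<tau> = tv (P \<xi> \<rho> \<tau>)"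
  by (simp add: expresses_def)

lemma DefI:
  assumes "\<phi> \<in> L" "free1 \<phi> \<subseteq> V" "free2 \<phi> \<subseteq> W"
    "\<And>\<xi> \<rho> \<tau>. \<xi> \<in> trees rk \<Longrightarrow> (\<And>x. \<rho> x \<in> pos \<xi>) \<Longrightarrow> sem \<phi> \<xi> \<rho> \<tau> = tv (P \<xi> \<rho> \<tau>)"
  shows "Def V W P"
  using assms unfolding Def_def expresses_def by blast

lemma Def_cong:
  assumes "Def V W Q"
    and eq: "\<And>\<xi> \<rho> \<tau>. \<xi> \<in> trees rk \<Longrightarrow> (\<And>x. \<rho> x \<in> pos \<xi>) \<Longrightarrow> P \<xi> \<rho> \<tau> \<longleftrightarrow> Q \<xi> \<rho> \<tau>"
  shows "Def V W P"
proof -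
  obtain \<phi> where \<phi>: "expresses V W \<phi> Q" using assms(1) unfolding Def_def ..
  show ?thesis by (rule DefI[OF expressesD[OF \<phi>]]) (simp only: sem_expresses[OF \<phi>] eq)
qed

lemma Def_label: "x \<in> V \<Longrightarrow> Def V W (\<lambda>\<xi> \<rho> \<tau>. label_at \<xi> (\<rho> x) = f)"
  by (rule DefI[OF Label]) auto

lemma Def_edge:
  "x \<in> V \<Longrightarrow> y \<in> V \<Longrightarrow> 1 \<le> i \<Longrightarrow> i \<le> maxrk rk \<Longrightarrow> Def V W (\<lambda>\<xi> \<rho> \<tau>. \<rho> y = \<rho> x @ [i])"
  by (rule DefI[OF Edge]) auto

lemma Def_le: "x \<in> V \<Longrightarrow> y \<in> V \<Longrightarrow> Def V W (\<lambda>\<xi> \<rho> \<tau>. prefix (\<rho> x) (\<rho> y))"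
  by (rule DefI[OF Le]) auto

lemma Def_in: "x \<in> V \<Longrightarrow> X \<in> W \<Longrightarrow> Def V W (\<lambda>\<xi> \<rho> \<tau>. \<rho> x \<in> \<tau> X)"
  by (rule DefI[OF In]) auto

lemma Def_mod: "x \<in> V \<Longrightarrow> m < n \<Longrightarrow> Def V W (\<lambda>\<xi> \<rho> \<tau>. length (\<rho> x) mod n = m)"
proof (rule DefI[OF Mod])
  fix \<xi> and \<rho> :: "nat \<Rightarrow> nat list" and \<tau> assume "m < n" "\<xi> \<in> trees rk" "\<And>x. \<rho> x \<in> pos \<xi>"
  then show "sem (Mod_eq rk n m x) \<xi> \<rho> \<tau> = tv (length (\<rho> x) mod n = m)"
    by (intro sem_Mod_eq)
qed (simp_all add: free_Mod_eq)

lemma Def_const: "Def V W (\<lambda>\<xi> \<rho> \<tau>. P)"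
  using DefI[OF Const_0, of V W "\<lambda>_ _ _. P"] DefI[OF Const_1, of V W "\<lambda>_ _ _. P"] by (cases P) simp_all

lemma Def_not:
  assumes "Def V W P"
  shows "Def V W (\<lambda>\<xi> \<rho> \<tau>. \<not> P \<xi> \<rho> \<tau>)"
proof -
  obtain \<phi> where \<phi>: "expresses V W \<phi> P" using assms unfolding Def_def ..
  show ?thesis
    by (rule DefI[OF Neg[OF expressesD(1)[OF \<phi>]]])
      (use expressesD[OF \<phi>] in \<open>simp_all add: sem_expresses[OF \<phi>]\<close>)
qed

lemma Def_conj:
  assumes "Def V W P" "Def V W Q"
  shows "Def V W (\<lambda>\<xi> \<rho> \<tau>. P \<xi> \<rho> \<tau> \<and> Q \<xi> \<rho> \<tau>)"
proof -
  obtain \<phi> \<psi> where \<phi>: "expresses V W \<phi> P" and \<psi>: "expresses V W \<psi> Q"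
    using assms unfolding Def_def by blast
  show ?thesis
    by (rule DefI[OF And[OF expressesD(1)[OF \<phi>] expressesD(1)[OF \<psi>]]])
      (use expressesD[OF \<phi>] expressesD[OF \<psi>] in \<open>simp_all add: sem_expresses[OF \<phi>] sem_expresses[OF \<psi>]\<close>)
qed

lemma Def_disj: "Def V W P \<Longrightarrow> Def V W Q \<Longrightarrow> Def V W (\<lambda>\<xi> \<rho> \<tau>. P \<xi> \<rho> \<tau> \<or> Q \<xi> \<rho> \<tau>)"
  using Def_not[OF Def_conj[OF Def_not[of V W P] Def_not[of V W Q]]] by simp

lemma Def_imp: "Def V W P \<Longrightarrow> Def V W Q \<Longrightarrow> Def V W (\<lambda>\<xi> \<rho> \<tau>. P \<xi> \<rho> \<tau> \<longrightarrow> Q \<xi> \<rho> \<tau>)"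
  using Def_not[OF Def_conj[of V W P, OF _ Def_not[of V W Q]]] by simp

lemma Def_ball_fin:
  "finite I \<Longrightarrow> (\<And>i. i \<in> I \<Longrightarrow> Def V W (P i)) \<Longrightarrow> Def V W (\<lambda>\<xi> \<rho> \<tau>. \<forall>i\<in>I. P i \<xi> \<rho> \<tau>)"
proof (induction I rule: finite_induct)
  case empty
  then show ?case by (simp add: Def_const)
next
  case (insert i I)
  then show ?case by (simp add: Def_conj)
qed

lemma Def_bex_fin:
  "finite I \<Longrightarrow> (\<And>i. i \<in> I \<Longrightarrow> Def V W (P i)) \<Longrightarrow> Def V W (\<lambda>\<xi> \<rho> \<tau>. \<exists>i\<in>I. P i \<xi> \<rho> \<tau>)"
  using Def_not[OF Def_ball_fin[OF _ Def_not, of I V W P]] by simp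

lemma Def_all_upd:
  assumes "Def (insert x V) W P"
  shows "Def V W (\<lambda>\<xi> \<rho> \<tau>. \<forall>v\<in>pos \<xi>. P \<xi> (\<rho>(x := v)) \<tau>)"
proof -
  obtain \<phi> where \<phi>: "expresses (insert x V) W \<phi> P" using assms unfolding Def_def ..
  show ?thesis
    by (rule DefI[OF All1[OF expressesD(1)[OF \<phi>], of x]])
      (use expressesD[OF \<phi>] in \<open>auto simp: sem_expresses[OF \<phi>] prod_tv finite_pos cong: prod.cong\<close>)
qed

lemma Def_ex_upd:
  "Def (insert x V) W P \<Longrightarrow> Def V W (\<lambda>\<xi> \<rho> \<tau>. \<exists>v\<in>pos \<xi>. P \<xi> (\<rho>(x := v)) \<tau>)"
  using Def_not[OF Def_all_upd[OF Def_not, of x V W P]] by simp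

text \<open>The bound variable is some \<open>z\<close> outside \<open>V\<close>. The last
  assumption says that \<open>P\<close> ignores such variables, so overwriting \<open>z\<close> does
  no harm.\<close>

lemma Def_ex:
  assumes "finite V" "\<And>z. z \<notin> V \<Longrightarrow> Def (insert z V) W (\<lambda>\<xi> \<rho> \<tau>. P \<xi> \<rho> \<tau> (\<rho> z))"
    and "\<And>\<xi> \<rho> \<tau> z v u. z \<notin> V \<Longrightarrow> P \<xi> (\<rho>(z := v)) \<tau> u = P \<xi> \<rho> \<tau> u"
  shows "Def V W (\<lambda>\<xi> \<rho> \<tau>. \<exists>v\<in>pos \<xi>. P \<xi> \<rho> \<tau> v)"
proof -
  obtain z where z: "z \<notin> V" using assms(1) ex_new_if_finite infinite_UNIV_nat by blast
  show ?thesis using Def_ex_upd[OF assms(2)[OF z]] by (simp add: assms(3)[OF z])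
qed

lemma Def_all:
  assumes "finite V" "\<And>z. z \<notin> V \<Longrightarrow> Def (insert z V) W (\<lambda>\<xi> \<rho> \<tau>. P \<xi> \<rho> \<tau> (\<rho> z))"
    and "\<And>\<xi> \<rho> \<tau> z v u. z \<notin> V \<Longrightarrow> P \<xi> (\<rho>(z := v)) \<tau> u = P \<xi> \<rho> \<tau> u"
  shows "Def V W (\<lambda>\<xi> \<rho> \<tau>. \<forall>v\<in>pos \<xi>. P \<xi> \<rho> \<tau> v)"
proof -
  obtain z where z: "z \<notin> V" using assms(1) ex_new_if_finite infinite_UNIV_nat by blast
  show ?thesis using Def_all_upd[OF assms(2)[OF z]] by (simp add: assms(3)[OF z])
qed

lemma Def_ex_upds:
  "Def (V \<union> set xs) W P \<Longrightarrow>
    Def V W (\<lambda>\<xi> \<rho> \<tau>. \<exists>vs\<in>tuples (pos \<xi>) (length xs). P \<xi> (upds \<rho> xs vs) \<tau>)"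
proof (induction xs arbitrary: V)
  case (Cons x xs)
  have eq: "(\<exists>vs\<in>tuples A (Suc k). Q vs) \<longleftrightarrow> (\<exists>v\<in>A. \<exists>vs\<in>tuples A k. Q (v # vs))"
    for A :: "nat list set" and k Q
    by (fastforce simp: tuples_def length_Suc_conv)
  have "Def (insert x V) W (\<lambda>\<xi> \<rho> \<tau>. \<exists>vs\<in>tuples (pos \<xi>) (length xs). P \<xi> (upds \<rho> xs vs) \<tau>)"
    using Cons.prems by (intro Cons.IH) simp
  from Def_ex_upd[OF this] show ?case by (simp add: eq)
qed simp

lemma Def_eq: "x \<in> V \<Longrightarrow> y \<in> V \<Longrightarrow> Def V W (\<lambda>\<xi> \<rho> \<tau>. \<rho> x = \<rho> y)"
  by (rule Def_cong[OF Def_conj[OF Def_le Def_le, of x V y y x]]) (auto dest: prefix_order.antisym)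

lemmas Def_intros = Def_const Def_not Def_conj Def_disj Def_imp Def_label Def_edge Def_le Def_in Def_mod Def_eq

text \<open>The base is the longest prefix whose length is a multiple of \<open>n\<close>; this
  needs only the prefix order and one modulo predicate.\<close>

lemma base_iff:
  assumes n: "0 < n" and "u \<in> pos \<xi>" "v \<in> pos \<xi>"
  shows "u = base n v \<longleftrightarrow> prefix u v \<and> length u mod n = 0 \<and>
    (\<forall>w\<in>pos \<xi>. prefix w v \<and> length w mod n = 0 \<longrightarrow> prefix w u)"
proof
  assume u: "u = base n v"
  have "prefix w u" if "prefix w v" "length w mod n = 0" for w
  proof -
    have "length v - length v mod n = n * (length v div n)"
      by (simp add: minus_mod_eq_mult_div)
    moreover have "length w = n * (length w div n)" using that(2) by auto
    moreover have "length w div n \<le> length v div n"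
      by (intro div_le_mono prefix_length_le that)
    ultimately have "length w \<le> length u"
      using prefix_length_le[OF that(1)] u by (simp add: base_eq[OF n]) (metis mult_le_mono2)
    then show ?thesis using prefix_length_prefix[OF that(1) base_prefix[OF n]] u by blast
  qed
  then show "prefix u v \<and> length u mod n = 0 \<and>
    (\<forall>w\<in>pos \<xi>. prefix w v \<and> length w mod n = 0 \<longrightarrow> prefix w u)"
    using u base_prefix[OF n] dvd_length_base[OF n] by auto
next
  assume *: "prefix u v \<and> length u mod n = 0 \<and>
    (\<forall>w\<in>pos \<xi>. prefix w v \<and> length w mod n = 0 \<longrightarrow> prefix w u)"
  have "prefix (base n v) u"
    using * base_prefix[OF n] dvd_length_base[OF n] base_in_pos[OF n assms(3)] by auto
  then have le: "length (base n v) \<le> length u" by (rule prefix_length_le)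
  have "length v - length v mod n = n * (length v div n)"
    by (simp add: minus_mod_eq_mult_div)
  moreover have "length u = n * (length u div n)" using * by auto
  moreover have "length u div n \<le> length v div n"
    using * by (intro div_le_mono prefix_length_le) simp
  ultimately have "length u \<le> length (base n v)"
    using prefix_length_le[of u v] * by (simp add: base_eq[OF n]) (metis mult_le_mono2)
  then show "u = base n v"
    using le * base_prefix[OF n] by (intro prefix_same_length_eq[of u v]) auto
qed

lemma Def_base:
  assumes "x \<in> V" "y \<in> V" "finite V" "0 < n"
  shows "Def V W (\<lambda>\<xi> \<rho> \<tau>. \<rho> y = base n (\<rho> x))"
proof (rule Def_cong)
  show "Def V W (\<lambda>\<xi> \<rho> \<tau>. prefix (\<rho> y) (\<rho> x) \<and> length (\<rho> y) mod n = 0 \<and>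
    (\<forall>w\<in>pos \<xi>. prefix w (\<rho> x) \<and> length w mod n = 0 \<longrightarrow> prefix w (\<rho> y)))"
    by (intro Def_intros Def_all) (use assms in auto)
qed (use assms in \<open>simp add: base_iff\<close>)

text \<open>Being exactly \<open>n\<close> longer means being the next position on the path with
  length divisible by \<open>n\<close>, with none in between.\<close>

lemma par_iff:
  assumes n: "0 < n" and "v \<in> pos \<xi>" "v' \<in> pos \<xi>"
  shows "par n v v' \<longleftrightarrow> (\<exists>u\<in>pos \<xi>. \<exists>u'\<in>pos \<xi>. u = base n v \<and> u' = base n v' \<and> prefix u u' \<and> u \<noteq> u' \<and>
    (\<forall>w\<in>pos \<xi>. length w mod n = 0 \<and> prefix w u' \<and> w \<noteq> u' \<longrightarrow> prefix w u))"
proof -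
  define u u' where "u = base n v" and "u' = base n v'"
  have pos: "u \<in> pos \<xi>" "u' \<in> pos \<xi>" using base_in_pos[OF n] assms by (auto simp: u_def u'_def)
  have dvd: "n dvd length u" "n dvd length u'" by (simp_all add: u_def u'_def dvd_length_base n)
  have "prefix u u' \<and> length u' = length u + n \<longleftrightarrow> prefix u u' \<and> u \<noteq> u' \<and>
    (\<forall>w\<in>pos \<xi>. length w mod n = 0 \<and> prefix w u' \<and> w \<noteq> u' \<longrightarrow> prefix w u)"
  proof (intro iffI conjI ballI impI; (elim conjE)?)
    fix w assume u: "prefix u u'" "length u' = length u + n"
      and w: "length w mod n = 0" "prefix w u'" "w \<noteq> u'"
    have "length w < length u'"
      using w(2,3) by (metis le_neq_implies_less prefix_length_le prefix_order.order_refl prefix_same_length_eq)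
    moreover have "n dvd length u' - length w" using w(1) dvd(2) by (intro dvd_diff_nat) auto
    ultimately have "n \<le> length u' - length w" by (intro dvd_imp_le) auto
    then have "length w \<le> length u" using u(2) \<open>length w < length u'\<close> by simp
    then show "prefix w u" using u w by (intro prefix_length_prefix[of w u' u]) auto
  next
    assume u: "prefix u u'" "u \<noteq> u'"
      and w: "\<forall>w\<in>pos \<xi>. length w mod n = 0 \<and> prefix w u' \<and> w \<noteq> u' \<longrightarrow> prefix w u"
    have lt: "length u < length u'"
      using u by (metis le_neq_implies_less prefix_length_le prefix_order.order_refl prefix_same_length_eq)
    moreover have "n dvd length u' - length u" using dvd by (intro dvd_diff_nat)
    ultimately have le: "n \<le> length u' - length u" by (intro dvd_imp_le) auto
    \<comment> \<open>The prefix of \<open>u'\<close> that is \<open>n\<close> shorter. It must be a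
      prefix of \<open>u\<close>, so \<open>u'\<close> is at most \<open>n\<close> longer than
      \<open>u\<close>.\<close>
    define w where "w = take (length u' - n) u'"
    have "length w mod n = 0" using dvd(2) by (auto simp: w_def intro!: dvd_imp_mod_0 dvd_diff_nat)
    moreover have "w \<noteq> u'" using n lt by (auto simp: w_def)
    moreover have "w \<in> pos \<xi>" using pos(2) pos_prefix[of w "drop (length u' - n) u'" \<xi>] by (simp add: w_def)
    ultimately have "prefix w u" using bspec[OF w, of w] by (simp add: w_def take_is_prefix)
    then have "length u' - n \<le> length u" using prefix_length_le[of w u] by (simp add: w_def)
    then show "length u' = length u + n" using le lt by simp
  qed (use n in auto)
  then show ?thesis using pos unfolding par_def u_def u'_def by blast
qed

lemma Def_par:
  assumes "x \<in> V" "y \<in> V" "finite V" "0 < n"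
  shows "Def V W (\<lambda>\<xi> \<rho> \<tau>. par n (\<rho> x) (\<rho> y))"
proof (rule Def_cong)
  show "Def V W (\<lambda>\<xi> \<rho> \<tau>. \<exists>u\<in>pos \<xi>. \<exists>u'\<in>pos \<xi>. u = base n (\<rho> x) \<and> u' = base n (\<rho> y) \<and>
    prefix u u' \<and> u \<noteq> u' \<and> (\<forall>w\<in>pos \<xi>. length w mod n = 0 \<and> prefix w u' \<and> w \<noteq> u' \<longrightarrow> prefix w u))"
    by (intro Def_intros Def_ex Def_all Def_base) (use assms in auto)
qed (use assms in \<open>simp only: par_iff\<close>)

text \<open>Two bases are compared at the point \<open>z\<close> where they branch; the pair of
  directions ranges over a finite set. The case of a proper prefix is missing, as only bases of
  equal length will be compared.\<close>

definition lexless :: "nat \<Rightarrow> 'f tree \<Rightarrow> nat list \<Rightarrow> nat list \<Rightarrow> bool" where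
  "lexless n \<xi> v v' \<longleftrightarrow> (\<exists>z\<in>pos \<xi>. \<exists>z1\<in>pos \<xi>. \<exists>z2\<in>pos \<xi>. \<exists>b\<in>pos \<xi>. \<exists>b'\<in>pos \<xi>.
    (\<exists>p\<in>{p\<in>{1..maxrk rk} \<times> {1..maxrk rk}. fst p < snd p}. z1 = z @ [fst p] \<and> z2 = z @ [snd p]) \<and>
    b = base n v \<and> b' = base n v' \<and> prefix z1 b \<and> prefix z2 b')"

lemma Def_lexless:
  assumes "x \<in> V" "y \<in> V" "finite V" "0 < n"
  shows "Def V W (\<lambda>\<xi> \<rho> \<tau>. lexless n \<xi> (\<rho> x) (\<rho> y))"
  unfolding lexless_def
  by (intro Def_intros Def_ex Def_bex_fin Def_base) (use assms in auto)

lemma lexless_iff: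
  assumes n: "0 < n" and \<xi>: "\<xi> \<in> trees rk" and v: "v \<in> pos \<xi>" "v' \<in> pos \<xi>"
    and len: "length (base n v) = length (base n v')"
  shows "lexless n \<xi> v v' \<longleftrightarrow> base n v < base n v'"
proof
  assume "lexless n \<xi> v v'"
  then obtain z i j where "i < j" "prefix (z @ [i]) (base n v)" "prefix (z @ [j]) (base n v')"
    unfolding lexless_def by auto
  then obtain u u' where "base n v = z @ i # u" "base n v' = z @ j # u'" "i < j"
    by (auto simp: prefix_def)
  then show "base n v < base n v'" by (auto simp: list_less_def lexord_def)
next
  assume "base n v < base n v'"
  then obtain z i j u u' where *: "base n v = z @ i # u" "base n v' = z @ j # u'" "i < j"
    using len by (auto simp: list_less_def lexord_def)
  have pos: "z @ i # u \<in> pos \<xi>" "z @ j # u' \<in> pos \<xi>" using base_in_pos[OF n] v * by metis+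
  then have "z \<in> pos \<xi>" "z @ [i] \<in> pos \<xi>" "z @ [j] \<in> pos \<xi>"
    using pos_prefix[of z "i # u" \<xi>] pos_prefix[of "z @ [i]" u \<xi>] pos_prefix[of "z @ [j]" u' \<xi>] by simp_all
  moreover have "i \<in> {1..maxrk rk}" "j \<in> {1..maxrk rk}"
    using pos_bounds[OF \<xi> pos(1), of i] pos_bounds[OF \<xi> pos(2), of j] by auto
  moreover have "prefix (z @ [i]) (z @ i # u)" "prefix (z @ [j]) (z @ j # u')" by simp_all
  ultimately show "lexless n \<xi> v v'"
    unfolding lexless_def * using pos \<open>i < j\<close>
    by (intro bexI[of _ z] bexI[of _ "z @ [i]"] bexI[of _ "z @ [j]"] bexI[of _ "z @ i # u"] bexI[of _ "z @ j # u'"]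
        conjI bexI[of _ "(i, j)"]) auto
qed

text \<open>First-order counterpart of \<open>is_chlist\<close>, with the list stored in the
  variables \<open>1, ..., k\<close>.\<close>

definition chl :: "nat \<Rightarrow> nat \<Rightarrow> 'f tree \<Rightarrow> (nat \<Rightarrow> nat list) \<Rightarrow> (nat \<Rightarrow> nat list set) \<Rightarrow> bool" where
  "chl n k \<xi> \<rho> \<tau> \<longleftrightarrow> (\<forall>i\<in>{1..k}. \<rho> i \<in> \<tau> 0 \<and> par n (\<rho> 0) (\<rho> i)) \<and>
    (\<forall>p\<in>{p\<in>{1..k} \<times> {1..k}. fst p < snd p}. lexless n \<xi> (\<rho> (fst p)) (\<rho> (snd p))) \<and>
    (\<forall>w\<in>pos \<xi>. w \<in> \<tau> 0 \<and> par n (\<rho> 0) w \<longrightarrow> (\<exists>i\<in>{1..k}. w = \<rho> i))"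

lemma Def_chl: "0 < n \<Longrightarrow> Def {0..k} {0} (chl n k)"
  unfolding chl_def
  by (intro Def_intros Def_ball_fin Def_bex_fin Def_all Def_par Def_lexless) auto

lemma chl_iff:
  assumes n: "0 < n" and \<xi>: "\<xi> \<in> trees rk" and \<rho>: "\<And>x. \<rho> x \<in> pos \<xi>"
  shows "chl n k \<xi> \<rho> \<tau> \<longleftrightarrow> is_chlist n (\<tau> 0 \<inter> pos \<xi>) (\<rho> 0) (map \<rho> [1..<Suc k])"
proof -
  have idx: "set [1..<Suc k] = {1..k}" by auto
  have sorted: "sorted_wrt (<) (map (base n) (map \<rho> [1..<Suc k])) \<longleftrightarrow>
      (\<forall>p\<in>{p\<in>{1..k} \<times> {1..k}. fst p < snd p}. base n (\<rho> (fst p)) < base n (\<rho> (snd p)))"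
  proof -
    have "sorted_wrt (<) (map (base n) (map \<rho> [1..<Suc k])) \<longleftrightarrow>
        (\<forall>i j. i < j \<longrightarrow> j < k \<longrightarrow> base n (\<rho> (Suc i)) < base n (\<rho> (Suc j)))"
      by (simp add: sorted_wrt_iff_nth_less del: upt_Suc)
    also have "\<dots> \<longleftrightarrow> (\<forall>i\<in>{1..k}. \<forall>j\<in>{1..k}. i < j \<longrightarrow> base n (\<rho> i) < base n (\<rho> j))"
    proof (intro iffI ballI allI impI)
      fix i j assume *: "\<forall>i j. i < j \<longrightarrow> j < k \<longrightarrow> base n (\<rho> (Suc i)) < base n (\<rho> (Suc j))"
        and "i \<in> {1..k}" "j \<in> {1..k}" "i < j"
      then show "base n (\<rho> i) < base n (\<rho> j)"
        using *[rule_format, of "i - 1" "j - 1"] by simp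
    qed simp
    finally show ?thesis by auto
  qed
  have lex: "(\<forall>p\<in>{p\<in>{1..k} \<times> {1..k}. fst p < snd p}. lexless n \<xi> (\<rho> (fst p)) (\<rho> (snd p))) \<longleftrightarrow>
      (\<forall>p\<in>{p\<in>{1..k} \<times> {1..k}. fst p < snd p}. base n (\<rho> (fst p)) < base n (\<rho> (snd p)))"
    if "\<forall>i\<in>{1..k}. par n (\<rho> 0) (\<rho> i)"
    using that by (intro ball_cong refl lexless_iff[OF n \<xi> \<rho> \<rho>]) (auto simp: par_def)
  show ?thesis
    unfolding chl_def is_chlist_def next_base_iff sorted children_def set_map idx
    using lex \<rho> by auto
qed

lemma upds_upt:
  assumes "us \<in> tuples A k"
  shows "map (upds \<rho> [1..<Suc k] us) [1..<Suc k] = us" "upds \<rho> [1..<Suc k] us 0 = \<rho> 0"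
    "(\<And>x. \<rho> x \<in> A) \<Longrightarrow> upds \<rho> [1..<Suc k] us x \<in> A"
proof -
  let ?xs = "[1..<Suc k]"
  have len: "length ?xs = length us" using assms by (simp add: tuples_def)
  show map: "map (upds \<rho> ?xs us) ?xs = us"
    using upds_nth[of ?xs us _ \<rho>] len by (intro nth_equalityI) (simp_all del: upt_Suc)
  show "upds \<rho> ?xs us 0 = \<rho> 0" by (rule upds_notin) simp
  show "upds \<rho> ?xs us x \<in> A" if \<rho>: "\<And>x. \<rho> x \<in> A"
  proof (cases "x \<in> set ?xs")
    case True
    then have "upds \<rho> ?xs us x \<in> set (map (upds \<rho> ?xs us) ?xs)" unfolding set_map by (rule imageI)
    then show ?thesis using assms unfolding map tuples_def by blast
  qed (simp add: upds_notin \<rho> del: upt_Suc)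
qed

lemma chl_upds:
  assumes n: "0 < n" and \<xi>: "\<xi> \<in> trees rk" and \<rho>: "\<And>x. \<rho> x \<in> pos \<xi>" and us: "us \<in> tuples (pos \<xi>) k"
  shows "chl n k \<xi> (upds \<rho> [1..<Suc k] us) \<tau> \<longleftrightarrow> is_chlist n (\<tau> 0 \<inter> pos \<xi>) (\<rho> 0) us"
  unfolding chl_iff[OF n \<xi> upds_upt(3)[OF us \<rho>]] upds_upt(1,2)[OF us] ..

text \<open>\<open>\<phi>'\<close> has only the position and the set as free variables and finds the
  remaining arguments of \<open>\<phi>\<close> as the list of children. Its value matters only when
  there are exactly \<open>k\<close> of them.\<close>

definition step_at_children :: "nat \<Rightarrow> nat \<Rightarrow> ('f, 's, nat) mso \<Rightarrow> ('f, 's, nat) mso \<Rightarrow> bool" where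
  "step_at_children n k \<phi> \<phi>' \<longleftrightarrow> \<phi>' \<in> step L \<and> free1 \<phi>' \<subseteq> {0} \<and> free2 \<phi>' \<subseteq> {0} \<and>
    (\<forall>\<xi>\<in>trees rk. \<forall>\<rho> \<tau> vs. (\<forall>x. \<rho> x \<in> pos \<xi>) \<longrightarrow> inj_on (base n) (\<tau> 0 \<inter> pos \<xi>) \<longrightarrow>
      vs \<in> tuples (pos \<xi>) k \<longrightarrow> is_chlist n (\<tau> 0 \<inter> pos \<xi>) (\<rho> 0) vs \<longrightarrow>
      sem \<phi>' \<xi> \<rho> \<tau> = sem \<phi> \<xi> (assign (\<rho> 0) vs) (\<lambda>_. {}))"

text \<open>
  Weighted quantifiers are not available in step formulas. As the list of children is unique, its
  elements can be introduced by Boolean quantifiers at each atom \<open>\<alpha> \<in> L\<close> separately.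
\<close>

lemma step_at_children_exists:
  assumes n: "0 < n" and "\<phi> \<in> step L" "free1 \<phi> \<subseteq> {0..k}" "free2 \<phi> = {}"
  shows "\<exists>\<phi>'. step_at_children n k \<phi> \<phi>'"
  using assms(2-4)
proof induction
  case (1 a)
  show ?case by (rule exI[of _ "Const a"]) (simp add: step_at_children_def step.intros)
next
  case (2 \<alpha>)
  let ?P = "\<lambda>\<xi> \<rho> \<tau>. sem \<alpha> \<xi> \<rho> \<tau> = 1"
  let ?xs = "[1..<Suc k]"
  have "Def {0..k} {0} ?P"
    by (rule DefI[OF 2(1)]) (use 2 boolean[OF 2(1)] in auto)
  moreover have "{0} \<union> set ?xs = {0..k}" by auto
  ultimately have "Def ({0} \<union> set ?xs) {0} (\<lambda>\<xi> \<rho> \<tau>. chl n k \<xi> \<rho> \<tau> \<and> ?P \<xi> \<rho> \<tau>)"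
    by (simp only:) (intro Def_conj Def_chl n)
  from Def_ex_upds[OF this] obtain \<alpha>' where \<alpha>': "expresses {0} {0} \<alpha>' (\<lambda>\<xi> \<rho> \<tau>.
      \<exists>vs\<in>tuples (pos \<xi>) (length ?xs). chl n k \<xi> (upds \<rho> ?xs vs) \<tau> \<and> ?P \<xi> (upds \<rho> ?xs vs) \<tau>)"
    unfolding Def_def ..
  have "sem \<alpha>' \<xi> \<rho> \<tau> = sem \<alpha> \<xi> (assign (\<rho> 0) vs) (\<lambda>_. {})"
    if \<xi>: "\<xi> \<in> trees rk" and \<rho>: "\<forall>x. \<rho> x \<in> pos \<xi>" and inj: "inj_on (base n) (\<tau> 0 \<inter> pos \<xi>)"
      and vs: "vs \<in> tuples (pos \<xi>) k" and ch: "is_chlist n (\<tau> 0 \<inter> pos \<xi>) (\<rho> 0) vs" for \<xi> \<rho> \<tau> vs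
  proof -
    \<comment> \<open>Uniqueness of the list of children leaves \<open>vs\<close> as the only
      witness of the existential quantifiers.\<close>
    have chl: "chl n k \<xi> (upds \<rho> ?xs us) \<tau> \<longleftrightarrow> us = vs" if "us \<in> tuples (pos \<xi>) k" for us
      unfolding chl_upds[OF n \<xi> spec[OF \<rho>] that] using is_chlist_unique[OF inj] ch by blast
    have "length ?xs = k" by simp
    then have "(\<exists>us\<in>tuples (pos \<xi>) (length ?xs). chl n k \<xi> (upds \<rho> ?xs us) \<tau> \<and> ?P \<xi> (upds \<rho> ?xs us) \<tau>) \<longleftrightarrow>
        ?P \<xi> (upds \<rho> ?xs vs) \<tau>"
      using chl vs by (simp only:) blast
    then have "sem \<alpha>' \<xi> \<rho> \<tau> = tv (?P \<xi> (upds \<rho> ?xs vs) \<tau>)"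
      using sem_expresses[OF \<alpha>' \<xi>, of \<rho> \<tau>] \<rho> by (simp only:)
    also have "\<dots> = sem \<alpha> \<xi> (upds \<rho> ?xs vs) \<tau>"
      by (rule boolean[OF 2(1), symmetric])
    also have "\<dots> = sem \<alpha> \<xi> (assign (\<rho> 0) vs) (\<lambda>_. {})"
    proof (rule sem_cong_free)
      fix j assume "j \<in> free1 \<alpha>"
      then have "j \<le> k" using 2(2) by auto
      have "upds \<rho> ?xs vs (Suc i) = vs ! i" if "i < k" for i
        using arg_cong[OF upds_upt(1)[OF vs], of "\<lambda>l. l ! i"] that by (simp del: upt_Suc)
      then show "upds \<rho> ?xs vs j = assign (\<rho> 0) vs j"
        using upds_upt(2)[OF vs] \<open>j \<le> k\<close> vs by (cases j) (simp_all add: assign_def tuples_def del: upt_Suc)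
    qed (use 2(3) in simp)
    finally show ?thesis .
  qed
  then show ?case
    using expressesD[OF \<alpha>'] step.intros(2)[OF expressesD(1)[OF \<alpha>']] unfolding step_at_children_def by blast
next
  case (3 \<phi>)
  then obtain \<phi>' where "step_at_children n k \<phi> \<phi>'" by auto
  then show ?case by (intro exI[of _ "Neg \<phi>'"]) (simp add: step_at_children_def step.intros)
next
  case (4 \<phi> \<psi>)
  then obtain \<phi>' \<psi>' where "step_at_children n k \<phi> \<phi>'" "step_at_children n k \<psi> \<psi>'" by auto
  then show ?case by (intro exI[of _ "Or \<phi>' \<psi>'"]) (simp add: step_at_children_def step.intros)
next
  case (5 \<phi> \<psi>)
  then obtain \<phi>' \<psi>' where "step_at_children n k \<phi> \<phi>'" "step_at_children n k \<psi> \<psi>'" by auto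
  then show ?case by (intro exI[of _ "And \<phi>' \<psi>'"]) (simp add: step_at_children_def step.intros)
qed

text \<open>The start is described as the position that is a prefix of all others. Its base is
  \<open>[]\<close>, so the clause that all bases extend it holds automatically.\<close>

lemma Def_visits:
  assumes n: "0 < n"
  shows "Def {} {0} (\<lambda>\<xi> \<rho> \<tau>. \<tau> 0 \<inter> pos \<xi> \<in> visits \<xi> n [])"
proof (rule Def_cong)
  show "Def {} {0} (\<lambda>\<xi> \<rho> \<tau>. (\<exists>w\<in>pos \<xi>. w \<in> \<tau> 0 \<and> (\<forall>u\<in>pos \<xi>. prefix w u)) \<and>
    (\<forall>w\<in>pos \<xi>. \<forall>w'\<in>pos \<xi>. w \<in> \<tau> 0 \<and> w' \<in> \<tau> 0 \<and> (\<exists>b\<in>pos \<xi>. b = base n w \<and> b = base n w') \<longrightarrow> w = w') \<and>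
    (\<forall>w\<in>pos \<xi>. w \<in> \<tau> 0 \<longrightarrow> (\<forall>u\<in>pos \<xi>. prefix w u) \<or> (\<exists>w'\<in>pos \<xi>. w' \<in> \<tau> 0 \<and> par n w' w)))"
    by (intro Def_intros Def_ex Def_all Def_base Def_par) (use n in auto)
next
  fix \<xi> \<rho> and \<tau> :: "nat \<Rightarrow> nat list set"
  have root: "(\<forall>u\<in>pos \<xi>. prefix w u) \<longleftrightarrow> w = []" for w
    using Nil_in_pos[of \<xi>] by auto
  have b: "(\<exists>b\<in>pos \<xi>. b = base n w \<and> b = base n w') \<longleftrightarrow> base n w = base n w'" if "w \<in> pos \<xi>" for w w'
    using base_in_pos[OF n that] by auto
  have nil: "base n [] = []" by (simp add: base_eq[OF n])
  show "\<tau> 0 \<inter> pos \<xi> \<in> visits \<xi> n [] \<longleftrightarrow> (\<exists>w\<in>pos \<xi>. w \<in> \<tau> 0 \<and> (\<forall>u\<in>pos \<xi>. prefix w u)) \<and>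
    (\<forall>w\<in>pos \<xi>. \<forall>w'\<in>pos \<xi>. w \<in> \<tau> 0 \<and> w' \<in> \<tau> 0 \<and> (\<exists>b\<in>pos \<xi>. b = base n w \<and> b = base n w') \<longrightarrow> w = w') \<and>
    (\<forall>w\<in>pos \<xi>. w \<in> \<tau> 0 \<longrightarrow> (\<forall>u\<in>pos \<xi>. prefix w u) \<or> (\<exists>w'\<in>pos \<xi>. w' \<in> \<tau> 0 \<and> par n w' w))"
    unfolding visits_def root using Nil_in_pos[of \<xi>] b by (auto simp: nil inj_on_def)
qed

lemma Disj_in_step: "set \<phi>s \<subseteq> step L \<Longrightarrow> Disj \<phi>s \<in> step L"
  by (induction \<phi>s) (auto simp: Disj_def intro: step.intros)

lemma free_Disj: "free1 (Disj \<phi>s) = (\<Union>\<phi>\<in>set \<phi>s. free1 \<phi>)" "free2 (Disj \<phi>s) = (\<Union>\<phi>\<in>set \<phi>s. free2 \<phi>)"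
  by (induction \<phi>s) (auto simp: Disj_def)

theorem BTC_definable_imp_EA_definable:
  assumes "BTC_definable rk (step L) r"
  shows "definable rk (EA (step L)) r"
proof -
  obtain m n \<Phi> where n: "0 < n" and fam: "is_family (step L) m \<Phi>" and prog: "progressing rk n m \<Phi>"
    and r: "\<And>\<xi>. \<xi> \<in> trees rk \<Longrightarrow> r \<xi> = BTC_sem m \<Phi> \<xi> []"
    using assms unfolding BTC_definable_def by blast
  have "\<forall>k. \<exists>\<phi>'. k \<le> m \<longrightarrow> step_at_children n k (\<Phi> k) \<phi>'"
    using step_at_children_exists[OF n] fam unfolding is_family_def by metis
  from choice[OF this] obtain \<Psi> where \<Psi>0: "\<And>k. k \<le> m \<Longrightarrow> step_at_children n k (\<Phi> k) (\<Psi> k)"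
    by blast
  have \<Psi>: "\<Psi> k \<in> step L" "free1 (\<Psi> k) \<subseteq> {0}" "free2 (\<Psi> k) \<subseteq> {0}" if "k \<le> m" for k
    using \<Psi>0[OF that] unfolding step_at_children_def by blast+
  have sem_\<Psi>: "sem (\<Psi> k) \<xi> \<rho> \<tau> = sem (\<Phi> k) \<xi> (assign (\<rho> 0) vs) (\<lambda>_. {})"
    if "k \<le> m" "\<xi> \<in> trees rk" "\<And>x. \<rho> x \<in> pos \<xi>" "inj_on (base n) (\<tau> 0 \<inter> pos \<xi>)"
      "vs \<in> tuples (pos \<xi>) k" "is_chlist n (\<tau> 0 \<inter> pos \<xi>) (\<rho> 0) vs" for k \<xi> \<rho> \<tau> vs
    using \<Psi>0[OF that(1)] that(2-) unfolding step_at_children_def by blast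
  have "Def {0} {0} (\<lambda>\<xi> \<rho> \<tau>. \<exists>vs\<in>tuples (pos \<xi>) (length [1..<Suc k]). chl n k \<xi> (upds \<rho> [1..<Suc k] vs) \<tau>)" for k
  proof -
    have "{0..k} = {0} \<union> set [1..<Suc k]" by auto
    then show ?thesis using Def_chl[OF n, of k] by (intro Def_ex_upds) (simp only:)
  qed
  then have "\<forall>k. \<exists>g. expresses {0} {0} g
      (\<lambda>\<xi> \<rho> \<tau>. \<exists>vs\<in>tuples (pos \<xi>) (length [1..<Suc k]). chl n k \<xi> (upds \<rho> [1..<Suc k] vs) \<tau>)"
    unfolding Def_def by blast
  from choice[OF this] obtain G where G0: "\<And>k. expresses {0} {0} (G k)
      (\<lambda>\<xi> \<rho> \<tau>. \<exists>vs\<in>tuples (pos \<xi>) (length [1..<Suc k]). chl n k \<xi> (upds \<rho> [1..<Suc k] vs) \<tau>)"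
    by blast
  note G = expressesD[OF G0]
  have sem_G: "sem (G k) \<xi> \<rho> \<tau> = tv (\<exists>vs\<in>tuples (pos \<xi>) k. is_chlist n (\<tau> 0 \<inter> pos \<xi>) (\<rho> 0) vs)"
    if \<xi>: "\<xi> \<in> trees rk" and \<rho>: "\<And>x. \<rho> x \<in> pos \<xi>" for k \<xi> \<rho> \<tau>
  proof -
    have "length [1..<Suc k] = k" by simp
    then show ?thesis
      using sem_expresses[OF G0[of k] \<xi>, of \<rho> \<tau>] chl_upds[OF n \<xi> \<rho>] \<rho> by (simp only: cong: bex_cong)
  qed
  obtain wf where wf0: "expresses {} {0} wf (\<lambda>\<xi> \<rho> \<tau>. \<tau> 0 \<inter> pos \<xi> \<in> visits \<xi> n [])"
    using Def_visits[OF n] unfolding Def_def ..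
  note wf = expressesD[OF wf0] sem_expresses[OF wf0]
  \<comment> \<open>For \<open>x\<close> in \<open>X\<close>, \<open>G k\<close> holds only for the
    actual number of children, so at most the summand with the weight of \<open>x\<close> survives;
    outside \<open>X\<close> the factor is 1. The check \<open>wf\<close> is repeated at every
    position, which is harmless as its value is 0 or 1.\<close>
  define \<theta> where "\<theta> = And wf (Or (And (In 0 0) (Disj (map (\<lambda>k. And (G k) (\<Psi> k)) [0..<Suc m]))) (Neg (In 0 0)))"
  have disjunct: "\<phi> \<in> step L \<and> free1 \<phi> \<subseteq> {0} \<and> free2 \<phi> \<subseteq> {0}"
    if "\<phi> \<in> set (map (\<lambda>k. And (G k) (\<Psi> k)) [0..<Suc m])" for \<phi>
  proof -
    from that obtain k where "\<phi> = And (G k) (\<Psi> k)" "k \<le> m" by (auto simp: less_Suc_eq_le simp del: upt_Suc)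
    then show ?thesis using G \<Psi> by (simp add: step.intros)
  qed
  then have D: "Disj (map (\<lambda>k. And (G k) (\<Psi> k)) [0..<Suc m]) \<in> step L"
    by (intro Disj_in_step) blast
  have "\<theta> \<in> step L"
    unfolding \<theta>_def
    by (rule step.intros(5)[OF step.intros(2)[OF wf(1)] step.intros(4)[OF step.intros(5)[OF step.intros(2)[OF In] D]
          step.intros(3)[OF step.intros(2)[OF In]]]])
  moreover have "free1 (Disj (map (\<lambda>k. And (G k) (\<Psi> k)) [0..<Suc m])) \<subseteq> {0}"
    "free2 (Disj (map (\<lambda>k. And (G k) (\<Psi> k)) [0..<Suc m])) \<subseteq> {0}"
    unfolding free_Disj using disjunct by blast+
  then have "free1 \<theta> \<subseteq> {0}" "free2 \<theta> \<subseteq> {0}"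
    using wf(2,3) by (simp_all add: \<theta>_def del: upt_Suc)
  ultimately have EA: "Ex2 0 (All1 0 \<theta>) \<in> EA (step L)" "free1 (Ex2 0 (All1 0 \<theta>)) = {}" "free2 (Ex2 0 (All1 0 \<theta>)) = {}"
    unfolding EA_def by auto
  have "r \<xi> = sem (Ex2 0 (All1 0 \<theta>)) \<xi> (\<lambda>_. []) (\<lambda>_. {})" if \<xi>: "\<xi> \<in> trees rk" for \<xi>
  proof -
    let ?F = "\<lambda>v vs. sem (\<Phi> (length vs)) \<xi> (assign v vs) (\<lambda>_. {})"
    have prod: "(\<Prod>x\<in>pos \<xi>. sem \<theta> \<xi> ((\<lambda>_. [])(0 := x)) ((\<lambda>_. {})(0 := V))) =
        (if V \<in> visits \<xi> n [] then \<Prod>w\<in>V. weight m ?F n V w else 0)" if V: "V \<in> Pow (pos \<xi>)" for V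
    proof -
      have VI: "V \<inter> pos \<xi> = V" using V by blast
      let ?r = "\<lambda>x. (\<lambda>_. [])(0 := x)" and ?t = "(\<lambda>_. {})(0 := V)"
      have valid: "?r x y \<in> pos \<xi>" if "x \<in> pos \<xi>" for x and y :: nat
        using that Nil_in_pos[of \<xi>] by simp
      have sem_theta: "sem \<theta> \<xi> (?r x) ?t = tv (V \<in> visits \<xi> n []) * (if x \<in> V then
          \<Sum>k\<in>{0..<Suc m}. tv (\<exists>vs\<in>tuples (pos \<xi>) k. is_chlist n V x vs) * sem (\<Psi> k) \<xi> (?r x) ?t else 1)"
        if x: "x \<in> pos \<xi>" for x
        unfolding \<theta>_def sem.simps sem_Disj_map[OF distinct_upt] set_upt wf(4)[OF \<xi> valid[OF x]]
          sem_G[OF \<xi> valid[OF x]] by (simp add: VI)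
      show ?thesis
      proof (cases "V \<in> visits \<xi> n []")
        case True
        have fin: "finite V" and inj: "inj_on (base n) V"
          using visits_finite[OF True] visitsD(4)[OF True] by auto
        have w: "(\<Sum>k\<in>{0..<Suc m}. tv (\<exists>vs\<in>tuples (pos \<xi>) k. is_chlist n V x vs) * sem (\<Psi> k) \<xi> (?r x) ?t) =
            weight m ?F n V x" if x: "x \<in> V" for x
        proof -
          define vs where "vs = chlist n V x"
          have ch: "is_chlist n V x vs" unfolding vs_def by (rule chlist[OF inj fin])
          have vs: "vs \<in> tuples (pos \<xi>) (length vs)"
            using ch V by (auto simp: tuples_def is_chlist_def children_def)
          have "(\<exists>us\<in>tuples (pos \<xi>) k. is_chlist n V x us) \<longleftrightarrow> k = length vs" for k
          proof
            assume "\<exists>us\<in>tuples (pos \<xi>) k. is_chlist n V x us"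
            then obtain us where us: "us \<in> tuples (pos \<xi>) k" "is_chlist n V x us" by blast
            then show "k = length vs" using is_chlist_unique[OF inj ch us(2)] by (simp add: tuples_def)
          next
            assume "k = length vs"
            then show "\<exists>us\<in>tuples (pos \<xi>) k. is_chlist n V x us" using ch vs by blast
          qed
          then have "(\<Sum>k\<in>{0..<Suc m}. tv (\<exists>vs\<in>tuples (pos \<xi>) k. is_chlist n V x vs) * sem (\<Psi> k) \<xi> (?r x) ?t) =
              tv (length vs \<in> {0..<Suc m}) * sem (\<Psi> (length vs)) \<xi> (?r x) ?t"
            by (simp only: sum_tv finite_atLeastLessThan)
          also have "\<dots> = weight m ?F n V x"
            using sem_\<Psi>[of "length vs" \<xi> "?r x" ?t vs, OF _ \<xi> valid] ch vs inj x V
            by (auto simp: weight_def VI vs_def[symmetric] less_Suc_eq_le)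
          finally show ?thesis .
        qed
        have "(\<Prod>x\<in>pos \<xi>. sem \<theta> \<xi> (?r x) ?t) = (\<Prod>x\<in>pos \<xi>. if x \<in> V then weight m ?F n V x else 1)"
          by (rule prod.cong[OF refl]) (simp add: sem_theta True w del: sum.op_ivl_Suc)
        also have "\<dots> = (\<Prod>x\<in>V. weight m ?F n V x)"
          using prod.inter_restrict[OF finite_pos, of "weight m ?F n V" \<xi> V] by (simp add: Int_commute VI)
        finally show ?thesis using True by simp
      next
        case False
        \<comment> \<open>One factor 0 annihilates the product, and the root always provides
          one.\<close>
        have "(\<Prod>x\<in>pos \<xi>. sem \<theta> \<xi> (?r x) ?t) = 0"
          by (rule prod_eq_0[OF finite_pos Nil_in_pos]) (simp only: sem_theta[OF Nil_in_pos], simp add: False)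
        then show ?thesis using False by simp
      qed
    qed
    have "sem (Ex2 0 (All1 0 \<theta>)) \<xi> (\<lambda>_. []) (\<lambda>_. {}) =
        (\<Sum>V\<in>Pow (pos \<xi>). if V \<in> visits \<xi> n [] then \<Prod>w\<in>V. weight m ?F n V w else 0)"
      unfolding sem.simps by (rule sum.cong[OF refl]) (rule prod)
    also have "\<dots> = (\<Sum>V\<in>Pow (pos \<xi>) \<inter> visits \<xi> n []. \<Prod>w\<in>V. weight m ?F n V w)"
      by (rule sum.inter_restrict[symmetric]) (simp add: finite_pos)
    also have "Pow (pos \<xi>) \<inter> visits \<xi> n [] = visits \<xi> n []" by (auto simp: visits_def)
    also have "(\<Sum>V\<in>visits \<xi> n []. \<Prod>w\<in>V. weight m ?F n V w) = BTC_sem m \<Phi> \<xi> []"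
    proof (rule visits_fixpoint[OF n, symmetric])
      fix v assume v: "v \<in> pos \<xi>"
      show "BTC_sem m \<Phi> \<xi> v = (\<Sum>k\<le>m. \<Sum>vs\<in>tuples (pos \<xi>) k. ?F v vs * (\<Prod>i<k. BTC_sem m \<Phi> \<xi> (vs ! i)))"
        unfolding BTC_sem_fixpoint[OF n fam prog \<xi> v]
        by (intro sum.cong refl) (simp add: tuples_def)
    qed (use prog \<xi> in \<open>auto simp: progressing_def Nil_in_pos\<close>)
    finally show ?thesis using r[OF \<xi>] by simp
  qed
  then show ?thesis unfolding definable_def using EA by blast
qed

end

section \<open>Cutting a run of an automaton at the next base positions\<close>

fun subtree :: "'f tree \<Rightarrow> nat list \<Rightarrow> 'f tree" where
  "subtree t [] = t"
| "subtree (Node f ts) (i # w) = subtree (ts ! (i - 1)) w"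

lemma subtree_append: "subtree t (u @ w) = subtree (subtree t u) w"
  by (induction t u rule: subtree.induct) simp_all

lemma append_in_pos_iff: "u \<in> pos t \<Longrightarrow> u @ w \<in> pos t \<longleftrightarrow> w \<in> pos (subtree t u)"
  by (induction t u rule: subtree.induct) (simp_all add: Cons_in_pos_Node)

lemma label_at_append: "u \<in> pos t \<Longrightarrow> label_at t (u @ w) = label_at (subtree t u) w"
  by (induction t u rule: subtree.induct) (simp_all add: Cons_in_pos_Node)

text \<open>Equality down to depth \<open>M - 1\<close>; this makes precise that something depends
  on a bounded part of the tree.\<close>

definition agree :: "nat \<Rightarrow> 'f tree \<Rightarrow> 'f tree \<Rightarrow> bool" where
  "agree M t t' \<longleftrightarrow> (\<forall>w. length w < M \<longrightarrow>
    (w \<in> pos t \<longleftrightarrow> w \<in> pos t') \<and> (w \<in> pos t \<longrightarrow> label_at t w = label_at t' w))"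

lemma agree_pos: "agree M t t' \<Longrightarrow> length w < M \<Longrightarrow> w \<in> pos t \<longleftrightarrow> w \<in> pos t'"
  by (simp add: agree_def)

lemma agree_subtree:
  assumes "agree (length u + M) t t'" "u \<in> pos t" "0 < M"
  shows "agree M (subtree t u) (subtree t' u)"
proof -
  have "u \<in> pos t'" using assms by (simp add: agree_def)
  then show ?thesis
    using assms unfolding agree_def
    by (simp add: append_in_pos_iff[symmetric] label_at_append[symmetric])
qed

lemma agree_Node:
  assumes "agree (Suc M) (Node f ts) (Node f' ts')" "0 < M"
  shows "f = f'" "length ts = length ts'" "\<And>i. i < length ts \<Longrightarrow> agree M (ts ! i) (ts' ! i)"
proof -
  show "f = f'" using assms(1)[unfolded agree_def, rule_format, of "[]"] by (simp add: Nil_in_pos)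
  have "i < length ts \<longleftrightarrow> i < length ts'" for i
    using agree_pos[OF assms(1), of "[Suc i]"] assms(2) by (simp add: Suc_Cons_in_pos_Node Nil_in_pos)
  then show "length ts = length ts'" by (metis linorder_neqE_nat less_irrefl)
  show "agree M (ts ! i) (ts' ! i)" if "i < length ts" for i
    using agree_subtree[of "[Suc i]" M "Node f ts" "Node f' ts'"] assms that
    by (simp add: Suc_Cons_in_pos_Node Nil_in_pos)
qed

text \<open>The comparison reaches one level below the deepest positions of \<open>t\<close>, so it
  also sees that \<open>t'\<close> has no further children.\<close>

lemma agree_eq:
  "agree M t t' \<Longrightarrow> (\<And>w. w \<in> pos t \<Longrightarrow> Suc (length w) < M) \<Longrightarrow> t = t'"
proof (induction t arbitrary: t' M)
  case (Node f ts)
  obtain f' ts' where t': "t' = Node f' ts'" by (cases t')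
  have "1 < M" using Node.prems(2)[OF Nil_in_pos] by simp
  then obtain M' where M: "M = Suc M'" "0 < M'" by (cases M) auto
  note a = agree_Node[OF Node.prems(1)[unfolded M t'] M(2)]
  have "ts ! i = ts' ! i" if "i < length ts" for i
  proof (rule Node.IH[OF nth_mem[OF that] a(3)[OF that]])
    fix w assume "w \<in> pos (ts ! i)"
    then show "Suc (length w) < M'"
      using Node.prems(2)[of "Suc i # w"] that M by (simp add: Suc_Cons_in_pos_Node)
  qed
  then show ?case using a(1,2) t' by (simp add: list_eq_iff_nth_eq)
qed

definition big :: "nat \<Rightarrow> 'f tree \<Rightarrow> bool" where
  "big n t \<longleftrightarrow> (\<exists>w\<in>pos t. length w = n - 1)"

text \<open>
  State \<open>p < n\<close> at a position \<open>u\<close> whose subtree \<open>t\<close> is big is encoded by the position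
  \<open>u @ code n t p\<close>, the \<open>p\<close>-th one on a chosen path of length \<open>n - 1\<close>.
\<close>

definition code :: "nat \<Rightarrow> 'f tree \<Rightarrow> nat \<Rightarrow> nat list" where
  "code n t p = take p (SOME w. w \<in> pos t \<and> length w = n - 1)"

lemma code:
  assumes "big n t" "p < n"
  shows "code n t p \<in> pos t" "length (code n t p) = p"
proof -
  have "\<exists>w. w \<in> pos t \<and> length w = n - 1" using assms(1) by (auto simp: big_def)
  then have *: "(SOME w. w \<in> pos t \<and> length w = n - 1) \<in> pos t \<and> length (SOME w. w \<in> pos t \<and> length w = n - 1) = n - 1"
    by (rule someI_ex)
  then show "length (code n t p) = p" using assms(2) by (simp add: code_def)
  show "code n t p \<in> pos t"
    using pos_prefix[of "take p (SOME w. w \<in> pos t \<and> length w = n - 1)" "drop p (SOME w. w \<in> pos t \<and> length w = n - 1)" t] *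
    by (simp add: code_def)
qed

text \<open>Both depend only on the set of positions of length \<open>n - 1\<close>, and equal sets
  give the same chosen path.\<close>

lemma agree_big_code:
  assumes "agree n t t'" "0 < n"
  shows "big n t = big n t'" "code n t = code n t'"
proof -
  have eq: "w \<in> pos t \<and> length w = n - 1 \<longleftrightarrow> w \<in> pos t' \<and> length w = n - 1" for w
    using agree_pos[OF assms(1), of w] assms(2) by auto
  show "big n t = big n t'" using eq by (auto simp: big_def)
  show "code n t = code n t'" using eq by (simp add: code_def fun_eq_iff)
qed

lemma not_big:
  assumes "\<not> big n t" "w \<in> pos t" "0 < n"
  shows "Suc (length w) < n"
proof (rule ccontr)
  assume "\<not> Suc (length w) < n"
  moreover have "take (n - 1) w \<in> pos t"
    using pos_prefix[of "take (n - 1) w" "drop (n - 1) w" t] assms(2) by simp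
  ultimately have "big n t" unfolding big_def by (intro bexI[of _ "take (n - 1) w"]) simp_all
  then show False using assms(1) by simp
qed

text \<open>
  The positions of length \<open>d\<close> with a big subtree. The other subtrees at this depth have bounded size
  and are evaluated together with the block above them.
\<close>

fun holes :: "nat \<Rightarrow> nat \<Rightarrow> 'f tree \<Rightarrow> nat list list" where
  "holes n 0 t = (if big n t then [[]] else [])"
| "holes n (Suc d) (Node f ts) = concat (map (\<lambda>i. map ((#) (Suc i)) (holes n d (ts ! i))) [0..<length ts])"

lemma set_holes_Suc:
  "set (holes n (Suc d) (Node f ts)) = (\<Union>i<length ts. (#) (Suc i) ` set (holes n d (ts ! i)))"
  by auto

lemma holes_props:
  "h \<in> set (holes n d t) \<Longrightarrow> length h = d \<and> h \<in> pos t \<and> big n (subtree t h)"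
proof (induction n d t arbitrary: h rule: holes.induct)
  case (1 n t)
  then show ?case by (simp add: Nil_in_pos split: if_splits)
next
  case (2 n d f ts)
  then obtain i h' where "h = Suc i # h'" "i < length ts" "h' \<in> set (holes n d (ts ! i))"
    unfolding set_holes_Suc by auto
  then show ?case using 2(1)[of i h'] by (simp add: Suc_Cons_in_pos_Node)
qed

lemma sorted_holes: "sorted_wrt (<) (holes n d t)"
proof (induction n d t rule: holes.induct)
  case (2 n d f ts)
  have "sorted_wrt (<) (concat (map (\<lambda>i. map ((#) (Suc i)) (holes n d (ts ! i))) [0..<k]))" if "k \<le> length ts" for k
    using that
  proof (induction k)
    case (Suc k)
    have "sorted_wrt (<) (map ((#) (Suc k)) (holes n d (ts ! k)))"
      using 2[of k] Suc.prems by (simp add: sorted_wrt_map)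
    moreover have "x < y" if "x \<in> set (concat (map (\<lambda>i. map ((#) (Suc i)) (holes n d (ts ! i))) [0..<k]))"
      "y \<in> set (map ((#) (Suc k)) (holes n d (ts ! k)))" for x y
      using that by auto
    ultimately show ?case using Suc by (simp add: sorted_wrt_append)
  qed simp
  then show ?case by simp
qed simp

lemma agree_holes:
  "agree (d + n) t t' \<Longrightarrow> 0 < n \<Longrightarrow> holes n d t = holes n d t'"
proof (induction n d t arbitrary: t' rule: holes.induct)
  case (1 n t)
  then show ?case using agree_big_code(1)[of n t t'] by simp
next
  case (2 n d f ts)
  obtain f' ts' where t': "t' = Node f' ts'" by (cases t')
  have "agree (Suc (d + n)) (Node f ts) (Node f' ts')" using 2(2) t' by simp
  note a = agree_Node[OF this]
  have "holes n d (ts ! i) = holes n d (ts' ! i)" if "i < length ts" for i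
    using 2(1)[of i "ts' ! i"] a(3) 2(3) that by simp
  then show ?case using a(2) 2(3) t' by (auto intro!: arg_cong[where f = concat])
qed

text \<open>This bounds the number of blocks directly below a block, hence the size \<open>m\<close>
  of the family.\<close>

lemma holes_length_le:
  assumes "t \<in> trees rk"
  shows "length (holes n d t) \<le> maxrk rk ^ d"
proof -
  have "distinct (holes n d t)"
    using sorted_holes strict_sorted_iff by blast
  then have "length (holes n d t) = card (set (holes n d t))" by (simp add: distinct_card)
  also have "\<dots> \<le> card {w. set w \<subseteq> {1..maxrk rk} \<and> length w = d}"
  proof (rule card_mono)
    show "set (holes n d t) \<subseteq> {w. set w \<subseteq> {1..maxrk rk} \<and> length w = d}"
      using holes_props pos_bounds[OF assms] by fastforce
  qed (simp add: finite_lists_length_eq)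
  also have "\<dots> = maxrk rk ^ d" by (simp add: card_lists_length_eq)
  finally show ?thesis .
qed

text \<open>A weighted tree automaton with states \<open>{..<n}\<close> and final state \<open>0\<close>, given by its weights.\<close>

locale automaton =
  fixes n :: nat
    and c :: "nat list \<Rightarrow> 'f \<Rightarrow> nat \<Rightarrow> 's::{comm_semiring_0, comm_monoid_mult}"
    and H :: "nat \<Rightarrow> 'f tree \<Rightarrow> 's"
  assumes n: "0 < n"
    and H_Node: "q < n \<Longrightarrow> H q (Node f ts) =
      (\<Sum>ps\<in>tuples {..<n} (length ts). c ps f q * (\<Prod>i<length ts. H (ps ! i) (ts ! i)))"
begin

text \<open>The weight of state \<open>q\<close> at \<open>t\<close> when the state at each hole \<open>w\<close> is forced to be \<open>\<eta> w\<close>.\<close>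

fun cut :: "nat \<Rightarrow> 'f tree \<Rightarrow> (nat list \<Rightarrow> nat) \<Rightarrow> nat \<Rightarrow> 's" where
  "cut 0 t \<eta> q = (if big n t then tv (\<eta> [] = q) else H q t)"
| "cut (Suc d) (Node f ts) \<eta> q =
    (\<Sum>ps\<in>tuples {..<n} (length ts). c ps f q * (\<Prod>i\<in>{..<length ts}. cut d (ts ! i) (down i \<eta>) (ps ! i)))"

lemma cut_local:
  "\<forall>w\<in>set (holes n d t). \<eta> w = \<eta>' w \<Longrightarrow> cut d t \<eta> q = cut d t \<eta>' q"
proof (induction d t \<eta> q arbitrary: \<eta>' rule: cut.induct)
  case (1 t \<eta> q)
  then show ?case by simp
next
  case (2 d f ts \<eta> q)
  have "cut d (ts ! i) (down i \<eta>) (ps ! i) = cut d (ts ! i) (down i \<eta>') (ps ! i)"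
    if "ps \<in> tuples {..<n} (length ts)" "i \<in> {..<length ts}" for ps i
    using 2(1)[OF that] 2(2) that(2) unfolding set_holes_Suc by (simp add: down_def)
  then show ?case by simp
qed

text \<open>The next \<open>n\<close> levels below depth \<open>d\<close> decide whether a subtree
  there is big, and they contain it completely if it is not.\<close>

lemma agree_cut:
  "agree (d + n) t t' \<Longrightarrow> cut d t \<eta> q = cut d t' \<eta> q"
proof (induction d t \<eta> q arbitrary: t' rule: cut.induct)
  case (1 t \<eta> q)
  then have a: "agree n t t'" by simp
  show ?case
  proof (cases "big n t")
    case False
    then have "t = t'" using agree_eq[OF a] not_big[OF False _ n] by blast
    then show ?thesis by simp
  qed (use agree_big_code(1)[OF a n] in simp)
next
  case (2 d f ts \<eta> q)
  obtain f' ts' where t': "t' = Node f' ts'" by (cases t')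
  have "agree (Suc (d + n)) (Node f ts) (Node f' ts')" using 2(2) t' by simp
  note a = agree_Node[OF this]
  have "cut d (ts ! i) (down i \<eta>) (ps ! i) = cut d (ts' ! i) (down i \<eta>) (ps ! i)"
    if "ps \<in> tuples {..<n} (length ts)" "i \<in> {..<length ts}" for ps i
    using 2(1)[OF that] a(3) n that(2) by simp
  then show ?case using a(1,2) n t' by simp
qed

text \<open>A run splits into the part above the holes and the runs below them. For
  \<open>d = 0\<close> and a big tree the sum over \<open>\<eta> []\<close> just selects
  \<open>q\<close>; the step multiplies out the sums at the children.\<close>

lemma H_cut:
  "q < n \<Longrightarrow> H q t = (\<Sum>\<eta>\<in>set (holes n d t) \<rightarrow>\<^sub>E {..<n}.
    cut d t \<eta> q * (\<Prod>w\<in>set (holes n d t). H (\<eta> w) (subtree t w)))"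
proof (induction d arbitrary: t q)
  case 0
  show ?case
  proof (cases "big n t")
    case True
    have "(\<Sum>\<eta>\<in>{[] :: nat list} \<rightarrow>\<^sub>E {..<n}. tv (\<eta> [] = q) * H (\<eta> []) t) = (\<Sum>p<n. tv (p = q) * H p t)"
      by (rule sum.reindex_bij_witness[where j = "\<lambda>\<eta>. \<eta> []" and i = "\<lambda>p. restrict (\<lambda>_. p) {[]}"])
        (auto simp: fun_eq_iff restrict_def PiE_iff extensional_def)
    also have "\<dots> = H q t" using 0 by (simp add: sum_tv)
    finally show ?thesis using True by simp
  qed simp
next
  case (Suc d)
  obtain f ts where t: "t = Node f ts" by (cases t)
  let ?k = "length ts"
  let ?h = "\<lambda>i. set (holes n d (ts ! i))"
  let ?S = "set (holes n (Suc d) (Node f ts))"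
  let ?g = "\<lambda>i \<eta> p. cut d (ts ! i) \<eta> p * (\<Prod>w\<in>?h i. H (\<eta> w) (subtree (ts ! i) w))"
  let ?G = "\<lambda>\<eta>. cut (Suc d) (Node f ts) \<eta> q * (\<Prod>w\<in>?S. H (\<eta> w) (subtree (Node f ts) w))"
  let ?D = "PiE {..<?k} (\<lambda>i. ?h i \<rightarrow>\<^sub>E {..<n})"
  have G: "?G (graft undefined \<eta>s) = (\<Sum>ps\<in>tuples {..<n} ?k. c ps f q * (\<Prod>i<?k. ?g i (\<eta>s i) (ps ! i)))" for \<eta>s
  proof -
    have "(\<Prod>w\<in>?S. H (graft undefined \<eta>s w) (subtree (Node f ts) w)) =
        (\<Prod>i<?k. \<Prod>w\<in>(#) (Suc i) ` ?h i. H (graft undefined \<eta>s w) (subtree (Node f ts) w))"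
      unfolding set_holes_Suc by (rule prod.UNION_disjoint) auto
    also have "\<dots> = (\<Prod>i<?k. \<Prod>w\<in>?h i. H (\<eta>s i w) (subtree (ts ! i) w))"
      by (rule prod.cong[OF refl], subst prod.reindex) (auto simp: graft_def)
    finally show ?thesis
      by (simp add: sum_distrib_right prod.distrib mult.assoc)
  qed
  have "(\<Sum>\<eta>\<in>?S \<rightarrow>\<^sub>E {..<n}. ?G \<eta>) = (\<Sum>\<eta>s\<in>?D. ?G (graft undefined \<eta>s))"
  proof (rule sum_PiE_children[OF set_holes_Suc])
    fix \<eta> \<eta>' :: "nat list \<Rightarrow> nat" assume eq: "\<forall>w\<in>?S. \<eta> w = \<eta>' w"
    then have "cut (Suc d) (Node f ts) \<eta> q = cut (Suc d) (Node f ts) \<eta>' q" by (rule cut_local)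
    moreover have "(\<Prod>w\<in>?S. H (\<eta> w) (subtree (Node f ts) w)) = (\<Prod>w\<in>?S. H (\<eta>' w) (subtree (Node f ts) w))"
      by (rule prod.cong[OF refl]) (simp only: bspec[OF eq])
    ultimately show "?G \<eta> = ?G \<eta>'" by (simp only:)
  qed
  also have "\<dots> = (\<Sum>\<eta>s\<in>?D. \<Sum>ps\<in>tuples {..<n} ?k. c ps f q * (\<Prod>i<?k. ?g i (\<eta>s i) (ps ! i)))"
    by (rule sum.cong[OF refl]) (rule G)
  also have "\<dots> = (\<Sum>ps\<in>tuples {..<n} ?k. c ps f q * (\<Sum>\<eta>s\<in>?D. \<Prod>i<?k. ?g i (\<eta>s i) (ps ! i)))"
    by (subst sum.swap) (simp only: sum_distrib_left)
  also have "\<dots> = (\<Sum>ps\<in>tuples {..<n} ?k. c ps f q * (\<Prod>i<?k. \<Sum>\<eta>\<in>?h i \<rightarrow>\<^sub>E {..<n}. ?g i \<eta> (ps ! i)))"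
    by (subst prod_sum_distrib_PiE) (simp_all add: finite_PiE)
  also have "\<dots> = (\<Sum>ps\<in>tuples {..<n} ?k. c ps f q * (\<Prod>i<?k. H (ps ! i) (ts ! i)))"
  proof (rule sum.cong[OF refl])
    fix ps assume ps: "ps \<in> tuples {..<n} ?k"
    have "(\<Prod>i<?k. \<Sum>\<eta>\<in>?h i \<rightarrow>\<^sub>E {..<n}. ?g i \<eta> (ps ! i)) = (\<Prod>i<?k. H (ps ! i) (ts ! i))"
      by (rule prod.cong[OF refl], rule Suc.IH[symmetric]) (use tuples_nth[OF ps] in auto)
    then show "c ps f q * (\<Prod>i<?k. \<Sum>\<eta>\<in>?h i \<rightarrow>\<^sub>E {..<n}. ?g i \<eta> (ps ! i)) =
      c ps f q * (\<Prod>i<?k. H (ps ! i) (ts ! i))" by (simp only:)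
  qed
  also have "\<dots> = H q t" using H_Node[OF Suc.prems] t by simp
  finally show ?case using t by simp
qed

end

text \<open>The final states are merged into a new state \<open>0\<close>; the old ones are
  renumbered from 1, and a tuple containing \<open>0\<close> gets weight 0. The number
  \<open>0\<close> is what the start position \<open>[]\<close> encodes, by its length.\<close>

lemma recognizable_automaton:
  fixes r :: "'f tree \<Rightarrow> 's::{comm_semiring_0, comm_monoid_mult}"
  assumes "recognizable rk r"
  shows "\<exists>n c H. automaton n c H \<and> (\<forall>\<xi>\<in>trees rk. r \<xi> = H 0 \<xi>)"
proof -
  obtain A :: "(nat, 'f, 's) wta" where A: "is_wta A" and r: "\<And>\<xi>. \<xi> \<in> trees rk \<Longrightarrow> r \<xi> = wta_language A \<xi>"
    using assms unfolding recognizable_def by blast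
  let ?m = "card (states A)"
  obtain e where e: "bij_betw e {..<?m} (states A)"
    using A ex_bij_betw_nat_finite[of "states A"] by (auto simp: is_wta_def lessThan_atLeast0)
  define d where "d = the_inv_into {..<?m} e"
  have de: "d (e j) = j" if "j < ?m" for j
    unfolding d_def using e that by (intro the_inv_into_f_f) (auto simp: bij_betw_def)
  have ed: "e (d q) = q" "d q < ?m" if "q \<in> states A" for q
    using e that f_the_inv_into_f[of e "{..<?m}" q] the_inv_into_into[of e "{..<?m}" q "{..<?m}"]
    by (auto simp: d_def bij_betw_def)
  define H where "H q \<xi> = (if q = 0 then wta_language A \<xi> else run_weight A \<xi> (e (q - 1)))" for q \<xi>
  define c where "c ps f q = (if 0 \<in> set ps then 0 else
      if q = 0 then \<Sum>p\<in>final A. trans A (map (\<lambda>p. e (p - 1)) ps) f p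
      else trans A (map (\<lambda>p. e (p - 1)) ps) f (e (q - 1)))" for ps f q
  \<comment> \<open>The sums may range over the new state as well, since the tuples in which it
    occurs contribute 0.\<close>
  have run: "(\<Sum>ps\<in>tuples (states A) (length ts). a ps * (\<Prod>i<length ts. run_weight A (ts ! i) (ps ! i))) =
      (\<Sum>ps\<in>tuples {..<Suc ?m} (length ts). (if 0 \<in> set ps then 0 else a (map (\<lambda>p. e (p - 1)) ps)) *
        (\<Prod>i<length ts. H (ps ! i) (ts ! i)))" for a :: "nat list \<Rightarrow> 's" and ts
  proof -
    let ?k = "length ts"
    let ?B = "\<lambda>ps. a (map (\<lambda>p. e (p - 1)) ps) * (\<Prod>i<?k. H (ps ! i) (ts ! i))"
    have "(\<Sum>ps\<in>tuples {..<Suc ?m} ?k. (if 0 \<in> set ps then 0 else a (map (\<lambda>p. e (p - 1)) ps)) *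
        (\<Prod>i<?k. H (ps ! i) (ts ! i))) = (\<Sum>ps\<in>tuples (Suc ` {..<?m}) ?k. ?B ps)"
      by (rule sum.mono_neutral_cong_right[OF finite_tuples]) (auto simp: tuples_def subset_iff image_iff less_Suc_eq_0_disj)
    also have "\<dots> = (\<Sum>ps\<in>tuples (states A) ?k. a ps * (\<Prod>i<?k. run_weight A (ts ! i) (ps ! i)))"
    proof (rule sum.reindex_bij_witness[where i = "map (\<lambda>q. Suc (d q))" and j = "map (\<lambda>p. e (p - 1))"])
      fix ps assume ps: "ps \<in> tuples (Suc ` {..<?m}) ?k"
      then show "map (\<lambda>q. Suc (d q)) (map (\<lambda>p. e (p - 1)) ps) = ps"
        by (auto simp: tuples_def de intro!: map_idI)
      show "map (\<lambda>p. e (p - 1)) ps \<in> tuples (states A) ?k"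
        using tuples_map[OF ps, of "\<lambda>p. e (p - 1)"] e by (simp add: image_image bij_betw_def)
      have "H (ps ! i) (ts ! i) = run_weight A (ts ! i) (map (\<lambda>p. e (p - 1)) ps ! i)" if "i < ?k" for i
        using tuples_nth[OF ps that] ps that by (auto simp: H_def tuples_def)
      then show "a (map (\<lambda>p. e (p - 1)) ps) * (\<Prod>i<?k. run_weight A (ts ! i) (map (\<lambda>p. e (p - 1)) ps ! i)) = ?B ps"
        by simp
    next
      fix qs assume qs: "qs \<in> tuples (states A) ?k"
      then show "map (\<lambda>p. e (p - 1)) (map (\<lambda>q. Suc (d q)) qs) = qs"
        by (auto simp: tuples_def ed intro!: map_idI)
      show "map (\<lambda>q. Suc (d q)) qs \<in> tuples (Suc ` {..<?m}) ?k"
        using qs by (auto simp: tuples_def ed(2) subset_iff)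
    qed
    finally show ?thesis by simp
  qed
  have rw: "run_weight A (Node f ts) q =
      (\<Sum>ps\<in>tuples (states A) (length ts). trans A ps f q * (\<Prod>i<length ts. run_weight A (ts ! i) (ps ! i)))" for f ts q
    by (simp add: tuples_def)
  have "automaton (Suc ?m) c H"
  proof
    fix q f ts assume "q < Suc ?m"
    show "H q (Node f ts) = (\<Sum>ps\<in>tuples {..<Suc ?m} (length ts). c ps f q * (\<Prod>i<length ts. H (ps ! i) (ts ! i)))"
    proof (cases "q = 0")
      case True
      have "wta_language A (Node f ts) = (\<Sum>ps\<in>tuples (states A) (length ts).
          (\<Sum>p\<in>final A. trans A ps f p) * (\<Prod>i<length ts. run_weight A (ts ! i) (ps ! i)))"
        unfolding wta_language_def rw by (subst sum.swap) (simp only: sum_distrib_right)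
      also have "\<dots> = (\<Sum>ps\<in>tuples {..<Suc ?m} (length ts). c ps f q * (\<Prod>i<length ts. H (ps ! i) (ts ! i)))"
        unfolding run by (rule sum.cong[OF refl]) (simp add: c_def True)
      finally show ?thesis by (simp add: H_def True)
    next
      case False
      have "run_weight A (Node f ts) (e (q - 1)) =
          (\<Sum>ps\<in>tuples {..<Suc ?m} (length ts). c ps f q * (\<Prod>i<length ts. H (ps ! i) (ts ! i)))"
        unfolding rw run by (rule sum.cong[OF refl]) (simp add: c_def False)
      then show ?thesis by (simp add: H_def False del: run_weight.simps)
    qed
  qed simp
  moreover have "\<forall>\<xi>\<in>trees rk. r \<xi> = H 0 \<xi>" using r by (simp add: H_def)
  ultimately show ?thesis by blast
qed

section \<open>From automata to branching transitive closures\<close>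

text \<open>Case distinction on one predicate at a time: \<open>\<alpha>\<close> and its negation
  have values 0 and 1, so the disjunction acts as a conditional. Constants at the end realize an
  arbitrary \<open>g\<close>.\<close>

lemma (in fo_class) step_of_vector:
  assumes "finite I" "\<And>i. i \<in> I \<Longrightarrow> Def V W (P i)"
  shows "\<exists>\<phi>\<in>step L. free1 \<phi> \<subseteq> V \<and> free2 \<phi> \<subseteq> W \<and> (\<forall>\<xi>\<in>trees rk. \<forall>\<rho> \<tau>. (\<forall>x. \<rho> x \<in> pos \<xi>) \<longrightarrow>
    sem \<phi> \<xi> \<rho> \<tau> = g {i\<in>I. P i \<xi> \<rho> \<tau>})"
  using assms
proof (induction I arbitrary: g rule: finite_induct)
  case empty
  show ?case by (rule bexI[of _ "Const (g {})"]) (simp_all add: step.intros)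
next
  case (insert i I)
  obtain \<phi> where \<phi>: "\<phi> \<in> step L" "free1 \<phi> \<subseteq> V" "free2 \<phi> \<subseteq> W"
    "\<forall>\<xi>\<in>trees rk. \<forall>\<rho> \<tau>. (\<forall>x. \<rho> x \<in> pos \<xi>) \<longrightarrow> sem \<phi> \<xi> \<rho> \<tau> = g (insert i {i\<in>I. P i \<xi> \<rho> \<tau>})"
    using insert(3)[of "\<lambda>S. g (insert i S)"] insert(4) by blast
  obtain \<psi> where \<psi>: "\<psi> \<in> step L" "free1 \<psi> \<subseteq> V" "free2 \<psi> \<subseteq> W"
    "\<forall>\<xi>\<in>trees rk. \<forall>\<rho> \<tau>. (\<forall>x. \<rho> x \<in> pos \<xi>) \<longrightarrow> sem \<psi> \<xi> \<rho> \<tau> = g {i\<in>I. P i \<xi> \<rho> \<tau>}"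
    using insert(3)[of g] insert(4) by blast
  obtain \<alpha> where \<alpha>: "\<alpha> \<in> L" "free1 \<alpha> \<subseteq> V" "free2 \<alpha> \<subseteq> W"
    "\<forall>\<xi>\<in>trees rk. \<forall>\<rho> \<tau>. (\<forall>x. \<rho> x \<in> pos \<xi>) \<longrightarrow> sem \<alpha> \<xi> \<rho> \<tau> = tv (P i \<xi> \<rho> \<tau>)"
    using insert(4)[of i] unfolding Def_def expresses_def by blast
  let ?\<chi> = "Or (And \<alpha> \<phi>) (And (Neg \<alpha>) \<psi>)"
  have "?\<chi> \<in> step L"
    by (intro step.intros(3-5) \<phi>(1) \<psi>(1) step.intros(2)[OF \<alpha>(1)])
  moreover have "free1 ?\<chi> \<subseteq> V" "free2 ?\<chi> \<subseteq> W" using \<phi>(2,3) \<psi>(2,3) \<alpha>(2,3) by simp_all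
  moreover have "sem ?\<chi> \<xi> \<rho> \<tau> = g {j\<in>insert i I. P j \<xi> \<rho> \<tau>}"
    if "\<xi> \<in> trees rk" "\<forall>x. \<rho> x \<in> pos \<xi>" for \<xi> \<rho> \<tau>
  proof -
    have \<alpha>s: "sem \<alpha> \<xi> \<rho> \<tau> = tv (P i \<xi> \<rho> \<tau>)" using \<alpha>(4) that by blast
    have \<phi>s: "sem \<phi> \<xi> \<rho> \<tau> = g (insert i {i\<in>I. P i \<xi> \<rho> \<tau>})" using \<phi>(4) that by blast
    have \<psi>s: "sem \<psi> \<xi> \<rho> \<tau> = g {i\<in>I. P i \<xi> \<rho> \<tau>}" using \<psi>(4) that by blast
    have "{j\<in>insert i I. P j \<xi> \<rho> \<tau>} = (if P i \<xi> \<rho> \<tau> then insert i {i\<in>I. P i \<xi> \<rho> \<tau>} else {i\<in>I. P i \<xi> \<rho> \<tau>})"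
      by auto
    moreover have "sem (Neg \<alpha>) \<xi> \<rho> \<tau> = tv (\<not> P i \<xi> \<rho> \<tau>)" by (rule sem_Neg[OF \<alpha>s])
    ultimately show ?thesis by (simp only: sem.simps(7,8) \<alpha>s \<phi>s \<psi>s) simp
  qed
  ultimately show ?case by blast
qed

lemma (in fo_class) Def_append:
  assumes "set w \<subseteq> {1..maxrk rk}" "x \<in> V" "y \<in> V" "finite V"
  shows "Def V W (\<lambda>\<xi> \<rho> \<tau>. \<rho> y = \<rho> x @ w)"
  using assms
proof (induction w arbitrary: V y rule: rev_induct)
  case Nil
  then show ?case by (simp add: Def_eq)
next
  case (snoc i w)
  show ?case
  proof (rule Def_cong)
    show "Def V W (\<lambda>\<xi> \<rho> \<tau>. \<exists>z\<in>pos \<xi>. z = \<rho> x @ w \<and> \<rho> y = z @ [i])"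
      by (intro Def_ex Def_conj snoc.IH Def_edge) (use snoc.prems in auto)
    fix \<xi> and \<rho> :: "nat \<Rightarrow> nat list" assume "\<And>x. \<rho> x \<in> pos \<xi>"
    then show "\<rho> y = \<rho> x @ w @ [i] \<longleftrightarrow> (\<exists>z\<in>pos \<xi>. z = \<rho> x @ w \<and> \<rho> y = z @ [i])"
      using pos_prefix[of "\<rho> x @ w" "[i]" \<xi>] by (metis append_assoc)
  qed
qed

section \<open>The weight of a block as a step formula\<close>

definition rel :: "nat \<Rightarrow> nat list \<Rightarrow> nat list \<Rightarrow> nat list option" where
  "rel M u v = (if prefix u v \<and> length v < length u + M then Some (drop (length u) v) else None)"

lemma rel_Some_iff: "rel M u v = Some x \<longleftrightarrow> v = u @ x \<and> length x < M"
  by (auto simp: rel_def prefix_def)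

locale coding = fo_class rk L + automaton n c H
  for rk :: "'f::finite \<Rightarrow> nat" and L :: "('f, 's::{comm_semiring_0, comm_monoid_mult}, nat) mso set"
    and n and c :: "nat list \<Rightarrow> 'f \<Rightarrow> nat \<Rightarrow> 's" and H
begin

text \<open>
  The weight of a block as a function of the subtree at its base, the state there, and the
  positions that encode the states at the holes, relative to the base.
\<close>

definition block :: "'f tree \<Rightarrow> nat \<Rightarrow> nat list option list \<Rightarrow> 's" where
  "block t q xs = (let hs = holes n n t in
    if length xs = length hs \<and> (\<forall>i<length hs. \<exists>p<n. xs ! i = Some (hs ! i @ code n (subtree t (hs ! i)) p))
    then cut n t (\<lambda>w. length (the (the (map_of (zip hs xs) w))) mod n) q else 0)"

text \<open>Holes have depth \<open>n\<close>, and \<open>n\<close> more levels determine the codes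
  there and the small subtrees.\<close>

lemma agree_block:
  assumes "agree (n + n) t t'"
  shows "block t q xs = block t' q xs"
proof -
  have hs: "holes n n t' = holes n n t" using agree_holes[OF assms n] by simp
  have "code n (subtree t (holes n n t ! i)) = code n (subtree t' (holes n n t ! i))"
    if "i < length (holes n n t)" for i
    using holes_props[OF nth_mem[OF that]] assms n by (intro agree_big_code(2) agree_subtree) simp_all
  then show ?thesis unfolding block_def Let_def hs agree_cut[OF assms] by (simp cong: conj_cong)
qed

text \<open>The distance of \<open>v\<close> from its base, \<open>length v mod n\<close>, is the
  state at the base.\<close>

definition wt :: "'f tree \<Rightarrow> nat list \<Rightarrow> nat list list \<Rightarrow> 's" where
  "wt \<xi> v vs = block (subtree \<xi> (base n v)) (length v mod n) (map (rel (n + n) (base n v)) vs)"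

definition words :: "nat list set" where
  "words = {w. set w \<subseteq> {1..maxrk rk} \<and> length w \<le> n + n}"

text \<open>The atomic facts about a block, all relative to the base of variable \<open>0\<close>:
  the labels within reach and the places of the variables.\<close>

definition local_pred :: "nat list \<times> 'f + nat \<times> nat list \<Rightarrow> 'f tree \<Rightarrow> (nat \<Rightarrow> nat list) \<Rightarrow> bool" where
  "local_pred i \<xi> \<rho> = (case i of
      Inl (w, f) \<Rightarrow> \<exists>b\<in>pos \<xi>. \<exists>z\<in>pos \<xi>. b = base n (\<rho> 0) \<and> z = b @ w \<and> label_at \<xi> z = f
    | Inr (j, w) \<Rightarrow> \<exists>b\<in>pos \<xi>. b = base n (\<rho> 0) \<and> \<rho> j = b @ w)"

definition local_index :: "nat \<Rightarrow> (nat list \<times> 'f + nat \<times> nat list) set" where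
  "local_index k = (words \<times> UNIV) <+> ({0..k} \<times> words)"

lemma finite_local_index: "finite (local_index k)"
  by (simp add: local_index_def words_def finite_lists_length_le)

lemma Def_local_pred:
  assumes "i \<in> local_index k"
  shows "Def {0..k} {} (\<lambda>\<xi> \<rho> \<tau>. local_pred i \<xi> \<rho>)"
proof -
  consider w f where "i = Inl (w, f)" "w \<in> words" | j w where "i = Inr (j, w)" "j \<le> k" "w \<in> words"
    using assms by (auto simp: local_index_def)
  then show ?thesis
  proof cases
    case 1
    then show ?thesis unfolding local_pred_def 1(1) sum.case prod.case
      by (intro Def_ex Def_conj Def_base Def_append Def_label) (use n in \<open>auto simp: words_def\<close>)
  next
    case 2
    then show ?thesis unfolding local_pred_def 2(1) sum.case prod.case
      by (intro Def_ex Def_conj Def_base Def_append) (use n in \<open>auto simp: words_def\<close>)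
  qed
qed

lemma word_in_words:
  assumes "\<xi> \<in> trees rk" "u @ w \<in> pos \<xi>" "length w < n + n"
  shows "w \<in> words"
  using pos_bounds[OF assms(1,2)] assms(3) by (auto simp: words_def)

text \<open>One direction only, to be applied twice with the trees exchanged. A label fact also
  witnesses that the position exists.\<close>

lemma local_preds_imp:
  assumes eq: "\<And>i. i \<in> local_index k \<Longrightarrow> local_pred i \<xi> \<rho> \<Longrightarrow> local_pred i \<xi>' \<rho>'"
    and \<xi>: "\<xi> \<in> trees rk" "\<xi>' \<in> trees rk" and \<rho>: "\<And>x. \<rho> x \<in> pos \<xi>" "\<And>x. \<rho>' x \<in> pos \<xi>'"
  defines "u \<equiv> base n (\<rho> 0)" and "u' \<equiv> base n (\<rho>' 0)"
  shows "length w < n + n \<Longrightarrow> w \<in> pos (subtree \<xi> u) \<Longrightarrow>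
      w \<in> pos (subtree \<xi>' u') \<and> label_at (subtree \<xi> u) w = label_at (subtree \<xi>' u') w"
    and "j \<le> k \<Longrightarrow> rel (n + n) u (\<rho> j) = Some x \<Longrightarrow> rel (n + n) u' (\<rho>' j) = Some x"
proof -
  have pos: "u \<in> pos \<xi>" "u' \<in> pos \<xi>'"
    unfolding u_def u'_def by (rule base_in_pos[OF n \<rho>(1)], rule base_in_pos[OF n \<rho>(2)])
  show "w \<in> pos (subtree \<xi>' u') \<and> label_at (subtree \<xi> u) w = label_at (subtree \<xi>' u') w"
    if w: "length w < n + n" "w \<in> pos (subtree \<xi> u)"
  proof -
    have uw: "u @ w \<in> pos \<xi>" using w(2) pos by (simp add: append_in_pos_iff)
    let ?i = "Inl (w, label_at \<xi> (u @ w))"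
    have "?i \<in> local_index k" using word_in_words[OF \<xi>(1) uw w(1)] by (auto simp: local_index_def)
    moreover have "local_pred ?i \<xi> \<rho>" using uw pos by (simp add: local_pred_def u_def)
    ultimately have "local_pred ?i \<xi>' \<rho>'" by (rule eq)
    then have "u' @ w \<in> pos \<xi>'" "label_at \<xi>' (u' @ w) = label_at \<xi> (u @ w)"
      by (auto simp: local_pred_def u'_def)
    then show ?thesis using pos by (simp add: append_in_pos_iff label_at_append)
  qed
  show "rel (n + n) u' (\<rho>' j) = Some x" if "j \<le> k" "rel (n + n) u (\<rho> j) = Some x"
  proof -
    have x: "\<rho> j = u @ x" "length x < n + n" using that(2) by (simp_all add: rel_Some_iff)
    let ?i = "Inr (j, x)"
    have "x \<in> words" using word_in_words[OF \<xi>(1), of u x] \<rho>(1)[of j] x by simp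
    then have "?i \<in> local_index k" using that(1) by (auto simp: local_index_def)
    moreover have "local_pred ?i \<xi> \<rho>" using x pos by (simp add: local_pred_def u_def)
    ultimately have "local_pred ?i \<xi>' \<rho>'" by (rule eq)
    then show ?thesis using x(2) by (simp add: local_pred_def u'_def rel_Some_iff)
  qed
qed

text \<open>So the state at the base, too, is determined by a relative position, namely that of
  \<open>v\<close> itself.\<close>

lemma length_mod_eq_rel: "length v mod n = length (the (rel (n + n) (base n v) v))"
proof -
  have "length v mod n < n" using n by simp
  moreover have "v = base n v @ drop (length v - length v mod n) v" by (simp add: base_eq[OF n])
  ultimately have "rel (n + n) (base n v) v = Some (drop (length v - length v mod n) v)"
    unfolding rel_Some_iff by simp
  then show ?thesis by simp
qed

lemma local_preds_wt:
  assumes eq: "\<And>i. i \<in> local_index k \<Longrightarrow> local_pred i \<xi> \<rho> \<longleftrightarrow> local_pred i \<xi>' \<rho>'"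
    and \<xi>: "\<xi> \<in> trees rk" "\<xi>' \<in> trees rk" and \<rho>: "\<And>x. \<rho> x \<in> pos \<xi>" "\<And>x. \<rho>' x \<in> pos \<xi>'"
  shows "wt \<xi> (\<rho> 0) (map \<rho> [1..<Suc k]) = wt \<xi>' (\<rho>' 0) (map \<rho>' [1..<Suc k])"
proof -
  define u u' where u: "u = base n (\<rho> 0)" "u' = base n (\<rho>' 0)"
  have eq1: "local_pred i \<xi>' \<rho>'" if "i \<in> local_index k" "local_pred i \<xi> \<rho>" for i
    using eq[OF that(1)] that(2) by simp
  have eq2: "local_pred i \<xi> \<rho>" if "i \<in> local_index k" "local_pred i \<xi>' \<rho>'" for i
    using eq[OF that(1)] that(2) by simp
  have "w \<in> pos (subtree \<xi>' u') \<and> label_at (subtree \<xi> u) w = label_at (subtree \<xi>' u') w"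
    if "length w < n + n" "w \<in> pos (subtree \<xi> u)" for w
    unfolding u by (rule local_preds_imp(1)[of k \<xi> \<rho> \<xi>' \<rho>'], rule eq1) (use that \<xi> \<rho> u in simp_all)
  moreover have "w \<in> pos (subtree \<xi> u) \<and> label_at (subtree \<xi>' u') w = label_at (subtree \<xi> u) w"
    if "length w < n + n" "w \<in> pos (subtree \<xi>' u')" for w
    unfolding u by (rule local_preds_imp(1)[of k \<xi>' \<rho>' \<xi> \<rho>], rule eq2) (use that \<xi> \<rho> u in simp_all)
  ultimately have "agree (n + n) (subtree \<xi> u) (subtree \<xi>' u')"
    unfolding agree_def by blast
  moreover have rel: "rel (n + n) u (\<rho> j) = rel (n + n) u' (\<rho>' j)" if "j \<le> k" for j
  proof -
    have "rel (n + n) u' (\<rho>' j) = Some x" if "rel (n + n) u (\<rho> j) = Some x" for x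
      unfolding u by (rule local_preds_imp(2)[of k \<xi> \<rho> \<xi>' \<rho>'], rule eq1) (use that \<open>j \<le> k\<close> \<xi> \<rho> u in simp_all)
    moreover have "rel (n + n) u (\<rho> j) = Some x" if "rel (n + n) u' (\<rho>' j) = Some x" for x
      unfolding u by (rule local_preds_imp(2)[of k \<xi>' \<rho>' \<xi> \<rho>], rule eq2) (use that \<open>j \<le> k\<close> \<xi> \<rho> u in simp_all)
    ultimately show ?thesis by (metis option.exhaust)
  qed
  then have "length (\<rho> 0) mod n = length (\<rho>' 0) mod n"
    unfolding length_mod_eq_rel u[symmetric] by simp
  moreover have "map (rel (n + n) u) (map \<rho> [1..<Suc k]) = map (rel (n + n) u') (map \<rho>' [1..<Suc k])"
    using rel by (simp del: upt_Suc)
  ultimately show ?thesis unfolding wt_def u[symmetric] by (simp only: agree_block)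
qed

text \<open>The weight is a function of a finite vector of atomic facts. It is obtained by choice:
  any tree and assignment with the same vector have the same weight.\<close>

lemma step_wt:
  "\<exists>\<phi>\<in>step L. free1 \<phi> \<subseteq> {0..k} \<and> free2 \<phi> \<subseteq> {} \<and> (\<forall>\<xi>\<in>trees rk. \<forall>\<rho> \<tau>. (\<forall>x. \<rho> x \<in> pos \<xi>) \<longrightarrow>
    sem \<phi> \<xi> \<rho> \<tau> = wt \<xi> (\<rho> 0) (map \<rho> [1..<Suc k]))"
proof -
  let ?vec = "\<lambda>\<xi> \<rho>. {i\<in>local_index k. local_pred i \<xi> \<rho>}"
  define R where "R S a \<longleftrightarrow> (\<exists>\<xi>\<in>trees rk. \<exists>\<rho>. (\<forall>x. \<rho> x \<in> pos \<xi>) \<and> ?vec \<xi> \<rho> = S \<and>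
    a = wt \<xi> (\<rho> 0) (map \<rho> [1..<Suc k]))" for S a
  have "(SOME a. R (?vec \<xi> \<rho>) a) = wt \<xi> (\<rho> 0) (map \<rho> [1..<Suc k])"
    if \<xi>: "\<xi> \<in> trees rk" "\<forall>x. \<rho> x \<in> pos \<xi>" for \<xi> \<rho>
  proof (rule some_equality)
    show "R (?vec \<xi> \<rho>) (wt \<xi> (\<rho> 0) (map \<rho> [1..<Suc k]))"
      unfolding R_def using that by blast
    fix a assume "R (?vec \<xi> \<rho>) a"
    then obtain \<xi>' \<rho>' where *: "\<xi>' \<in> trees rk" "\<forall>x. \<rho>' x \<in> pos \<xi>'" "?vec \<xi>' \<rho>' = ?vec \<xi> \<rho>"
      "a = wt \<xi>' (\<rho>' 0) (map \<rho>' [1..<Suc k])"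
      unfolding R_def by blast
    have "local_pred i \<xi>' \<rho>' \<longleftrightarrow> local_pred i \<xi> \<rho>" if "i \<in> local_index k" for i
      using *(3) that by blast
    then show "a = wt \<xi> (\<rho> 0) (map \<rho> [1..<Suc k])"
      unfolding *(4) by (rule local_preds_wt[OF _ *(1) \<xi>(1)]) (use *(2) \<xi>(2) in simp_all)
  qed
  then show ?thesis
    using step_of_vector[of "local_index k" "{0..k}" "{}" "\<lambda>i \<xi> \<rho> \<tau>. local_pred i \<xi> \<rho>" "\<lambda>S. SOME a. R S a",
        OF finite_local_index Def_local_pred] by (simp del: upt_Suc)
qed

section \<open>Lists of successors with nonzero weight\<close>

context
  fixes \<xi> :: "'f tree" and v :: "nat list"
  assumes v: "v \<in> pos \<xi>"
begin

private abbreviation "u \<equiv> base n v"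
private abbreviation "t \<equiv> subtree \<xi> u"
private abbreviation "hs \<equiv> holes n n t"
private abbreviation "succ \<eta> \<equiv> map (\<lambda>h. u @ h @ code n (subtree t h) (\<eta> h)) hs"

lemma hole: "h \<in> set hs \<Longrightarrow> length h = n \<and> h \<in> pos t \<and> big n (subtree t h)"
  by (rule holes_props)

lemma distinct_hs: "distinct hs"
  using sorted_holes strict_sorted_iff by blast

lemma base_append:
  assumes "n dvd length w" "length x < n"
  shows "base n (w @ x) = w" "length (w @ x) mod n = length x"
proof -
  obtain k where "length w = n * k" using assms(1) by (rule dvdE)
  then have "length (w @ x) = length x + n * k" by simp
  then show m: "length (w @ x) mod n = length x" using assms(2) by (simp only: mod_mult_self2) simp
  show "base n (w @ x) = w" unfolding base_eq[OF n] m by simp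
qed

lemma hole_code:
  assumes "h \<in> set hs" "p < n"
  shows "u @ h @ code n (subtree t h) p \<in> pos \<xi>" "length (code n (subtree t h) p) = p"
    "base n (u @ h @ code n (subtree t h) p) = u @ h"
    "length (u @ h @ code n (subtree t h) p) mod n = p"
proof -
  have h: "length h = n" "h \<in> pos t" "big n (subtree t h)" using hole[OF assms(1)] by auto
  show len: "length (code n (subtree t h) p) = p" by (rule code(2)[OF h(3) assms(2)])
  have "h @ code n (subtree t h) p \<in> pos t"
    using code(1)[OF h(3) assms(2)] h(2) by (simp add: append_in_pos_iff)
  then show "u @ h @ code n (subtree t h) p \<in> pos \<xi>"
    using base_in_pos[OF n v] by (simp add: append_in_pos_iff)
  have "n dvd length (u @ h)" using dvd_length_base[OF n, of v] h(1) by simp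
  from base_append[OF this, of "code n (subtree t h) p"] assms(2) len
  show "base n (u @ h @ code n (subtree t h) p) = u @ h"
    "length (u @ h @ code n (subtree t h) p) mod n = p" by simp_all
qed

text \<open>A hole has length \<open>n\<close> and the code appended to it has length
  \<open>\<eta> h\<close>, so lengths modulo \<open>n\<close> give back
  \<open>\<eta>\<close>.\<close>

lemma wt_succ:
  assumes \<eta>: "\<eta> \<in> set hs \<rightarrow>\<^sub>E {..<n}"
  shows "wt \<xi> v (succ \<eta>) = cut n t \<eta> (length v mod n)"
proof -
  have p: "\<eta> h < n" if "h \<in> set hs" for h using \<eta> that by auto
  let ?xs = "map (rel (n + n) u) (succ \<eta>)"
  have xs: "?xs ! i = Some (hs ! i @ code n (subtree t (hs ! i)) (\<eta> (hs ! i)))" if "i < length hs" for i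
    using that nth_mem[OF that] hole[of "hs ! i"] hole_code(2)[of "hs ! i" "\<eta> (hs ! i)"] p[of "hs ! i"]
    by (simp add: rel_Some_iff)
  have "cut n t (\<lambda>w. length (the (the (map_of (zip hs ?xs) w))) mod n) (length v mod n) = cut n t \<eta> (length v mod n)"
  proof (rule cut_local, rule ballI)
    fix w assume w: "w \<in> set hs"
    then obtain i where i: "i < length hs" "w = hs ! i" by (auto simp: in_set_conv_nth)
    have "map_of (zip hs ?xs) (hs ! i) = Some (?xs ! i)"
      by (rule map_of_zip_nth) (use distinct_hs i in simp_all)
    then show "length (the (the (map_of (zip hs ?xs) w))) mod n = \<eta> w"
      unfolding i(2) using xs[OF i(1)] hole[OF w] hole_code(2)[OF w p[OF w]] p[OF w] by (simp add: i(2))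
  qed
  moreover have "\<forall>i<length hs. \<exists>p<n. ?xs ! i = Some (hs ! i @ code n (subtree t (hs ! i)) p)"
    using xs p nth_mem by blast
  ultimately show ?thesis unfolding wt_def block_def Let_def by simp
qed

text \<open>\<open>block\<close> is 0 unless each entry encodes a state at its hole; since the holes
  are distinct, these states form a function.\<close>

lemma wt_nonzero:
  assumes "wt \<xi> v vs \<noteq> 0"
  shows "\<exists>\<eta>\<in>set hs \<rightarrow>\<^sub>E {..<n}. vs = succ \<eta>"
proof -
  have len: "length vs = length hs"
    and m: "\<forall>i<length hs. \<exists>p<n. map (rel (n + n) u) vs ! i = Some (hs ! i @ code n (subtree t (hs ! i)) p)"
    using assms by (auto simp: wt_def block_def Let_def split: if_splits)
  have "\<forall>h\<in>set hs. \<exists>p. p < n \<and> (\<forall>i<length hs. hs ! i = h \<longrightarrow> vs ! i = u @ h @ code n (subtree t h) p)"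
  proof
    fix h assume "h \<in> set hs"
    then obtain i where i: "i < length hs" "h = hs ! i" by (auto simp: in_set_conv_nth)
    then obtain p where p: "p < n" "rel (n + n) u (vs ! i) = Some (h @ code n (subtree t h) p)"
      using m len by auto
    have "j = i" if "j < length hs" "hs ! j = h" for j
      using distinct_hs that i by (simp add: nth_eq_iff_index_eq)
    then show "\<exists>p. p < n \<and> (\<forall>i<length hs. hs ! i = h \<longrightarrow> vs ! i = u @ h @ code n (subtree t h) p)"
      using p by (intro exI[of _ p]) (auto simp: rel_Some_iff)
  qed
  from bchoice[OF this] obtain \<eta> where \<eta>0: "\<forall>h\<in>set hs. \<eta> h < n \<and>
      (\<forall>i<length hs. hs ! i = h \<longrightarrow> vs ! i = u @ h @ code n (subtree t h) (\<eta> h))"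
    by (rule exE)
  have \<eta>: "\<And>h. h \<in> set hs \<Longrightarrow> \<eta> h < n"
    "\<And>i. i < length hs \<Longrightarrow> vs ! i = u @ (hs ! i) @ code n (subtree t (hs ! i)) (\<eta> (hs ! i))"
    using \<eta>0 nth_mem by blast+
  have "vs = succ (restrict \<eta> (set hs))"
    using \<eta>(2) len by (intro nth_equalityI) simp_all
  moreover have "restrict \<eta> (set hs) \<in> set hs \<rightarrow>\<^sub>E {..<n}" using \<eta>(1) by simp
  ultimately show ?thesis by blast
qed

text \<open>The base of a successor is its hole, and the holes are listed in strictly increasing
  order. This makes the family progressing.\<close>

lemma next_base_succ:
  assumes \<eta>: "\<eta> \<in> set hs \<rightarrow>\<^sub>E {..<n}"
  shows "next_base n v (succ \<eta>)"
proof -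
  have b: "base n (u @ h @ code n (subtree t h) (\<eta> h)) = u @ h" if "h \<in> set hs" for h
    using hole_code(3)[OF that] \<eta> that by auto
  then have map: "map (base n) (succ \<eta>) = map ((@) u) hs" by simp
  moreover have "sorted_wrt (<) (map ((@) u) hs)"
    unfolding sorted_wrt_map
    by (rule sorted_wrt_mono_rel[OF _ sorted_holes]) (auto simp: list_less_def intro: lexord_append_leftI)
  moreover have "par n v w" if "w \<in> set (succ \<eta>)" for w
    using that b hole by (auto simp: par_def)
  ultimately show ?thesis unfolding next_base_iff map by blast
qed

lemma succ_in_tuples:
  assumes \<eta>: "\<eta> \<in> set hs \<rightarrow>\<^sub>E {..<n}"
  shows "succ \<eta> \<in> tuples (pos \<xi>) (length hs)"
  using hole_code(1) \<eta> by (auto simp: tuples_def)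

text \<open>Codes of different states have different lengths, so each choice of states is counted
  once.\<close>

lemma inj_succ: "inj_on (\<lambda>\<eta>. succ \<eta>) (set hs \<rightarrow>\<^sub>E {..<n})"
proof (rule inj_onI)
  fix \<eta> \<eta>' assume \<eta>: "\<eta> \<in> set hs \<rightarrow>\<^sub>E {..<n}" "\<eta>' \<in> set hs \<rightarrow>\<^sub>E {..<n}" and eq: "succ \<eta> = succ \<eta>'"
  show "\<eta> = \<eta>'"
  proof (rule PiE_ext[OF \<eta>])
    fix h assume h: "h \<in> set hs"
    then have "u @ h @ code n (subtree t h) (\<eta> h) = u @ h @ code n (subtree t h) (\<eta>' h)" using eq by simp
    then have eq_code: "code n (subtree t h) (\<eta> h) = code n (subtree t h) (\<eta>' h)" by (simp only: same_append_eq)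
    have lt: "\<eta> h < n" "\<eta>' h < n" using \<eta> h by auto
    show "\<eta> h = \<eta>' h"
      using hole_code(2)[OF h lt(1)] hole_code(2)[OF h lt(2)] unfolding eq_code by (rule trans[OF sym])
  qed
qed

end

text \<open>The sum over all lists collapses to the lists \<open>S \<eta>\<close>. With the
  induction hypothesis at the successors the equation becomes \<open>H_cut\<close> at depth
  \<open>n\<close>.\<close>

lemma wt_fixpoint:
  assumes \<xi>: "\<xi> \<in> trees rk"
    and m: "\<And>t. t \<in> trees rk \<Longrightarrow> length (holes n n t) \<le> m"
    and sub: "\<And>u. u \<in> pos \<xi> \<Longrightarrow> subtree \<xi> u \<in> trees rk"
    and T: "\<And>v. v \<in> pos \<xi> \<Longrightarrow> T v = (\<Sum>k\<le>m. \<Sum>vs\<in>tuples (pos \<xi>) k. wt \<xi> v vs * (\<Prod>i<k. T (vs ! i)))"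
    and v: "v \<in> pos \<xi>"
  shows "T v = H (length v mod n) (subtree \<xi> (base n v))"
  using v
proof (induction "card (below \<xi> n v)" arbitrary: v rule: less_induct)
  case less
  note v = less.prems
  let ?u = "base n v"
  let ?t = "subtree \<xi> ?u"
  let ?hs = "holes n n ?t"
  let ?E = "set ?hs \<rightarrow>\<^sub>E {..<n}"
  define S where "S = (\<lambda>\<eta>. map (\<lambda>h. ?u @ h @ code n (subtree ?t h) (\<eta> h)) ?hs)"
  have u: "?u \<in> pos \<xi>" by (rule base_in_pos[OF n v])
  have zero: "wt \<xi> v vs = 0" if "vs \<notin> S ` ?E" for vs
  proof (rule ccontr)
    assume "wt \<xi> v vs \<noteq> 0"
    then obtain \<eta> where "\<eta> \<in> ?E" "vs = S \<eta>" using wt_nonzero[OF v] unfolding S_def by blast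
    then show False using that by blast
  qed
  have len: "length ?hs \<le> m" by (rule m[OF sub[OF u]])
  have S_in: "S ` ?E \<subseteq> tuples (pos \<xi>) (length ?hs)"
    using succ_in_tuples[OF v] by (auto simp: S_def)
  have "T v = (\<Sum>k\<in>{length ?hs}. \<Sum>vs\<in>tuples (pos \<xi>) k. wt \<xi> v vs * (\<Prod>i<k. T (vs ! i)))"
    unfolding T[OF v]
  proof (rule sum.mono_neutral_right)
    show "\<forall>k\<in>{..m} - {length ?hs}. (\<Sum>vs\<in>tuples (pos \<xi>) k. wt \<xi> v vs * (\<Prod>i<k. T (vs ! i))) = 0"
    proof
      fix k assume k: "k \<in> {..m} - {length ?hs}"
      show "(\<Sum>vs\<in>tuples (pos \<xi>) k. wt \<xi> v vs * (\<Prod>i<k. T (vs ! i))) = 0"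
      proof (rule sum.neutral, rule ballI)
        fix vs assume "vs \<in> tuples (pos \<xi>) k"
        then have "vs \<notin> S ` ?E" using k S_in by (auto simp: tuples_def)
        then show "wt \<xi> v vs * (\<Prod>i<k. T (vs ! i)) = 0" by (simp add: zero)
      qed
    qed
  qed (use len in simp_all)
  also have "\<dots> = (\<Sum>vs\<in>tuples (pos \<xi>) (length ?hs). wt \<xi> v vs * (\<Prod>i<length ?hs. T (vs ! i)))"
    by simp
  also have "\<dots> = (\<Sum>vs\<in>S ` ?E. wt \<xi> v vs * (\<Prod>i<length ?hs. T (vs ! i)))"
    by (rule sum.mono_neutral_right[OF finite_tuples[OF finite_pos] S_in]) (auto simp: zero)
  also have "\<dots> = (\<Sum>\<eta>\<in>?E. wt \<xi> v (S \<eta>) * (\<Prod>i<length ?hs. T (S \<eta> ! i)))"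
    using inj_succ[OF v] by (simp add: sum.reindex S_def)
  also have "\<dots> = (\<Sum>\<eta>\<in>?E. cut n ?t \<eta> (length v mod n) * (\<Prod>h\<in>set ?hs. H (\<eta> h) (subtree ?t h)))"
  proof (rule sum.cong[OF refl])
    fix \<eta> assume \<eta>: "\<eta> \<in> ?E"
    have nb: "next_base n v (S \<eta>)" using next_base_succ[OF v \<eta>] by (simp add: S_def)
    have "T (S \<eta> ! i) = H (\<eta> (?hs ! i)) (subtree ?t (?hs ! i))" if i: "i < length ?hs" for i
    proof -
      let ?h = "?hs ! i"
      have h: "?h \<in> set ?hs" and p: "\<eta> ?h < n" using i \<eta> by auto
      have Si: "S \<eta> ! i = ?u @ ?h @ code n (subtree ?t ?h) (\<eta> ?h)" using i by (simp add: S_def)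
      note hc = hole_code[OF v h p, folded Si]
      have "card (below \<xi> n (S \<eta> ! i)) \<le> (\<Sum>i<length (S \<eta>). card (below \<xi> n (S \<eta> ! i)))"
        using i by (intro member_le_sum) (auto simp: S_def)
      also have "\<dots> < card (below \<xi> n v)" by (rule next_base_below[OF n v nb])
      finally have "T (S \<eta> ! i) = H (length (S \<eta> ! i) mod n) (subtree \<xi> (base n (S \<eta> ! i)))"
        by (rule less.hyps) (rule hc(1))
      then show ?thesis by (simp only: hc(3,4) subtree_append)
    qed
    then have "(\<Prod>i<length ?hs. T (S \<eta> ! i)) = (\<Prod>i<length ?hs. H (\<eta> (?hs ! i)) (subtree ?t (?hs ! i)))"
      by (intro prod.cong) simp_all
    also have "\<dots> = (\<Prod>h\<in>set ?hs. H (\<eta> h) (subtree ?t h))"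
      by (rule prod.reindex_bij_betw) (simp add: bij_betw_nth[OF distinct_hs[OF v]])
    finally show "wt \<xi> v (S \<eta>) * (\<Prod>i<length ?hs. T (S \<eta> ! i)) =
      cut n ?t \<eta> (length v mod n) * (\<Prod>h\<in>set ?hs. H (\<eta> h) (subtree ?t h))"
      using wt_succ[OF v \<eta>] by (simp add: S_def)
  qed
  also have "\<dots> = H (length v mod n) ?t"
    by (rule H_cut[symmetric]) (use n in simp)
  finally show ?case .
qed

end

lemma subtree_in_trees: "\<xi> \<in> trees rk \<Longrightarrow> u \<in> pos \<xi> \<Longrightarrow> subtree \<xi> u \<in> trees rk"
proof (induction \<xi> u rule: subtree.induct)
  case (2 f ts i w)
  from 2(2) have "\<And>t. t \<in> set ts \<Longrightarrow> t \<in> trees rk" by (cases rule: trees.cases) auto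
  then show ?case using 2 by (auto simp: Cons_in_pos_Node)
qed simp

theorem (in fo_class) recognizable_imp_BTC_definable:
  assumes "recognizable rk r"
  shows "BTC_definable rk (step L) r"
proof -
  obtain n c H where aut: "automaton n c H" and r: "\<And>\<xi>. \<xi> \<in> trees rk \<Longrightarrow> r \<xi> = H 0 \<xi>"
    using recognizable_automaton[OF assms] by blast
  interpret automaton n c H by (rule aut)
  interpret coding rk L n c H ..
  obtain \<Phi> where \<Phi>: "\<And>k. \<Phi> k \<in> step L \<and> free1 (\<Phi> k) \<subseteq> {0..k} \<and> free2 (\<Phi> k) \<subseteq> {} \<and>
    (\<forall>\<xi>\<in>trees rk. \<forall>\<rho> \<tau>. (\<forall>x. \<rho> x \<in> pos \<xi>) \<longrightarrow> sem (\<Phi> k) \<xi> \<rho> \<tau> = wt \<xi> (\<rho> 0) (map \<rho> [1..<Suc k]))"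
    using step_wt by metis
  \<comment> \<open>The maximal number of holes at depth \<open>n\<close>.\<close>
  define m where "m = maxrk rk ^ n"
  have sem: "sem (\<Phi> (length vs)) \<xi> (assign v vs) (\<lambda>_. {}) = wt \<xi> v vs"
    if "\<xi> \<in> trees rk" "v \<in> pos \<xi>" "set vs \<subseteq> pos \<xi>" for \<xi> v vs
  proof -
    have "map (assign v vs) [1..<Suc (length vs)] = vs"
      by (intro nth_equalityI) (simp_all add: assign_def del: upt_Suc)
    moreover have "assign v vs 0 = v" by (simp add: assign_def)
    moreover have "assign v vs x \<in> pos \<xi>" for x
      using that(2,3) Nil_in_pos[of \<xi>] nth_mem[of x "v # vs"] by (auto simp: assign_def)
    ultimately show ?thesis using \<Phi>[of "length vs"] that(1) by metis
  qed
  have fam: "is_family (step L) m \<Phi>" using \<Phi> by (simp add: is_family_def)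
  have prog: "progressing rk n m \<Phi>"
    unfolding progressing_def
  proof (intro ballI allI impI)
    fix \<xi> v vs assume *: "\<xi> \<in> trees rk" "v \<in> pos \<xi>" "set vs \<subseteq> pos \<xi>"
      and "sem (\<Phi> (length vs)) \<xi> (assign v vs) (\<lambda>_. {}) \<noteq> 0"
    then have "wt \<xi> v vs \<noteq> 0" using sem[OF *] by simp
    then show "next_base n v vs" using wt_nonzero[OF *(2)] next_base_succ[OF *(2)] by blast
  qed
  have "BTC_sem m \<Phi> \<xi> [] = r \<xi>" if \<xi>: "\<xi> \<in> trees rk" for \<xi>
  proof -
    \<comment> \<open>The root has length 0 and thus stores state \<open>0\<close>, so this value is
      \<open>H 0 \<xi>\<close>.\<close>
    have "BTC_sem m \<Phi> \<xi> [] = H (length ([] :: nat list) mod n) (subtree \<xi> (base n []))"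
    proof (rule wt_fixpoint[OF \<xi> _ subtree_in_trees[OF \<xi>] _ Nil_in_pos])
      show "length (holes n n t) \<le> m" if "t \<in> trees rk" for t :: "'f tree"
        unfolding m_def by (rule holes_length_le[OF that])
      fix v assume v: "v \<in> pos \<xi>"
      show "BTC_sem m \<Phi> \<xi> v = (\<Sum>k\<le>m. \<Sum>vs\<in>tuples (pos \<xi>) k. wt \<xi> v vs * (\<Prod>i<k. BTC_sem m \<Phi> \<xi> (vs ! i)))"
        unfolding BTC_sem_fixpoint[OF n fam prog \<xi> v]
        by (intro sum.cong refl) (auto simp: tuples_def sem[OF \<xi> v])
    qed
    then show ?thesis using r[OF \<xi>] by (simp add: base_eq[OF n])
  qed
  then show ?thesis unfolding BTC_definable_def using n fam prog by metis
qed

section \<open>The equivalence\<close>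

lemma BTC_definable_mono: "L \<subseteq> L' \<Longrightarrow> BTC_definable rk L r \<Longrightarrow> BTC_definable rk L' r"
  unfolding BTC_definable_def is_family_def by (meson subsetD)

lemma definable_mono: "L \<subseteq> L' \<Longrightarrow> definable rk L r \<Longrightarrow> definable rk L' r"
  unfolding definable_def by blast

lemma EA_mono: "L \<subseteq> L' \<Longrightarrow> EA L \<subseteq> EA L'"
  unfolding EA_def by blast

lemma EA_step_BMSO_subset_RMSO: "EA (step (BMSO rk)) \<subseteq> RMSO rk"
  unfolding EA_def by (auto intro: RMSO.intros)

theorem theorem4p1:
  fixes rk :: "'f::finite \<Rightarrow> nat"
    and r :: "'f tree \<Rightarrow> 's::{comm_semiring_0, comm_monoid_mult}"
  shows "(recognizable rk r \<longleftrightarrow> BTC_definable rk (step (BFO_mod rk)) r) \<and>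
    (recognizable rk r \<longleftrightarrow> BTC_definable rk (step (BMSO rk)) r) \<and>
    (recognizable rk r \<longleftrightarrow> definable rk (EA (step (BFO_mod rk))) r) \<and>
    (recognizable rk r \<longleftrightarrow> definable rk (EA (step (BMSO rk))) r) \<and>
    (recognizable rk r \<longleftrightarrow> definable rk (RMSO rk) r)"
proof -
  have sub: "step (BFO_mod rk) \<subseteq> (step (BMSO rk) :: ('f, 's, nat) mso set)"
    by (rule step_mono[OF BFO_mod_subset_BMSO])
  have "recognizable rk r \<Longrightarrow> BTC_definable rk (step (BFO_mod rk)) r"
    by (rule fo_class.recognizable_imp_BTC_definable[OF fo_class_BFO_mod])
  moreover have "BTC_definable rk (step (BFO_mod rk)) r \<Longrightarrow> BTC_definable rk (step (BMSO rk)) r"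
    by (rule BTC_definable_mono[OF sub])
  moreover have "BTC_definable rk (step (BFO_mod rk)) r \<Longrightarrow> definable rk (EA (step (BFO_mod rk))) r"
    by (rule fo_class.BTC_definable_imp_EA_definable[OF fo_class_BFO_mod])
  moreover have "BTC_definable rk (step (BMSO rk)) r \<Longrightarrow> definable rk (EA (step (BMSO rk))) r"
    by (rule fo_class.BTC_definable_imp_EA_definable[OF fo_class_BMSO])
  moreover have "definable rk (EA (step (BFO_mod rk))) r \<Longrightarrow> definable rk (EA (step (BMSO rk))) r"
    by (rule definable_mono[OF EA_mono[OF sub]])
  moreover have "definable rk (EA (step (BMSO rk))) r \<Longrightarrow> definable rk (RMSO rk) r"
    by (rule definable_mono[OF EA_step_BMSO_subset_RMSO])
  moreover have "definable rk (RMSO rk) r \<Longrightarrow> recognizable rk r"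
    by (rule RMSO_recognizable)
  ultimately show ?thesis by blast
qed

end
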